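(* Consider a monotone-separable network with $\gamma(0)<a$ satisfying (IA), (AA), (SE) and (H) (all defined in the context). Then $$\limsup_{x\to\infty}\frac{\mathbf{P}(Z>x)}{\overline{F}^s(x)}\le\lim_{L\to\infty}\lim_{x\to\infty}\frac{\mathbf{P}(\widehat R>x)}{\overline{F}^s(x)}=\frac{d}{a-\gamma(0)},$$ where $\widehat R=\widehat R_L$ is the stationary response time in the $L$-upper-bound $GI/GI/1/\infty$ queue associated with the network.
   Context: Asymptotic notation ($x\to\infty$): for $c>0$, $f\sim cg$ means $f(x)/g(x)\to c$; $f\sim cg$ with $c=0$ means $f(x)=o(g(x))$. Monotone-separable network. The input $N=\{T_n\}_{n\in\mathbb{Z}}$ is a nondecreasing real sequence of arrival epochs, $\tau_n=T_{n+1}-T_n$, and $\{\zeta_n\}_{n\in\mathbb{Z}}$ is a sequence with values in a measurable space $K$ (service times and routing decisions). There are measurable functions $f_l:\mathbb{R}^l\times K^l\to\mathbb{R}$, $l\ge1$, and for $m\le n$ one puts $X_{[m,n]}(N)=f_{n-m+1}\{(T_l,\zeta_l),\,m\le l\le n\}$ (the finite time of last activity when the network starts empty and is fed by $T_m,\ldots,T_n$). For all inputs $N$ and all $m\le n$ it is required that: (causality) $X_{[m,n]}(N)\ge T_n$; (external monotonicity) $X_{[m,n]}(N')\ge X_{[m,n]}(N)$ whenever $T'_k\ge T_k$ for all $k$; (homogeneity) $X_{[m,n]}(c+N)=X_{[m,n]}(N)+c$ for all $c\in\mathbb{R}$; (separability) for $m\le l<n$, if $X_{[m,l]}(N)\le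 T_{l+1}$ then $X_{[m,n]}(N)=X_{[l+1,n]}(N)$. Maximal daters: $Z_{[m,n]}(N)=X_{[m,n]}(N)-T_n$; $Z_n=Z_{[n,n]}(N)$ (which does not depend on $N$). The sequence $Z_{[-n,0]}(N)$ is nondecreasing in $n$, and $Z=Z_{(-\infty,0]}=\lim_{n\to\infty}Z_{[-n,0]}(N)$ is the stationary maximal dater. Stochastic assumptions: $\{(\tau_n,\zeta_n)\}$ is stationary and ergodic, $\mathbf{E}\tau_n=a=\lambda^{-1}<\infty$, $\mathbf{E}Z_n<\infty$. With $Q$ the degenerate input with all points equal to $0$, $\gamma(0)=\lim_n Z_{[-n,-1]}(Q)/n=\lim_n\mathbf{E}Z_{[-n,-1]}(Q)/n$ a.s. (these limits exist and are constant). Stability: $\gamma(0)<a$. (IA): the sequences $\{\zeta_n\}$ and $\{\tau_n\}$ are mutually independent and each consists of i.i.d. random variables. (AA): for all $i$, $Z_i=Y_i^{(1)}+\cdots+Y_i^{(r)}$, where the $Y_i^{(j)}$ are nonnegative, independent of the interarrival times, and the vectors $(Y_i^{(1)},\ldots,Y_i^{(r)})$ are i.i.d. in $i$ (with arbitrary dependence between the components of a vector); in addition, for all $n\le 0$, $Z_{[n,0]}(Q)\ge\max_{j}\sum_{i=n}^0Y_i^{(j)}$ a.s. (SE): $F$ is a distribution function on $\mathbb{R}^+$ such that (a) $F$ is subexponential with finite mean; (b) the integrated tail distribution $F^s$, with tail $\overline{F}^s(x)=1-F^s(x)=\min\{1,\int_x^\infty\overline{F}(u)\,du\}$, $\overline{F}=1-F$,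 is subexponential; (c) for all $j$, $\mathbf{P}(Y_1^{(j)}>x)\sim d^{(j)}\overline{F}(x)$ as $x\to\infty$, with $d^{(j)}\ge0$ and $d=\sum_jd^{(j)}>0$. (H): as $x\to\infty$, $\mathbf{P}(\sum_{j=1}^rY_1^{(j)}>x)\sim\mathbf{P}(\max_{j}Y_1^{(j)}>x)\sim\sum_{j=1}^r\mathbf{P}(Y_1^{(j)}>x)\sim\sum_{j=1}^rd^{(j)}\overline{F}(x)$. $L$-upper-bound queue: for an integer $L\ge1$ with $\mathbf{E}Z_{[-L,-1]}(Q)<La$ (this holds for all sufficiently large $L$), it is the single-server queue with service times $\widehat s_n=Z_{[L(n-1)+1,Ln]}(Q)$ and interarrival times $\widehat\tau_n=T_{Ln}-T_{L(n-1)}$; its stationary response time is $\widehat R=\widehat R_L=\widehat s_0+\sup_{k\ge0}\sum_{i=-k}^{-1}(\widehat s_i-\widehat\tau_{i+1})$ (with $\sum_{0}^{-1}=0$). *)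

theory Defs
  imports "HOL-Probability.Probability"
begin

text \<open>
  A network is given by functions \<open>f l\<close> of \<open>l\<close> arrival epochs and \<open>l\<close> marks; tuples of length \<open>l\<close>
  are extensional functions on \<open>{..<l}\<close>.  The argument \<open>z\<close> is the sequence of marks
  (service times and routing decisions).
\<close>

definition last_activity ::
  "(nat \<Rightarrow> (nat \<Rightarrow> real) \<times> (nat \<Rightarrow> 'k) \<Rightarrow> real) \<Rightarrow> int \<Rightarrow> int \<Rightarrow> (int \<Rightarrow> real) \<Rightarrow> (int \<Rightarrow> 'k) \<Rightarrow> real"
  where
  "last_activity f m n t z =
     (let l = nat (n - m + 1)
      in f l (\<lambda>i\<in>{..<l}. t (m + int i), \<lambda>i\<in>{..<l}. z (m + int i)))"

definition maximal_dater ::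
  "(nat \<Rightarrow> (nat \<Rightarrow> real) \<times> (nat \<Rightarrow> 'k) \<Rightarrow> real) \<Rightarrow> int \<Rightarrow> int \<Rightarrow> (int \<Rightarrow> real) \<Rightarrow> (int \<Rightarrow> 'k) \<Rightarrow> real"
  where
  "maximal_dater f m n t z = last_activity f m n t z - t n"

text \<open>The maximal dater for the degenerate input all of whose points are equal to 0.\<close>

definition dater_Q ::
  "(nat \<Rightarrow> (nat \<Rightarrow> real) \<times> (nat \<Rightarrow> 'k) \<Rightarrow> real) \<Rightarrow> int \<Rightarrow> int \<Rightarrow> (int \<Rightarrow> 'k) \<Rightarrow> real"
  where
  "dater_Q f m n z = maximal_dater f m n (\<lambda>_. 0) z"

locale monotone_separable =
  fixes K :: "'k measure"
    and f :: "nat \<Rightarrow> (nat \<Rightarrow> real) \<times> (nat \<Rightarrow> 'k) \<Rightarrow> real"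
  assumes f_measurable:
      "\<And>l. 1 \<le> l \<Longrightarrow>
        f l \<in> borel_measurable ((\<Pi>\<^sub>M i\<in>{..<l}. borel) \<Otimes>\<^sub>M (\<Pi>\<^sub>M i\<in>{..<l}. K))"
    and causality:
      "\<And>m n t z. \<lbrakk>mono t; range z \<subseteq> space K; m \<le> n\<rbrakk> \<Longrightarrow> t n \<le> last_activity f m n t z"
    and external_monotonicity:
      "\<And>m n t t' z. \<lbrakk>mono t; mono t'; range z \<subseteq> space K; m \<le> n; \<And>k. t k \<le> t' k\<rbrakk>
        \<Longrightarrow> last_activity f m n t z \<le> last_activity f m n t' z"
    and homogeneity:
      "\<And>m n t z c. \<lbrakk>mono t; range z \<subseteq> space K; m \<le> n\<rbrakk>
        \<Longrightarrow> last_activity f m n (\<lambda>k. c + t k) z = last_activity f m n t z + c"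
    and separability:
      "\<And>m l n t z. \<lbrakk>mono t; range z \<subseteq> space K; m \<le> l; l < n;
           last_activity f m l t z \<le> t (l + 1)\<rbrakk>
        \<Longrightarrow> last_activity f m n t z = last_activity f (l + 1) n t z"

definition stationary_process :: "'w measure \<Rightarrow> 'e measure \<Rightarrow> (int \<Rightarrow> 'w \<Rightarrow> 'e) \<Rightarrow> bool"
  where
  "stationary_process M S \<xi> \<longleftrightarrow>
     (\<forall>n. \<xi> n \<in> measurable M S) \<and>
     distr M (\<Pi>\<^sub>M n\<in>UNIV. S) (\<lambda>\<omega> n. \<xi> (n + 1) \<omega>) = distr M (\<Pi>\<^sub>M n\<in>UNIV. S) (\<lambda>\<omega> n. \<xi> n \<omega>)"

definition ergodic_process :: "'w measure \<Rightarrow> 'e measure \<Rightarrow> (int \<Rightarrow> 'w \<Rightarrow> 'e) \<Rightarrow> bool"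
  where
  "ergodic_process M S \<xi> \<longleftrightarrow>
     (\<forall>A\<in>sets (\<Pi>\<^sub>M n\<in>UNIV. S).
        (\<lambda>x n. x (n + 1)) -` A \<inter> space (\<Pi>\<^sub>M n\<in>UNIV. S) = A \<longrightarrow>
        measure M {\<omega> \<in> space M. (\<lambda>n. \<xi> n \<omega>) \<in> A} \<in> {0, 1})"

definition interarrival :: "(int \<Rightarrow> 'w \<Rightarrow> real) \<Rightarrow> int \<Rightarrow> 'w \<Rightarrow> real"
  where
  "interarrival T n \<omega> = T (n + 1) \<omega> - T n \<omega>"

locale stochastic_network = prob_space M + monotone_separable K f
  for M :: "'w measure"
    and K :: "'k measure"
    and f :: "nat \<Rightarrow> (nat \<Rightarrow> real) \<times> (nat \<Rightarrow> 'k) \<Rightarrow> real" +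
  fixes T :: "int \<Rightarrow> 'w \<Rightarrow> real"
    and \<zeta> :: "int \<Rightarrow> 'w \<Rightarrow> 'k"
    and a :: real
  assumes T_measurable: "\<And>n. T n \<in> borel_measurable M"
    and \<zeta>_measurable: "\<And>n. \<zeta> n \<in> measurable M K"
    and T_mono: "\<And>\<omega>. \<omega> \<in> space M \<Longrightarrow> mono (\<lambda>n. T n \<omega>)"
    and stationary:
      "stationary_process M (borel \<Otimes>\<^sub>M K) (\<lambda>n \<omega>. (interarrival T n \<omega>, \<zeta> n \<omega>))"
    and ergodic:
      "ergodic_process M (borel \<Otimes>\<^sub>M K) (\<lambda>n \<omega>. (interarrival T n \<omega>, \<zeta> n \<omega>))"
    and interarrival_integrable: "\<And>n. integrable M (interarrival T n)"
    and interarrival_mean: "\<And>n. expectation (interarrival T n) = a"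
    and dater_integrable:
      "\<And>n. integrable M (\<lambda>\<omega>. maximal_dater f n n (\<lambda>k. T k \<omega>) (\<lambda>k. \<zeta> k \<omega>))"

text \<open>
  By the subadditive ergodic theorem the limit of the means exists and agrees almost surely with the
  limit of \<open>dater_Q f (- int n) (-1) (\<lambda>k. \<zeta> k \<omega>) / real n\<close>.
\<close>

definition gamma0 ::
  "'w measure \<Rightarrow> (nat \<Rightarrow> (nat \<Rightarrow> real) \<times> (nat \<Rightarrow> 'k) \<Rightarrow> real) \<Rightarrow> (int \<Rightarrow> 'w \<Rightarrow> 'k) \<Rightarrow> real"
  where
  "gamma0 M f \<zeta> = lim (\<lambda>n. (\<integral>\<omega>. dater_Q f (- int n) (-1) (\<lambda>k. \<zeta> k \<omega>) \<partial>M) / real n)"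

definition stationary_dater ::
  "(nat \<Rightarrow> (nat \<Rightarrow> real) \<times> (nat \<Rightarrow> 'k) \<Rightarrow> real) \<Rightarrow> (int \<Rightarrow> 'w \<Rightarrow> real) \<Rightarrow> (int \<Rightarrow> 'w \<Rightarrow> 'k) \<Rightarrow> 'w \<Rightarrow> ereal"
  where
  "stationary_dater f T \<zeta> \<omega> =
     lim (\<lambda>n. ereal (maximal_dater f (- int n) 0 (\<lambda>k. T k \<omega>) (\<lambda>k. \<zeta> k \<omega>)))"

definition service_hat ::
  "(nat \<Rightarrow> (nat \<Rightarrow> real) \<times> (nat \<Rightarrow> 'k) \<Rightarrow> real) \<Rightarrow> (int \<Rightarrow> 'w \<Rightarrow> 'k) \<Rightarrow> nat \<Rightarrow> int \<Rightarrow> 'w \<Rightarrow> real"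
  where
  "service_hat f \<zeta> L n \<omega> = dater_Q f (int L * (n - 1) + 1) (int L * n) (\<lambda>k. \<zeta> k \<omega>)"

definition interarrival_hat :: "(int \<Rightarrow> 'w \<Rightarrow> real) \<Rightarrow> nat \<Rightarrow> int \<Rightarrow> 'w \<Rightarrow> real"
  where
  "interarrival_hat T L n \<omega> = T (int L * n) \<omega> - T (int L * (n - 1)) \<omega>"

definition response_hat ::
  "(nat \<Rightarrow> (nat \<Rightarrow> real) \<times> (nat \<Rightarrow> 'k) \<Rightarrow> real) \<Rightarrow> (int \<Rightarrow> 'w \<Rightarrow> real) \<Rightarrow> (int \<Rightarrow> 'w \<Rightarrow> 'k) \<Rightarrow>
    nat \<Rightarrow> 'w \<Rightarrow> ereal"
  where
  "response_hat f T \<zeta> L \<omega> =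
     ereal (service_hat f \<zeta> L 0 \<omega>) +
     (SUP k::nat. ereal (\<Sum>i\<in>{- int k..-1}. service_hat f \<zeta> L i \<omega> - interarrival_hat T L (i + 1) \<omega>))"

definition upper_bound_queue_stable ::
  "'w measure \<Rightarrow> (nat \<Rightarrow> (nat \<Rightarrow> real) \<times> (nat \<Rightarrow> 'k) \<Rightarrow> real) \<Rightarrow> (int \<Rightarrow> 'w \<Rightarrow> 'k) \<Rightarrow> real \<Rightarrow> nat \<Rightarrow> bool"
  where
  "upper_bound_queue_stable M f \<zeta> a L \<longleftrightarrow>
     1 \<le> L \<and> (\<integral>\<omega>. dater_Q f (- int L) (-1) (\<lambda>k. \<zeta> k \<omega>) \<partial>M) < real L * a"

definition distribution_function_nonneg :: "(real \<Rightarrow> real) \<Rightarrow> bool"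
  where
  "distribution_function_nonneg F \<longleftrightarrow>
     mono F \<and> (\<forall>x. continuous (at_right x) F) \<and> (F \<longlongrightarrow> 1) at_top \<and> (\<forall>x<0. F x = 0)"

definition subexponential :: "(real \<Rightarrow> real) \<Rightarrow> bool"
  where
  "subexponential F \<longleftrightarrow>
     distribution_function_nonneg F \<and> (\<forall>x. F x < 1) \<and>
     ((\<lambda>x. measure (interval_measure F \<star> interval_measure F) {x<..} / (1 - F x)) \<longlongrightarrow> 2) at_top"

text \<open>
  The integrated tail distribution is a distribution on the nonnegative half-line, so the formula
  for its tail is used for nonnegative arguments only.  (If the mean of \<open>F\<close> is smaller than 1, the
  formula would be smaller than 1 also for some negative arguments; the missing mass is put at 0.)
\<close>

definition integrated_tail :: "(real \<Rightarrow> real) \<Rightarrow> real \<Rightarrow> real"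
  where
  "integrated_tail F x = (if x < 0 then 1 else min 1 (LBINT u:{x..}. 1 - F u))"

text \<open>
  The library's \<open>prob_space.indep_var\<close> requires both variables to have the same value type.
\<close>

definition independent_variables ::
  "'w measure \<Rightarrow> 'b measure \<Rightarrow> ('w \<Rightarrow> 'b) \<Rightarrow> 'c measure \<Rightarrow> ('w \<Rightarrow> 'c) \<Rightarrow> bool"
  where
  "independent_variables M S X S' X' \<longleftrightarrow>
     X \<in> measurable M S \<and> X' \<in> measurable M S' \<and>
     prob_space.indep_set M {X -` A \<inter> space M | A. A \<in> sets S} {X' -` A \<inter> space M | A. A \<in> sets S'}"

definition iid_sequence :: "'w measure \<Rightarrow> 'b measure \<Rightarrow> (int \<Rightarrow> 'w \<Rightarrow> 'b) \<Rightarrow> bool"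
  where
  "iid_sequence M S X \<longleftrightarrow>
     prob_space.indep_vars M (\<lambda>_. S) X UNIV \<and> (\<forall>m n. distr M S (X m) = distr M S (X n))"

definition assumption_IA ::
  "'w measure \<Rightarrow> 'k measure \<Rightarrow> (int \<Rightarrow> 'w \<Rightarrow> real) \<Rightarrow> (int \<Rightarrow> 'w \<Rightarrow> 'k) \<Rightarrow> bool"
  where
  "assumption_IA M K T \<zeta> \<longleftrightarrow>
     independent_variables M
       (\<Pi>\<^sub>M n\<in>(UNIV :: int set). K) (\<lambda>\<omega> n. \<zeta> n \<omega>)
       (\<Pi>\<^sub>M n\<in>(UNIV :: int set). borel) (\<lambda>\<omega> n. interarrival T n \<omega>) \<and>
     iid_sequence M K \<zeta> \<and>
     iid_sequence M borel (interarrival T)"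

text \<open>Here \<open>Y i j\<close> is the \<open>j\<close>-th component, \<open>j \<in> {1..r}\<close>, of the \<open>i\<close>-th vector.\<close>

definition assumption_AA ::
  "'w measure \<Rightarrow> (nat \<Rightarrow> (nat \<Rightarrow> real) \<times> (nat \<Rightarrow> 'k) \<Rightarrow> real) \<Rightarrow>
    (int \<Rightarrow> 'w \<Rightarrow> real) \<Rightarrow> (int \<Rightarrow> 'w \<Rightarrow> 'k) \<Rightarrow> nat \<Rightarrow> (int \<Rightarrow> nat \<Rightarrow> 'w \<Rightarrow> real) \<Rightarrow> bool"
  where
  "assumption_AA M f T \<zeta> r Y \<longleftrightarrow>
     1 \<le> r \<and>
     (\<forall>i. AE \<omega> in M.
        maximal_dater f i i (\<lambda>k. T k \<omega>) (\<lambda>k. \<zeta> k \<omega>) = (\<Sum>j=1..r. Y i j \<omega>)) \<and>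
     (\<forall>i. \<forall>j\<in>{1..r}. AE \<omega> in M. 0 \<le> Y i j \<omega>) \<and>
     independent_variables M
       (\<Pi>\<^sub>M i\<in>(UNIV :: int set). \<Pi>\<^sub>M j\<in>{1..r}. borel) (\<lambda>\<omega> i. \<lambda>j\<in>{1..r}. Y i j \<omega>)
       (\<Pi>\<^sub>M n\<in>(UNIV :: int set). borel) (\<lambda>\<omega> n. interarrival T n \<omega>) \<and>
     iid_sequence M (\<Pi>\<^sub>M j\<in>{1..r}. borel) (\<lambda>i \<omega>. \<lambda>j\<in>{1..r}. Y i j \<omega>) \<and>
     (\<forall>n\<le>0. AE \<omega> in M.
        (MAX j\<in>{1..r}. \<Sum>i\<in>{n..0}. Y i j \<omega>) \<le> dater_Q f n 0 (\<lambda>k. \<zeta> k \<omega>))"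

definition assumption_SE ::
  "'w measure \<Rightarrow> nat \<Rightarrow> (int \<Rightarrow> nat \<Rightarrow> 'w \<Rightarrow> real) \<Rightarrow> (real \<Rightarrow> real) \<Rightarrow> (nat \<Rightarrow> real) \<Rightarrow> bool"
  where
  "assumption_SE M r Y F d \<longleftrightarrow>
     subexponential F \<and>
     integrable (interval_measure F) (\<lambda>x. x) \<and>
     subexponential (\<lambda>x. 1 - integrated_tail F x) \<and>
     (\<forall>j\<in>{1..r}. 0 \<le> d j \<and>
        ((\<lambda>x. measure M {\<omega> \<in> space M. Y 1 j \<omega> > x} / (1 - F x)) \<longlongrightarrow> d j) at_top) \<and>
     (\<Sum>j=1..r. d j) > 0"

definition assumption_H ::
  "'w measure \<Rightarrow> nat \<Rightarrow> (int \<Rightarrow> nat \<Rightarrow> 'w \<Rightarrow> real) \<Rightarrow> (real \<Rightarrow> real) \<Rightarrow> (nat \<Rightarrow> real) \<Rightarrow> bool"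
  where
  "assumption_H M r Y F d \<longleftrightarrow>
     (\<lambda>x. measure M {\<omega> \<in> space M. (\<Sum>j=1..r. Y 1 j \<omega>) > x}) \<sim>[at_top]
       (\<lambda>x. measure M {\<omega> \<in> space M. (MAX j\<in>{1..r}. Y 1 j \<omega>) > x}) \<and>
     (\<lambda>x. measure M {\<omega> \<in> space M. (MAX j\<in>{1..r}. Y 1 j \<omega>) > x}) \<sim>[at_top]
       (\<lambda>x. \<Sum>j=1..r. measure M {\<omega> \<in> space M. Y 1 j \<omega> > x}) \<and>
     (\<lambda>x. \<Sum>j=1..r. measure M {\<omega> \<in> space M. Y 1 j \<omega> > x}) \<sim>[at_top]
       (\<lambda>x. \<Sum>j=1..r. d j * (1 - F x))"

end

theory Submission
  imports Defs
begin

text \<open>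
  By separability and monotonicity, the network started empty at time \<open>- k L\<close> is dominated by the
  upper-bound queue, so \<open>Z \<le> R_hat\<close> holds pointwise and everything reduces to the tail
  of a \<open>GI/GI/1\<close> queue.  A batch service time lies between \<open>max_j \<Sum> Y_i j\<close> and \<open>\<Sum> Z_i\<close>; by (H)
  and the principle of a single big jump both bounds have tail \<open>L d (1 - F)\<close>.  Veraverbeke's theorem,
  proved along the lines of Zachary's argument (compare the random walk with a line of slope close to
  its drift: crossing this line needs a big jump, and the walk starts anew afterwards), gives
  \<open>P(R_hat > x) \<sim> L d / (L a - E s_hat)\<close> times the integrated tail.  By subadditivity \<open>E s_hat / L\<close>
  tends to \<open>\<gamma>(0)\<close>.

  The distribution of the maximum of the walk is handled through its recursion over the number of steps;
  all bounds on tails are therefore inductions over this number and uniform in it.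
\<close>

section \<open>Tails of distributions on the real line\<close>

text \<open>Finite horizons replace ladder heights and the strong law: each estimate on
  \<open>walk_max H N\<close> is an integral inequality, and the infinite horizon enters only at the
  end, by continuity along an increasing union. The price is that no constant may depend on
  \<open>N\<close>. Hence the index is quantified inside the eventuality in
  \<open>tail_bound\<close>, and the sharp upper bound is reached in stages. Means show that a fixed
  mass of the maximum stays below some level; a contraction turns this into tightness; tightness
  gives a crude bound by a multiple of the integrated tail; only then can the error terms be made
  small and the slope of the line be moved to the drift. Two reference tails occur. A block, being a
  finite convolution, is compared with \<open>1 - F\<close>. The walk is compared with the
  integrated tail \<open>\<beta>\<close>, since jumps crossing a line are summed along an arithmetic
  progression, a Riemann sum for \<open>\<beta>\<close>. Against \<open>\<beta>\<close> a single
  service time is negligible and a fixed shift of the level is invisible, so the first summand of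
  the response time and the interarrival times enter the limit only through the drift and the jumps
  of the walk.\<close>

lemma filterlim_minus_const_at_top: "filterlim (\<lambda>x. x - c :: real) at_top at_top"
  using filterlim_tendsto_add_at_top[OF tendsto_const[of "- c"] filterlim_ident] by simp

definition tail :: "real measure \<Rightarrow> real \<Rightarrow> real" where
  "tail \<mu> x = measure \<mu> {x<..}"

lemma tail_nonneg [simp]: "0 \<le> tail \<mu> x"
  by (simp add: tail_def)

lemma tail_le_1 [simp]: "real_distribution \<mu> \<Longrightarrow> tail \<mu> x \<le> 1"
  unfolding tail_def real_distribution_def by (simp add: prob_space.prob_le_1)

lemma abs_tail_le_1 [simp]: "real_distribution \<mu> \<Longrightarrow> \<bar>tail \<mu> x\<bar> \<le> 1"
  by simp

lemma tail_antimono: "real_distribution \<mu> \<Longrightarrow> x \<le> y \<Longrightarrow> tail \<mu> y \<le> tail \<mu> x"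
  unfolding tail_def real_distribution_def
  by (intro finite_measure.finite_measure_mono)
    (auto simp: real_distribution_axioms_def prob_space_def)

lemma borel_measurable_tail [measurable]:
  assumes "real_distribution \<mu>" shows "tail \<mu> \<in> borel_measurable borel"
proof -
  have "mono (\<lambda>x. - tail \<mu> x)"
    using tail_antimono[OF assms] by (intro monoI) auto
  then have "(\<lambda>x. - tail \<mu> x) \<in> borel_measurable borel"
    by (rule borel_measurable_mono)
  from borel_measurable_uminus[OF this] show ?thesis by simp
qed

lemma integrable_real_distribution:
  fixes f :: "real \<Rightarrow> real"
  assumes "real_distribution \<mu>" "f \<in> borel_measurable borel" "\<And>x. \<bar>f x\<bar> \<le> B"
  shows "integrable \<mu> f"
proof -
  interpret real_distribution \<mu> by fact
  show ?thesis using assms by (intro integrable_const_bound[where B=B]) auto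
qed

lemma integral_mono_real_distribution:
  fixes f :: "real \<Rightarrow> real"
  assumes "real_distribution \<mu>" "f \<in> borel_measurable borel" "g \<in> borel_measurable borel"
    and "\<And>x. \<bar>f x\<bar> \<le> B" "\<And>x. \<bar>g x\<bar> \<le> B'" "\<And>x. f x \<le> g x"
  shows "(\<integral>x. f x \<partial>\<mu>) \<le> (\<integral>x. g x \<partial>\<mu>)"
  using assms by (intro integral_mono integrable_real_distribution) auto

lemma integral_swap_real_distribution:
  fixes f :: "real \<Rightarrow> real \<Rightarrow> real"
  assumes \<mu>: "real_distribution \<mu>" and \<nu>: "real_distribution \<nu>"
    and f: "(\<lambda>(x, y). f x y) \<in> borel_measurable (borel \<Otimes>\<^sub>M borel)" and B: "\<And>x y. \<bar>f x y\<bar> \<le> B"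
  shows "(\<integral>x. (\<integral>y. f x y \<partial>\<nu>) \<partial>\<mu>) = (\<integral>y. (\<integral>x. f x y \<partial>\<mu>) \<partial>\<nu>)"
proof -
  interpret \<mu>: real_distribution \<mu> by fact
  interpret \<nu>: real_distribution \<nu> by fact
  interpret pair_prob_space \<mu> \<nu> ..
  have "(\<lambda>(x, y). f x y) \<in> borel_measurable (\<mu> \<Otimes>\<^sub>M \<nu>)"
    using f by (simp cong: measurable_cong_sets sets_pair_measure_cong)
  then have "integrable (\<mu> \<Otimes>\<^sub>M \<nu>) (\<lambda>(x, y). f x y)"
    using B by (intro integrable_const_bound[where B=B]) auto
  from Fubini_integral[OF this] show ?thesis by simp
qed

lemma integral_indicator_real_distribution:
  assumes "real_distribution \<mu>" "A \<in> sets borel"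
  shows "(\<integral>x. indicator A x \<partial>\<mu>) = measure \<mu> A"
proof -
  interpret real_distribution \<mu> by fact
  show ?thesis by simp
qed

lemma tail_eq_integral:
  assumes "real_distribution \<mu>"
  shows "tail \<mu> x = (\<integral>y. indicator {x<..} y \<partial>\<mu>)"
  using assms integral_indicator_real_distribution[OF assms, of "{x<..}"] by (simp only: tail_def) simp

lemma real_distribution_convolution:
  assumes "real_distribution \<mu>" "real_distribution \<nu>" shows "real_distribution (\<mu> \<star> \<nu>)"
proof -
  interpret \<mu>: real_distribution \<mu> by fact
  interpret \<nu>: real_distribution \<nu> by fact
  interpret pair_prob_space \<mu> \<nu> ..
  show ?thesis unfolding convolution_def by (intro real_distribution_distr) simp
qed

lemma tail_convolution:
  assumes \<mu>: "real_distribution \<mu>" and \<nu>: "real_distribution \<nu>"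
  shows "tail (\<mu> \<star> \<nu>) x = (\<integral>y. tail \<nu> (x - y) \<partial>\<mu>)"
proof -
  interpret \<mu>: real_distribution \<mu> by fact
  interpret \<nu>: real_distribution \<nu> by fact
  interpret c: real_distribution "\<mu> \<star> \<nu>" by (rule real_distribution_convolution[OF \<mu> \<nu>])
  have "ennreal (tail (\<mu> \<star> \<nu>) x) = emeasure (\<mu> \<star> \<nu>) {x<..}"
    by (simp add: tail_def c.emeasure_eq_measure)
  also have "\<dots> = (\<integral>\<^sup>+y. emeasure \<nu> {z. z + y \<in> {x<..}} \<partial>\<mu>)"
    by (intro convolution_emeasure) (auto intro: \<mu>.finite_measure_axioms \<nu>.finite_measure_axioms)
  also have "\<dots> = (\<integral>\<^sup>+y. ennreal (tail \<nu> (x - y)) \<partial>\<mu>)"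
    by (intro nn_integral_cong)
      (auto simp: tail_def \<nu>.emeasure_eq_measure greaterThan_def algebra_simps)
  also have "\<dots> = ennreal (\<integral>y. tail \<nu> (x - y) \<partial>\<mu>)"
    using \<nu> by (intro nn_integral_eq_integral integrable_real_distribution[OF \<mu>, where B=1]) auto
  finally show ?thesis
    by (simp add: integral_nonneg_AE)
qed

lemma convolution_commute:
  assumes "real_distribution \<mu>" "real_distribution \<nu>" shows "(\<mu> \<star> \<nu>) = (\<nu> \<star> \<mu>)"
proof -
  interpret \<mu>: real_distribution \<mu> by fact
  interpret \<nu>: real_distribution \<nu> by fact
  show ?thesis
    by (intro convolution_commutative) (auto intro: \<mu>.finite_measure_axioms \<nu>.finite_measure_axioms)
qed

lemma tail_tendsto_0:
  assumes "real_distribution \<mu>" shows "(tail \<mu> \<longlongrightarrow> 0) at_top"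
proof -
  interpret real_distribution \<mu> by fact
  have "tail \<mu> x = 1 - cdf \<mu> x" for x
    using prob_compl[of "{..x}"] by (auto simp: tail_def cdf_def Compl_eq_Diff_UNIV[symmetric])
  then have "tail \<mu> = (\<lambda>x. 1 - cdf \<mu> x)" by auto
  then show ?thesis
    using tendsto_diff[OF tendsto_const[of 1] cdf_lim_at_top_prob] by simp
qed

text \<open>
  The measure, under the product of \<open>\<mu>\<close> and \<open>\<nu>\<close>, of the event that both coordinates exceed
  \<open>A\<close> and their sum exceeds \<open>x\<close>.
\<close>

definition both_large :: "real measure \<Rightarrow> real measure \<Rightarrow> real \<Rightarrow> real \<Rightarrow> real" where
  "both_large \<mu> \<nu> A x = (\<integral>v. indicator {A<..} v * tail \<mu> (max A (x - v)) \<partial>\<nu>)"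

text \<open>Both sides integrate the same symmetric indicator over the product. Symmetry lets
  \<open>both_large_mono\<close>, which replaces the first factor, be applied to each factor in
  turn.\<close>

lemma both_large_commute:
  assumes \<mu>: "real_distribution \<mu>" and \<nu>: "real_distribution \<nu>"
  shows "both_large \<mu> \<nu> A x = both_large \<nu> \<mu> A x"
proof -
  have eq: "both_large \<mu> \<nu> A x =
      (\<integral>v. (\<integral>u. indicator {A<..} v * indicator {A<..} u * indicator {x<..} (u + v) \<partial>\<mu>) \<partial>\<nu>)"
    if \<mu>: "real_distribution \<mu>" for \<mu> \<nu>
    unfolding both_large_def
  proof (rule Bochner_Integration.integral_cong[OF refl])
    fix v
    have "(\<lambda>u. indicator {A<..} v * indicator {A<..} u * indicator {x<..} (u + v)) =
        (\<lambda>u. indicator {A<..} v * indicator {max A (x - v)<..} u :: real)"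
      by (auto simp: indicator_def fun_eq_iff)
    then show "indicator {A<..} v * tail \<mu> (max A (x - v)) =
        (\<integral>u. indicator {A<..} v * indicator {A<..} u * indicator {x<..} (u + v) \<partial>\<mu>)"
      by (simp add: tail_eq_integral[OF \<mu>])
  qed
  show ?thesis
    unfolding eq[OF \<mu>] eq[OF \<nu>]
    by (subst integral_swap_real_distribution[OF \<nu> \<mu>, where B=1])
      (auto simp: indicator_def add.commute mult.commute intro!: Bochner_Integration.integral_cong)
qed

text \<open>The level \<open>max A (x - v)\<close> never falls below \<open>A\<close>, so a
  comparison of the tails beyond \<open>A\<close> is enough.\<close>

lemma both_large_mono:
  assumes \<mu>: "real_distribution \<mu>" and \<mu>': "real_distribution \<mu>'" and \<nu>: "real_distribution \<nu>"
    and le: "\<And>t. A \<le> t \<Longrightarrow> tail \<mu> t \<le> k * tail \<mu>' t" and k: "0 \<le> k"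
  shows "both_large \<mu> \<nu> A x \<le> k * both_large \<mu>' \<nu> A x"
proof -
  note [measurable] = borel_measurable_tail[OF \<mu>] borel_measurable_tail[OF \<mu>']
  have "both_large \<mu> \<nu> A x \<le> (\<integral>v. k * (indicator {A<..} v * tail \<mu>' (max A (x - v))) \<partial>\<nu>)"
    unfolding both_large_def
  proof (rule integral_mono_real_distribution[OF \<nu>, where B=1 and B'=k])
    show "\<bar>k * (indicator {A<..} v * tail \<mu>' (max A (x - v)))\<bar> \<le> k" for v
      using k \<mu>' by (auto simp: indicator_def abs_mult intro!: mult_left_le)
  qed (use \<mu> \<mu>' le in \<open>auto simp: indicator_def\<close>)
  then show ?thesis by (simp add: both_large_def)
qed

lemma both_large_le:
  assumes \<mu>: "real_distribution \<mu>" and \<nu>: "real_distribution \<nu>" and \<beta>: "real_distribution \<beta>"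
    and "\<And>t. A \<le> t \<Longrightarrow> tail \<mu> t \<le> k * tail \<beta> t" "0 \<le> k"
    and "\<And>t. A \<le> t \<Longrightarrow> tail \<nu> t \<le> l * tail \<beta> t" "0 \<le> l"
  shows "both_large \<mu> \<nu> A x \<le> k * l * both_large \<beta> \<beta> A x"
proof -
  have "both_large \<mu> \<nu> A x \<le> k * both_large \<beta> \<nu> A x"
    by (rule both_large_mono) (use assms in auto)
  also have "\<dots> = k * both_large \<nu> \<beta> A x"
    using both_large_commute[OF \<beta> \<nu>] by simp
  also have "\<dots> \<le> k * (l * both_large \<beta> \<beta> A x)"
    by (intro mult_left_mono both_large_mono) (use assms in auto)
  finally show ?thesis by (simp add: mult.assoc)
qed

text \<open>The single big jump: if a sum exceeds \<open>x\<close>, then one coordinate exceeds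
  \<open>x - A\<close> or both exceed \<open>A\<close>.\<close>

lemma tail_convolution_le:
  assumes \<mu>: "real_distribution \<mu>" and \<nu>: "real_distribution \<nu>"
  shows "tail (\<mu> \<star> \<nu>) x \<le> tail \<mu> (x - A) + tail \<nu> (x - A) + both_large \<mu> \<nu> A x"
proof -
  note [measurable] = borel_measurable_tail[OF \<mu>]
  interpret \<nu>: real_distribution \<nu> by fact
  have "tail (\<mu> \<star> \<nu>) x = (\<integral>v. tail \<mu> (x - v) \<partial>\<nu>)"
    unfolding convolution_commute[OF \<mu> \<nu>] by (rule tail_convolution[OF \<nu> \<mu>])
  also have "\<dots> \<le> (\<integral>v. tail \<mu> (x - A) + indicator {x - A<..} v +
      indicator {A<..} v * tail \<mu> (max A (x - v)) \<partial>\<nu>)"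
  proof (rule integral_mono_real_distribution[OF \<nu>, where B=1 and B'=3])
    fix v
    show "tail \<mu> (x - v) \<le> tail \<mu> (x - A) + indicator {x - A<..} v +
        indicator {A<..} v * tail \<mu> (max A (x - v))"
    proof (cases "v \<le> A \<or> x - A < v")
      case True
      then show ?thesis
        using tail_antimono[OF \<mu>, of "x - A" "x - v"] tail_le_1[OF \<mu>, of "x - v"]
        using tail_nonneg[of \<mu> "x - A"] tail_nonneg[of \<mu> A] tail_nonneg[of \<mu> "max A (x - v)"]
        by (auto simp: indicator_def max_def simp del: tail_nonneg)
    next
      case False
      then have "max A (x - v) = x - v" by auto
      then show ?thesis using False by (auto simp: indicator_def)
    qed
  next
    fix v
    have "\<bar>indicator {A<..} v * tail \<mu> (max A (x - v))\<bar> \<le> 1" "\<bar>indicator {x - A<..} v\<bar> \<le> (1::real)"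
      using \<mu> by (auto simp: indicator_def)
    with abs_tail_le_1[OF \<mu>, of "x - A"]
    show "\<bar>tail \<mu> (x - A) + indicator {x - A<..} v +
      indicator {A<..} v * tail \<mu> (max A (x - v))\<bar> \<le> 3" by linarith
  qed (use \<mu> in auto)
  also have "\<dots> = tail \<mu> (x - A) + tail \<nu> (x - A) + both_large \<mu> \<nu> A x"
    unfolding both_large_def tail_eq_integral[OF \<nu>]
    using \<mu>
    by (subst Bochner_Integration.integral_add Bochner_Integration.integral_add
        | (intro Bochner_Integration.integrable_add integrable_real_distribution[OF \<nu>, where B=1];
            auto simp: indicator_def))+ (use \<nu>.prob_space in simp)
  finally show ?thesis .
qed

text \<open>The slack \<open>\<delta>\<close> is added to \<open>p\<close> instead of multiplying
  it, so that \<open>p = 0\<close> says that the family is negligible against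
  \<open>\<beta>\<close>. The threshold for \<open>x\<close> is common to all indices.\<close>

definition tail_bound :: "real measure \<Rightarrow> ('i \<Rightarrow> real measure) \<Rightarrow> real \<Rightarrow> bool" where
  "tail_bound \<beta> \<mu> p \<longleftrightarrow> (\<forall>\<delta>>0. \<forall>\<^sub>F x in at_top. \<forall>i. tail (\<mu> i) x \<le> (p + \<delta>) * tail \<beta> x)"

section \<open>Subexponential reference distributions\<close>

locale subexp_distribution = real_distribution \<beta> for \<beta> :: "real measure" +
  assumes nonneg_support: "measure \<beta> {..<0} = 0"
    and tail_pos: "\<And>x. 0 < tail \<beta> x"
    and tail_conv_ratio: "((\<lambda>x. tail (\<beta> \<star> \<beta>) x / tail \<beta> x) \<longlongrightarrow> 2) at_top"
begin

lemma real_dist [simp]: "real_distribution \<beta>" ..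

lemma tail_neg: "x < 0 \<Longrightarrow> tail \<beta> x = 1"
proof -
  assume "x < 0"
  have "tail \<beta> x = 1 - measure \<beta> {..x}"
    using prob_compl[of "{..x}"] by (auto simp: tail_def Compl_eq_Diff_UNIV[symmetric])
  moreover have "measure \<beta> {..x} \<le> measure \<beta> {..<0}"
    using \<open>x < 0\<close> by (intro finite_measure_mono) auto
  ultimately show ?thesis
    using nonneg_support by (simp add: measure_le_0_iff)
qed

lemma AE_nonneg: "AE u in \<beta>. 0 \<le> u"
  using nonneg_support by (subst AE_iff_measurable[OF _ refl]) (auto simp: emeasure_eq_measure not_le lessThan_def)

lemma measure_upto: "measure \<beta> {0..y} = 1 - tail \<beta> y"
proof -
  have "measure \<beta> {0..y} = measure \<beta> (- {y<..})"
    using AE_nonneg by (intro finite_measure_eq_AE) auto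
  then show ?thesis
    using prob_compl[of "{y<..}"] by (simp add: tail_def Compl_eq_Diff_UNIV)
qed

lemma integrable_indicator_borel: "S \<in> sets borel \<Longrightarrow> integrable \<beta> (indicator S :: real \<Rightarrow> real)"
  by (intro integrable_real_distribution[OF real_dist, where B=1]) auto

text \<open>Split the convolution tail according to one summand: in \<open>{0..y}\<close>, between
  \<open>y\<close> and \<open>x\<close>, or beyond \<open>x\<close>. The other summand then
  contributes at least \<open>tail \<beta> x\<close>, \<open>tail \<beta> (x - y)\<close> and 1. As
  the total is only about twice \<open>tail \<beta> x\<close>, the middle part leaves no room for
  \<open>tail \<beta> (x - y)\<close> to exceed \<open>tail \<beta> x\<close> by a fixed
  factor.\<close>

lemma long_tailed_nonneg:
  assumes y: "0 \<le> y"
  shows "((\<lambda>x. tail \<beta> (x - y) / tail \<beta> x) \<longlongrightarrow> 1) at_top"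
proof (rule tendsto_sandwich)
  note [measurable] = borel_measurable_tail[OF real_dist]
  let ?T = "\<lambda>x. tail (\<beta> \<star> \<beta>) x"
  have key: "tail \<beta> x * (1 - tail \<beta> y) + tail \<beta> (x - y) * (tail \<beta> y - tail \<beta> x) + tail \<beta> x \<le> ?T x"
    if x: "y \<le> x" for x
  proof -
    have "(\<integral>u. tail \<beta> x * indicator {0..y} u + tail \<beta> (x - y) * (indicator {y<..} u - indicator {x<..} u)
        + indicator {x<..} u \<partial>\<beta>) \<le> (\<integral>u. tail \<beta> (x - u) \<partial>\<beta>)"
    proof (rule integral_mono_AE)
      show "AE u in \<beta>. tail \<beta> x * indicator {0..y} u + tail \<beta> (x - y) * (indicator {y<..} u - indicator {x<..} u)
        + indicator {x<..} u \<le> tail \<beta> (x - u)"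
        using AE_nonneg
      proof eventually_elim
        case (elim u)
        then show ?case
          using x y tail_neg[of "x - u"] tail_antimono[OF real_dist, of "x - u" x]
             tail_antimono[OF real_dist, of "x - u" "x - y"]
          by (auto simp: indicator_def)
      qed
      show "integrable \<beta> (\<lambda>u. tail \<beta> x * indicator {0..y} u + tail \<beta> (x - y) * (indicator {y<..} u - indicator {x<..} u)
        + indicator {x<..} u)"
        by (intro Bochner_Integration.integrable_add Bochner_Integration.integrable_diff integrable_mult_right)
          (auto intro!: integrable_real_distribution[OF real_dist, where B=1])
    qed (auto intro!: integrable_real_distribution[OF real_dist, where B=1] real_dist)
    also have "(\<integral>u. tail \<beta> (x - u) \<partial>\<beta>) = ?T x"
      by (simp add: tail_convolution real_dist)
    also have "(\<integral>u. tail \<beta> x * indicator {0..y} u + tail \<beta> (x - y) * (indicator {y<..} u - indicator {x<..} u)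
        + indicator {x<..} u \<partial>\<beta>) =
       tail \<beta> x * (1 - tail \<beta> y) + tail \<beta> (x - y) * (tail \<beta> y - tail \<beta> x) + tail \<beta> x"
      by (simp add: integrable_indicator_borel measure_upto tail_def[symmetric])
    finally show ?thesis .
  qed
  have lim0: "(tail \<beta> \<longlongrightarrow> 0) at_top"
    by (rule tail_tendsto_0[OF real_dist])
  show "\<forall>\<^sub>F x in at_top. 1 \<le> tail \<beta> (x - y) / tail \<beta> x"
    using tail_antimono[OF real_dist, of "x - y" x for x] y tail_pos by (intro always_eventually) auto
  \<comment> \<open>Makes the divisor positive when \<open>key\<close> is solved for the
    ratio.\<close>
  have "\<forall>\<^sub>F x in at_top. tail \<beta> x < tail \<beta> y"
    using order_tendstoD(2)[OF lim0 tail_pos[of y]] .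
  then show "\<forall>\<^sub>F x in at_top. tail \<beta> (x - y) / tail \<beta> x \<le>
      (?T x / tail \<beta> x - 2 + tail \<beta> y) / (tail \<beta> y - tail \<beta> x)"
    using eventually_ge_at_top[of y]
  proof eventually_elim
    case (elim x)
    have "tail \<beta> (x - y) * (tail \<beta> y - tail \<beta> x) / tail \<beta> x
        \<le> (?T x - tail \<beta> x * (1 - tail \<beta> y) - tail \<beta> x) / tail \<beta> x"
      using key[OF elim(2)] tail_pos[of x] by (intro divide_right_mono) auto
    also have "\<dots> = ?T x / tail \<beta> x - 2 + tail \<beta> y"
      using tail_pos[of x] by (simp add: field_simps)
    finally show ?case
      using elim(1) by (simp add: pos_le_divide_eq mult.commute)
  qed
  have "((\<lambda>x. (?T x / tail \<beta> x - 2 + tail \<beta> y) / (tail \<beta> y - tail \<beta> x))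
      \<longlongrightarrow> (2 - 2 + tail \<beta> y) / (tail \<beta> y - 0)) at_top"
    using tail_pos[of y] by (intro tendsto_intros tail_conv_ratio lim0) auto
  then show "((\<lambda>x. (?T x / tail \<beta> x - 2 + tail \<beta> y) / (tail \<beta> y - tail \<beta> x)) \<longlongrightarrow> 1) at_top"
    using tail_pos[of y] by simp
qed simp

lemma long_tailed: "((\<lambda>x. tail \<beta> (x - y) / tail \<beta> x) \<longlongrightarrow> 1) at_top"
proof (cases "0 \<le> y")
  case False
  have "filterlim (\<lambda>x. - y + x) at_top at_top"
    by (rule filterlim_tendsto_add_at_top[OF tendsto_const filterlim_ident])
  from filterlim_compose[OF long_tailed_nonneg[of "- y"] this] False
  have "((\<lambda>x. tail \<beta> x / tail \<beta> (x - y)) \<longlongrightarrow> 1) at_top"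
    by (simp add: algebra_simps)
  from tendsto_inverse[OF this] show ?thesis
    by simp
qed (simp add: long_tailed_nonneg)

lemma eventually_shift_le:
  assumes "1 < c" shows "\<forall>\<^sub>F x in at_top. tail \<beta> (x - y) \<le> c * tail \<beta> x"
proof -
  have "\<forall>\<^sub>F x in at_top. tail \<beta> (x - y) / tail \<beta> x < c"
    using order_tendstoD(2)[OF long_tailed assms] .
  then show ?thesis
    by eventually_elim (use tail_pos in \<open>simp add: pos_divide_less_eq less_imp_le\<close>)
qed

lemma eventually_shift_ge:
  assumes "c < 1" shows "\<forall>\<^sub>F x in at_top. c * tail \<beta> x \<le> tail \<beta> (x - y)"
proof -
  have "\<forall>\<^sub>F x in at_top. c < tail \<beta> (x - y) / tail \<beta> x"
    using order_tendstoD(1)[OF long_tailed assms] .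
  then show ?thesis
    by eventually_elim (use tail_pos in \<open>simp add: pos_less_divide_eq less_imp_le\<close>)
qed

text \<open>Remove from the convolution tail the two symmetric events that one summand lies in
  \<open>{0..A}\<close> and the other exceeds \<open>x\<close>; each has mass
  \<open>(1 - tail \<beta> A) * tail \<beta> x\<close>. Since the whole is asymptotically
  \<open>2 * tail \<beta> x\<close>, at most about
  \<open>2 * tail \<beta> A * tail \<beta> x\<close> remains for two large summands.\<close>

lemma both_large_self:
  assumes \<epsilon>: "0 < \<epsilon>"
  shows "\<forall>\<^sub>F A in at_top. \<forall>\<^sub>F x in at_top. both_large \<beta> \<beta> A x \<le> \<epsilon> * tail \<beta> x"
proof -
  note [measurable] = borel_measurable_tail[OF real_dist]
  have key: "both_large \<beta> \<beta> A x + 2 * (1 - tail \<beta> A) * tail \<beta> x \<le> tail (\<beta> \<star> \<beta>) x"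
    if x: "A \<le> x" "0 \<le> A" for A x
  proof -
    have "(\<integral>v. indicator {A<..} v * tail \<beta> (max A (x - v)) + indicator {0..A} v * tail \<beta> x
        + indicator {x<..} v * (1 - tail \<beta> A) \<partial>\<beta>) \<le> (\<integral>v. tail \<beta> (x - v) \<partial>\<beta>)"
    proof (rule integral_mono_AE)
      show "AE v in \<beta>. indicator {A<..} v * tail \<beta> (max A (x - v)) + indicator {0..A} v * tail \<beta> x
        + indicator {x<..} v * (1 - tail \<beta> A) \<le> tail \<beta> (x - v)"
        using AE_nonneg
      proof eventually_elim
        case (elim v)
        then show ?case
          using x tail_neg[of "x - v"] tail_antimono[OF real_dist, of "x - v" x]
             tail_antimono[OF real_dist, of "x - v" "max A (x - v)"]
          by (auto simp: indicator_def)
      qed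
      have "integrable \<beta> (\<lambda>v. indicator {A<..} v * tail \<beta> (max A (x - v)))"
        using real_dist by (intro integrable_real_distribution[where B=1]) (auto simp: indicator_def)
      then show "integrable \<beta> (\<lambda>v. indicator {A<..} v * tail \<beta> (max A (x - v)) + indicator {0..A} v * tail \<beta> x
        + indicator {x<..} v * (1 - tail \<beta> A))"
        by (intro Bochner_Integration.integrable_add integrable_mult_left)
          (auto intro!: integrable_real_distribution[OF real_dist, where B=1])
    qed (auto intro!: integrable_real_distribution[OF real_dist, where B=1] real_dist)
    also have "(\<integral>v. tail \<beta> (x - v) \<partial>\<beta>) = tail (\<beta> \<star> \<beta>) x"
      by (simp add: tail_convolution real_dist)
    also have "(\<integral>v. indicator {A<..} v * tail \<beta> (max A (x - v)) + indicator {0..A} v * tail \<beta> x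
        + indicator {x<..} v * (1 - tail \<beta> A) \<partial>\<beta>) =
       both_large \<beta> \<beta> A x + 2 * (1 - tail \<beta> A) * tail \<beta> x"
    proof -
      have "integrable \<beta> (\<lambda>v. indicator {A<..} v * tail \<beta> (max A (x - v)))"
        using real_dist by (intro integrable_real_distribution[where B=1]) (auto simp: indicator_def)
      then show ?thesis
        by (simp add: integrable_indicator_borel measure_upto tail_def[symmetric] both_large_def)
    qed
    finally show ?thesis .
  qed
  have "\<forall>\<^sub>F A in at_top. tail \<beta> A < \<epsilon> / 2"
    using order_tendstoD(2)[OF tail_tendsto_0[OF real_dist], of "\<epsilon> / 2"] \<epsilon> by simp
  then show ?thesis
    using eventually_ge_at_top[of 0]
  proof eventually_elim
    case A: (elim A)
    have "((\<lambda>x. tail (\<beta> \<star> \<beta>) x / tail \<beta> x - 2 * (1 - tail \<beta> A)) \<longlongrightarrow> 2 - 2 * (1 - tail \<beta> A)) at_top"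
      by (intro tendsto_intros tail_conv_ratio)
    then have "\<forall>\<^sub>F x in at_top. tail (\<beta> \<star> \<beta>) x / tail \<beta> x - 2 * (1 - tail \<beta> A) < \<epsilon>"
      by (rule order_tendstoD(2)) (use A in simp)
    then show ?case
      using eventually_ge_at_top[of A]
    proof eventually_elim
      case (elim x)
      then have "tail (\<beta> \<star> \<beta>) x - 2 * (1 - tail \<beta> A) * tail \<beta> x < \<epsilon> * tail \<beta> x"
        using tail_pos[of x] by (simp add: field_simps)
      with key[OF elim(2) A(2)] show ?case by simp
    qed
  qed
qed

text \<open>The level \<open>A\<close> is fixed before \<open>x\<close>: crude bounds beyond
  \<open>A\<close> suffice for the joint term, which is negligible, while the marginal terms at
  \<open>x - A\<close> return to \<open>x\<close> because \<open>\<beta>\<close> is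
  long-tailed.\<close>

lemma tail_bound_convolution:
  assumes \<mu>: "\<And>i. real_distribution (\<mu> i)" and \<nu>: "\<And>i. real_distribution (\<nu> i)"
    and p: "tail_bound \<beta> \<mu> p" "0 \<le> p" and q: "tail_bound \<beta> \<nu> q" "0 \<le> q"
  shows "tail_bound \<beta> (\<lambda>i. \<mu> i \<star> \<nu> i) (p + q)"
  unfolding tail_bound_def
proof (intro allI impI)
  fix \<delta> :: real assume \<delta>: "0 < \<delta>"
  \<comment> \<open>Thirds of \<open>\<delta>\<close>: the joint term gets one through
    \<open>\<epsilon>\<close>, the slacks of the two marginals share one as
    \<open>\<delta> / 6\<close> each, and the factor \<open>c\<close> below spends the last one on
    the shift from \<open>x - A\<close> to \<open>x\<close>.\<close>
  define \<epsilon> where "\<epsilon> = \<delta> / (3 * ((p + 1) * (q + 1)))"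
  have \<epsilon>: "0 < \<epsilon>" using \<delta> p q by (simp add: \<epsilon>_def)
  have p1: "\<forall>\<^sub>F x in at_top. \<forall>i. tail (\<mu> i) x \<le> (p + 1) * tail \<beta> x"
    and q1: "\<forall>\<^sub>F x in at_top. \<forall>i. tail (\<nu> i) x \<le> (q + 1) * tail \<beta> x"
    using p q by (auto simp: tail_bound_def)
  have "\<forall>\<^sub>F A in at_top. (\<forall>t\<ge>A. \<forall>i. tail (\<mu> i) t \<le> (p + 1) * tail \<beta> t) \<and>
      (\<forall>t\<ge>A. \<forall>i. tail (\<nu> i) t \<le> (q + 1) * tail \<beta> t) \<and>
      (\<forall>\<^sub>F x in at_top. both_large \<beta> \<beta> A x \<le> \<epsilon> * tail \<beta> x)"
    using eventually_all_ge_at_top[OF p1] eventually_all_ge_at_top[OF q1] both_large_self[OF \<epsilon>]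
    by eventually_elim blast
  then obtain A where A: "\<And>t i. A \<le> t \<Longrightarrow> tail (\<mu> i) t \<le> (p + 1) * tail \<beta> t"
      "\<And>t i. A \<le> t \<Longrightarrow> tail (\<nu> i) t \<le> (q + 1) * tail \<beta> t"
      "\<forall>\<^sub>F x in at_top. both_large \<beta> \<beta> A x \<le> \<epsilon> * tail \<beta> x"
    by (metis (no_types, lifting) eventually_happens'[OF trivial_limit_at_top_linorder])
  have pos: "0 < p + q + \<delta> / 3" using p q \<delta> by simp
  define c where "c = (p + q + 2 * \<delta> / 3) / (p + q + \<delta> / 3)"
  have c: "1 < c" using \<delta> p q by (simp add: c_def field_simps)
  have c_eq: "(p + q + \<delta> / 3) * c = p + q + 2 * \<delta> / 3"
    using pos by (simp add: c_def)
  have "\<forall>\<^sub>F x in at_top. \<forall>i. tail (\<mu> i) x \<le> (p + \<delta> / 6) * tail \<beta> x"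
    "\<forall>\<^sub>F x in at_top. \<forall>i. tail (\<nu> i) x \<le> (q + \<delta> / 6) * tail \<beta> x"
    using p q \<delta> by (auto simp: tail_bound_def dest!: spec[of _ "\<delta> / 6"])
  from this[THEN eventually_compose_filterlim[OF _ filterlim_minus_const_at_top[of A]]]
  show "\<forall>\<^sub>F x in at_top. \<forall>i. tail (\<mu> i \<star> \<nu> i) x \<le> (p + q + \<delta>) * tail \<beta> x"
    using A(3) eventually_shift_le[OF c, of A]
  proof eventually_elim
    case (elim x)
    show ?case
    proof
      fix i
      have "both_large (\<mu> i) (\<nu> i) A x \<le> (p + 1) * (q + 1) * both_large \<beta> \<beta> A x"
        by (rule both_large_le) (use A p q \<mu> \<nu> real_dist in auto)
      also have "\<dots> \<le> (p + 1) * (q + 1) * (\<epsilon> * tail \<beta> x)"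
        by (intro mult_left_mono) (use elim p q in auto)
      also have "\<dots> = \<delta> / 3 * tail \<beta> x"
        using p q by (simp add: \<epsilon>_def)
      finally have "tail (\<mu> i \<star> \<nu> i) x \<le> (p + \<delta> / 6) * tail \<beta> (x - A) + (q + \<delta> / 6) * tail \<beta> (x - A)
          + \<delta> / 3 * tail \<beta> x"
        using tail_convolution_le[OF \<mu>[of i] \<nu>[of i], of x A] elim by (meson add_mono order_trans)
      also have "\<dots> = (p + q + \<delta> / 3) * tail \<beta> (x - A) + \<delta> / 3 * tail \<beta> x"
        by (simp add: algebra_simps)
      also have "\<dots> \<le> (p + q + \<delta> / 3) * (c * tail \<beta> x) + \<delta> / 3 * tail \<beta> x"
        by (intro add_mono mult_left_mono) (use elim p q \<delta> in auto)
      also have "\<dots> = (p + q + \<delta>) * tail \<beta> x"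
        unfolding mult.assoc[symmetric] c_eq by (simp add: algebra_simps)
      finally show "tail (\<mu> i \<star> \<nu> i) x \<le> (p + q + \<delta>) * tail \<beta> x" .
    qed
  qed
qed

end

section \<open>The maximum of a random walk\<close>

text \<open>For independent increments of law \<open>H\<close> this is the law of the maximum of the
  first \<open>N\<close> partial sums and 0: splitting off the first increment leaves a maximum over
  one step fewer.\<close>

primrec walk_max :: "real measure \<Rightarrow> nat \<Rightarrow> real measure" where
  "walk_max H 0 = return borel 0"
| "walk_max H (Suc N) = distr (H \<star> walk_max H N) borel (max 0)"

lemma real_distribution_distr_borel:
  assumes "real_distribution H" "f \<in> borel_measurable borel"
  shows "real_distribution (distr H borel f)"
proof -
  interpret real_distribution H by fact
  show ?thesis using assms(2) by (intro real_distribution_distr) simp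
qed

lemma real_distribution_walk_max:
  assumes "real_distribution H" shows "real_distribution (walk_max H N)"
proof (induction N)
  case 0
  show ?case
    by (simp add: real_distribution_def real_distribution_axioms_def prob_space_return)
next
  case (Suc N)
  then show ?case
    by (simp add: real_distribution_distr_borel real_distribution_convolution assms)
qed

lemma tail_walk_max_0: "tail (walk_max H 0) x = (if x < 0 then 1 else 0)"
  by (simp add: tail_def measure_return)

lemma tail_distr:
  assumes "real_distribution H" "f \<in> borel_measurable borel"
  shows "tail (distr H borel f) x = measure H {y. x < f y}"
proof -
  interpret real_distribution H by fact
  show ?thesis using assms by (simp add: tail_def measure_distr vimage_def)
qed

lemma tail_walk_max_neg:
  assumes "real_distribution H" "x < 0" shows "tail (walk_max H N) x = 1"
proof (cases N)
  case (Suc n)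
  interpret real_distribution "H \<star> walk_max H n"
    by (intro real_distribution_convolution real_distribution_walk_max assms)
  have "{y. x < max 0 y} = UNIV" using assms by auto
  moreover have "real_distribution (H \<star> walk_max H n)" ..
  ultimately show ?thesis using prob_space by (simp add: Suc tail_distr)
qed (use assms in \<open>simp add: tail_walk_max_0 del: walk_max.simps\<close>)

lemma tail_walk_max_Suc:
  assumes "real_distribution H" "0 \<le> x"
  shows "tail (walk_max H (Suc N)) x = (\<integral>y. tail (walk_max H N) (x - y) \<partial>H)"
proof -
  have "real_distribution (H \<star> walk_max H N)"
    by (intro real_distribution_convolution real_distribution_walk_max assms)
  moreover have "{y. x < max 0 y} = {x<..}" using assms by auto
  ultimately have "tail (walk_max H (Suc N)) x = tail (H \<star> walk_max H N) x"
    by (simp add: tail_distr) (simp add: tail_def)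
  then show ?thesis
    using assms by (simp add: tail_convolution real_distribution_walk_max)
qed

lemma borel_measurable_tail_walk_max [measurable]:
  "real_distribution H \<Longrightarrow> tail (walk_max H N) \<in> borel_measurable borel"
  by (intro borel_measurable_tail real_distribution_walk_max)

lemma tail_walk_max_mono_Suc:
  assumes H: "real_distribution H"
  shows "tail (walk_max H N) x \<le> tail (walk_max H (Suc N)) x"
proof (induction N arbitrary: x)
  case 0
  then show ?case
    using tail_walk_max_neg[OF H, of x "Suc 0"] by (auto simp: tail_walk_max_0 simp del: walk_max.simps)
next
  case (Suc N)
  note rd = real_distribution_walk_max[OF H]
  show ?case
  proof (cases "x < 0")
    case False
    then have "0 \<le> x" by simp
    then show ?thesis
      unfolding tail_walk_max_Suc[OF H \<open>0 \<le> x\<close>]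
      using H rd by (intro integral_mono_real_distribution[where B=1 and B'=1]) (auto simp: Suc simp del: walk_max.simps)
  qed (simp add: tail_walk_max_neg[OF H] del: walk_max.simps)
qed

lemma tail_walk_max_mono:
  assumes H: "real_distribution H" and "m \<le> n"
  shows "tail (walk_max H m) x \<le> tail (walk_max H n) x"
  using tail_walk_max_mono_Suc[OF H] \<open>m \<le> n\<close> by (rule lift_Suc_mono_le)

lemma integral_distr_real_distribution:
  fixes f :: "real \<Rightarrow> real"
  assumes "real_distribution H" "f \<in> borel_measurable borel" "g \<in> borel_measurable borel"
  shows "(\<integral>y. f y \<partial>distr H borel g) = (\<integral>y. f (g y) \<partial>H)"
proof -
  interpret real_distribution H by fact
  show ?thesis using assms by (intro integral_distr) auto
qed

text \<open>
  The walk is compared with the line \<open>b - n * c\<close>.  The walk starting anew after the first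
  crossing is bounded by \<open>\<rho>\<close>; the crossing occurs with the probability that the walk with
  increments shifted by \<open>c\<close> exceeds \<open>b\<close>, and crossing in step \<open>n + 1\<close> to a level above \<open>v\<close> needs a
  jump larger than \<open>v - b + n * c\<close>.
\<close>

lemma tail_walk_max_le:
  assumes H: "real_distribution H" and \<rho>: "real_distribution \<rho>"
    and le: "\<And>x. tail (walk_max H N) x \<le> tail \<rho> x"
    and c: "0 \<le> c" and m: "m \<le> Suc N" and b: "0 \<le> b" "b \<le> x"
  shows "tail (walk_max H m) x \<le>
    (\<integral>z. min (tail (walk_max (distr H borel (\<lambda>y. y + c)) m) b) (\<Sum>n<m. tail H (x - z - b + real n * c)) \<partial>\<rho>)"
  using m b
proof (induction m arbitrary: b x)
  case 0
  then show ?case by (simp add: tail_walk_max_0 del: walk_max.simps)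
next
  case (Suc m)
  define Hc where "Hc = distr H borel (\<lambda>y. y + c)"
  have Hc: "real_distribution Hc"
    unfolding Hc_def by (intro real_distribution_distr_borel H) simp
  define q where "q m b v = min (tail (walk_max Hc m) b) (\<Sum>n<m. tail H (v - b + real n * c))" for m b v
  note [measurable] = borel_measurable_tail[OF H] borel_measurable_tail_walk_max[OF Hc]
    borel_measurable_tail_walk_max[OF H] borel_measurable_tail[OF \<rho>]
  note rd = real_distribution_walk_max[OF H] real_distribution_walk_max[OF Hc]
  have q0: "0 \<le> q m b v" for m b v by (simp add: q_def sum_nonneg)
  have q1: "q m b v \<le> 1" for m b v
    using tail_le_1[OF rd(2)[of m], of b] by (simp add: q_def min.coboundedI1)
  have q_meas: "(\<lambda>v. q m b v) \<in> borel_measurable borel" for m b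
    unfolding q_def by measurable
  \<comment> \<open>Condition on the first increment \<open>y\<close>. Either it crosses the line at
    once and the rest is dominated by \<open>\<rho>\<close>, or the induction hypothesis applies
    with distance \<open>b - c - y\<close> to the line and level \<open>x - y\<close>. Here
    \<open>z\<close> is the value drawn from \<open>\<rho>\<close> after the crossing.\<close>
  let ?f = "\<lambda>y z. if b - c < y then indicator {x - y<..} z else q m (b - c - y) (x - y - z)"
  have f_meas: "(\<lambda>(y, z). ?f y z) \<in> borel_measurable (borel \<Otimes>\<^sub>M borel)"
  proof -
    have "(\<lambda>(y, z). indicator {x - y<..} z :: real) = (\<lambda>(y, z). indicator {0<..} (z + y - x))"
      by (auto simp: fun_eq_iff indicator_def)
    then have [measurable]: "(\<lambda>(y, z). indicator {x - y<..} z :: real) \<in> borel_measurable (borel \<Otimes>\<^sub>M borel)"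
      by simp
    show ?thesis unfolding q_def by measurable
  qed
  have f1: "\<bar>?f y z\<bar> \<le> 1" for y z
    using q0 q1 by (auto simp: indicator_def)
  have f_y: "(\<lambda>y. ?f y z) \<in> borel_measurable borel" for z
    by (rule measurable_compose[OF _ f_meas, of "\<lambda>y. (y, z)", simplified]) simp
  have f_z: "(\<lambda>z. ?f y z) \<in> borel_measurable borel" for y
    by (rule measurable_compose[OF _ f_meas, of "\<lambda>z. (y, z)", simplified]) simp
  have x0: "0 \<le> x" using Suc.prems by simp
  interpret \<rho>: real_distribution \<rho> by fact
  interpret H: real_distribution H by fact
  have meas_int: "(\<lambda>y. \<integral>z. ?f y z \<partial>\<rho>) \<in> borel_measurable borel"
    using f_meas by (intro \<rho>.borel_measurable_lebesgue_integral) (simp cong: measurable_cong_sets sets_pair_measure_cong)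
  have meas_int': "(\<lambda>z. \<integral>y. ?f y z \<partial>H) \<in> borel_measurable borel"
  proof -
    have "(\<lambda>(z, y). ?f y z) \<in> borel_measurable (borel \<Otimes>\<^sub>M borel)"
      using measurable_compose[OF measurable_pair_swap' f_meas] unfolding case_prod_beta fst_conv snd_conv .
    then show ?thesis
      by (intro H.borel_measurable_lebesgue_integral) (simp cong: measurable_cong_sets sets_pair_measure_cong)
  qed
  have bd: "\<bar>\<integral>z. g z \<partial>\<nu>\<bar> \<le> 1"
    if "real_distribution \<nu>" "g \<in> borel_measurable borel" "\<And>z. \<bar>g z\<bar> \<le> 1" for g :: "real \<Rightarrow> real" and \<nu> :: "real measure"
  proof -
    interpret \<nu>: real_distribution \<nu> by fact
    have "\<bar>\<integral>z. g z \<partial>\<nu>\<bar> \<le> (\<integral>z. \<bar>g z\<bar> \<partial>\<nu>)" using integral_norm_bound[of \<nu> g] by simp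
    also have "\<dots> \<le> (\<integral>z. 1 \<partial>\<nu>)"
      using that by (intro integral_mono_real_distribution[where B=1 and B'=1]) auto
    finally show ?thesis using \<nu>.prob_space by simp
  qed
  have "tail (walk_max H (Suc m)) x = (\<integral>y. tail (walk_max H m) (x - y) \<partial>H)"
    by (rule tail_walk_max_Suc[OF H x0])
  also have "\<dots> \<le> (\<integral>y. (\<integral>z. ?f y z \<partial>\<rho>) \<partial>H)"
  proof (rule integral_mono_real_distribution[OF H, where B=1 and B'=1])
    fix y
    show "tail (walk_max H m) (x - y) \<le> (\<integral>z. ?f y z \<partial>\<rho>)"
    proof (cases "b - c < y")
      case True
      have "tail (walk_max H m) (x - y) \<le> tail (walk_max H N) (x - y)"
        using Suc.prems by (intro tail_walk_max_mono[OF H]) simp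
      also have "\<dots> \<le> tail \<rho> (x - y)" by (rule le)
      finally show ?thesis using True by (simp add: tail_eq_integral[OF \<rho>])
    next
      case False
      then have "tail (walk_max H m) (x - y) \<le> (\<integral>z. q m (b - c - y) (x - y - z) \<partial>\<rho>)"
        unfolding q_def Hc_def using Suc.prems c by (intro Suc.IH) auto
      then show ?thesis using False by simp
    qed
  qed (use meas_int rd bd[OF \<rho> f_z f1] in auto)
  \<comment> \<open>After the exchange \<open>z\<close> is fixed, and the two entries of the minimum
    are bounded separately.\<close>
  also have "\<dots> = (\<integral>z. (\<integral>y. ?f y z \<partial>H) \<partial>\<rho>)"
    by (rule integral_swap_real_distribution[OF H \<rho> f_meas f1])
  also have "\<dots> \<le> (\<integral>z. q (Suc m) b (x - z) \<partial>\<rho>)"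
  proof (rule integral_mono_real_distribution[OF \<rho>, where B=1 and B'=1])
    fix z
    have "(\<integral>y. ?f y z \<partial>H) \<le> (\<integral>y. tail (walk_max Hc m) (b - (y + c)) \<partial>H)"
    proof (rule integral_mono_real_distribution[OF H f_y _ f1, where B'=1])
      show "?f y z \<le> tail (walk_max Hc m) (b - (y + c))" for y
        using tail_walk_max_neg[OF Hc, of "b - (y + c)" m]
        by (auto simp: q_def indicator_def algebra_simps min.coboundedI1)
    qed (use rd in auto)
    also have "\<dots> = (\<integral>y. tail (walk_max Hc m) (b - y) \<partial>Hc)"
      unfolding Hc_def[symmetric]
      by (subst (2) Hc_def, subst integral_distr_real_distribution[OF H]) auto
    also have "\<dots> = tail (walk_max Hc (Suc m)) b"
      using Suc.prems by (intro tail_walk_max_Suc[OF Hc, symmetric])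
    finally have 1: "(\<integral>y. ?f y z \<partial>H) \<le> tail (walk_max Hc (Suc m)) b" .
    have "(\<integral>y. ?f y z \<partial>H) \<le>
        (\<integral>y. indicator {x - z<..} y + (\<Sum>n<m. tail H (x - z - b + real (Suc n) * c)) \<partial>H)"
    proof (rule integral_mono_real_distribution[OF H f_y _ f1, where B'="1 + (\<Sum>n<m. tail H (x - z - b + real (Suc n) * c))"])
      fix y
      have e: "x - y - z - (b - c - y) + real n * c = x - z - b + real (Suc n) * c" for n :: nat
        by (simp add: algebra_simps)
      have "q m (b - c - y) (x - y - z) \<le> (\<Sum>n<m. tail H (x - z - b + real (Suc n) * c))"
        unfolding q_def e by simp
      then show "?f y z \<le> indicator {x - z<..} y + (\<Sum>n<m. tail H (x - z - b + real (Suc n) * c))"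
        by (auto simp: indicator_def add_increasing add_increasing2 sum_nonneg)
    qed (auto simp: indicator_def sum_nonneg)
    also have "\<dots> = tail H (x - z) + (\<Sum>n<m. tail H (x - z - b + real (Suc n) * c))"
      using H.prob_space
      by (subst Bochner_Integration.integral_add)
        (auto simp: tail_def intro!: integrable_real_distribution[OF H, where B=1] simp: indicator_def)
    \<comment> \<open>Lowering the level of the immediate jump by \<open>b\<close> turns it into the
      term \<open>n = 0\<close> of the sum.\<close>
    also have "\<dots> \<le> tail H (x - z - b) + (\<Sum>n<m. tail H (x - z - b + real (Suc n) * c))"
      using tail_antimono[OF H, of "x - z - b" "x - z"] Suc.prems by simp
    also have "\<dots> = (\<Sum>n<Suc m. tail H (x - z - b + real n * c))"
      by (subst sum.lessThan_Suc_shift) simp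
    finally show "(\<integral>y. ?f y z \<partial>H) \<le> q (Suc m) b (x - z)"
      using 1 by (simp add: q_def del: walk_max.simps)
    show "\<bar>\<integral>y. ?f y z \<partial>H\<bar> \<le> 1"
      by (rule bd[OF H f_y f1])
    show "\<bar>q (Suc m) b (x - z)\<bar> \<le> 1"
      using q0 q1 by simp
  next
    show "(\<lambda>z. q (Suc m) b (x - z)) \<in> borel_measurable borel"
      by (rule measurable_compose[OF _ q_meas]) simp
  qed (rule meas_int')
  finally show ?case by (simp add: q_def Hc_def del: walk_max.simps)
qed

text \<open>
  The walk exceeds \<open>x\<close> for the first time in step \<open>n + 1\<close> if it stays below \<open>x\<close> for \<open>n\<close> steps, stays
  above the line \<open>- K - n * c\<close> and then makes a jump larger than \<open>x + K + n * c\<close>.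
\<close>

lemma tail_walk_max_ge:
  assumes H: "real_distribution H"
  shows "(\<Sum>n<N. (1 - tail (walk_max H n) x - tail (walk_max (distr H borel (\<lambda>y. - y - c)) n) K) *
      tail H (x + K + real n * c)) \<le> tail (walk_max H N) x"
proof (induction N arbitrary: x K)
  case 0
  then show ?case by (simp del: walk_max.simps)
next
  case (Suc N)
  \<comment> \<open>Increments \<open>- y - c\<close>: their walk exceeds \<open>K\<close> exactly
    when the original one has fallen below the line \<open>- K - n * c\<close>.\<close>
  define H' where "H' = distr H borel (\<lambda>y. - y - c)"
  have H': "real_distribution H'"
    unfolding H'_def by (intro real_distribution_distr_borel H) simp
  note [measurable] = borel_measurable_tail[OF H] borel_measurable_tail_walk_max[OF H']
    borel_measurable_tail_walk_max[OF H]
  note rd = real_distribution_walk_max[OF H] real_distribution_walk_max[OF H']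
  interpret H: real_distribution H by fact
  let ?t = "\<lambda>n x K. 1 - tail (walk_max H n) x - tail (walk_max H' n) K"
  \<comment> \<open>At a negative level the tail is 1 and the weight is not positive. This settles
    the case of negative \<open>x\<close> or \<open>K\<close>, and below the increments
    \<open>y > x\<close>, where the sum merely must not add to the indicator.\<close>
  have nonpos: "(\<Sum>n<k. ?t n x K * tail H (x' n)) \<le> 0" if "x < 0 \<or> K < 0" for k x K x'
  proof (intro sum_nonpos mult_nonpos_nonneg)
    show "?t n x K \<le> 0" for n
      using that tail_walk_max_neg[OF H, of x n] tail_walk_max_neg[OF H', of K n]
        tail_nonneg[of "walk_max H n" x] tail_nonneg[of "walk_max H' n" K] by (auto simp del: tail_nonneg)
  qed auto
  show ?case
  proof (cases "x < 0 \<or> K < 0")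
    case True
    then show ?thesis
      using nonpos[where ?k1="Suc N" and ?x'1="\<lambda>n. x + K + real n * c", OF True] tail_nonneg[of "walk_max H (Suc N)" x]
      unfolding H'_def by linarith
  next
    case False
    then have x: "0 \<le> x" and K: "0 \<le> K" by auto
    have int: "integrable H (\<lambda>y. ?t n (x - y) (K + c + y) * tail H z)" for n z
    proof (rule integrable_mult_left, intro Bochner_Integration.integrable_diff)
      show "integrable H (\<lambda>y. tail (walk_max H n) (x - y))"
        using rd by (intro integrable_real_distribution[OF H, where B=1]) auto
      show "integrable H (\<lambda>y. tail (walk_max H' n) (K + c + y))"
        using rd by (intro integrable_real_distribution[OF H, where B=1]) auto
    qed simp
    \<comment> \<open>The weights are affine in two tails that both satisfy the recursion: the first
      increment lowers the distance to \<open>x\<close> by \<open>y\<close> and raises the one to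
      the line by \<open>c + y\<close>.\<close>
    have t_Suc: "(\<integral>y. ?t n (x - y) (K + c + y) * tail H z \<partial>H) = ?t (Suc n) x K * tail H z" for n z
    proof -
      have i: "integrable H (\<lambda>y. tail (walk_max H n) (x - y))"
        "integrable H (\<lambda>y. tail (walk_max H' n) (K + c + y))"
        using rd by (intro integrable_real_distribution[OF H, where B=1]; auto)+
      have "tail (walk_max H' (Suc n)) K = (\<integral>y. tail (walk_max H' n) (K + c + y) \<partial>H)"
        unfolding tail_walk_max_Suc[OF H' K]
        by (subst H'_def, subst integral_distr_real_distribution[OF H]) (auto simp: algebra_simps)
      then show ?thesis
        using i H.prob_space by (simp add: tail_walk_max_Suc[OF H x] del: walk_max.simps)
    qed
    have ind: "integrable H (indicator {x<..} :: real \<Rightarrow> real)"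
      by (intro integrable_real_distribution[OF H, where B=1]) auto
    have "(\<Sum>n<Suc N. ?t n x K * tail H (x + K + real n * c)) =
        ?t 0 x K * tail H (x + K) + (\<Sum>n<N. ?t (Suc n) x K * tail H (x + K + real (Suc n) * c))"
      by (subst sum.lessThan_Suc_shift) simp
    also have "\<dots> \<le> tail H x + (\<Sum>n<N. ?t (Suc n) x K * tail H (x + K + real (Suc n) * c))"
      using x K tail_antimono[OF H, of x "x + K"] by (simp add: tail_walk_max_0 del: walk_max.simps)
    also have "\<dots> = (\<integral>y. indicator {x<..} y + (\<Sum>n<N. ?t n (x - y) (K + c + y) * tail H (x + K + real (Suc n) * c)) \<partial>H)"
    proof -
      have "(\<integral>y. (\<Sum>n<N. ?t n (x - y) (K + c + y) * tail H (x + K + real (Suc n) * c)) \<partial>H) =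
          (\<Sum>n<N. ?t (Suc n) x K * tail H (x + K + real (Suc n) * c))"
        by (subst Bochner_Integration.integral_sum[OF int]) (rule sum.cong[OF refl t_Suc])
      moreover have "integrable H (\<lambda>y. \<Sum>n<N. ?t n (x - y) (K + c + y) * tail H (x + K + real (Suc n) * c))"
        by (rule Bochner_Integration.integrable_sum[OF int])
      ultimately show ?thesis
        by (subst Bochner_Integration.integral_add[OF ind]) (simp_all only: tail_eq_integral[OF H, of x])
    qed
    also have "\<dots> \<le> (\<integral>y. tail (walk_max H N) (x - y) \<partial>H)"
    proof (rule integral_mono)
      fix y
      show "indicator {x<..} y + (\<Sum>n<N. ?t n (x - y) (K + c + y) * tail H (x + K + real (Suc n) * c)) \<le>
          tail (walk_max H N) (x - y)"
      proof (cases "x < y")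
        case True
        then show ?thesis
          using nonpos[where ?x1="x - y" and ?K1="K + c + y" and ?x'1="\<lambda>n. x + K + real (Suc n) * c" and ?k1=N] tail_walk_max_neg[OF H, of "x - y" N]
          by (simp del: walk_max.simps)
      next
        case False
        have e: "x - y + (K + c + y) + real n * c = x + K + real (Suc n) * c" for n :: nat
          by (simp add: algebra_simps)
        then show ?thesis
          using Suc.IH[of "x - y" "K + c + y", unfolded e] False unfolding H'_def by simp
      qed
    next
      show "integrable H (\<lambda>y. tail (walk_max H N) (x - y))"
        using rd by (intro integrable_real_distribution[OF H, where B=1]) auto
    qed (use ind int in auto)
    also have "\<dots> = tail (walk_max H (Suc N)) x"
      by (rule tail_walk_max_Suc[OF H x, symmetric])
    finally show ?thesis unfolding H'_def .
  qed
qed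

section \<open>Tightness of the maxima, uniformly in the number of steps\<close>

lemma AE_walk_max_nonneg:
  assumes "real_distribution H" shows "AE z in walk_max H N. 0 \<le> z"
proof -
  interpret real_distribution "walk_max H N" by (rule real_distribution_walk_max[OF assms])
  have "cdf (walk_max H N) (- inverse (real (Suc n))) = 0" for n
    using tail_walk_max_neg[OF assms, of "- inverse (real (Suc n))" N]
      prob_compl[of "{..- inverse (real (Suc n))}"]
    by (simp add: tail_def cdf_def Compl_eq_Diff_UNIV[symmetric])
  then have "AE z in walk_max H N. \<not> z \<le> - inverse (real (Suc n))" for n
    by (subst AE_iff_measurable[OF _ refl]) (auto simp: emeasure_eq_measure cdf_def atMost_def)
  then have "AE z in walk_max H N. \<forall>n. \<not> z \<le> - inverse (real (Suc n))"
    by (simp add: AE_all_countable)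
  then show ?thesis
  proof eventually_elim
    case (elim z)
    show ?case
    proof (rule ccontr)
      assume "\<not> 0 \<le> z"
      then obtain n where "inverse (real (Suc n)) < - z"
        using reals_Archimedean[of "- z"] by auto
      then have "z \<le> - inverse (real (Suc n))" by linarith
      with elim show False by blast
    qed
  qed
qed

lemma integral_convolution:
  fixes f :: "real \<Rightarrow> real"
  assumes \<mu>: "real_distribution \<mu>" and \<nu>: "real_distribution \<nu>"
    and int: "integrable \<mu> (\<lambda>x. x)" "integrable \<nu> (\<lambda>x. x)"
    and f: "f \<in> borel_measurable borel" "\<And>x. \<bar>f x\<bar> \<le> \<bar>x\<bar>"
  shows "integrable (\<mu> \<star> \<nu>) f"
    and "(\<integral>x. f x \<partial>(\<mu> \<star> \<nu>)) = (\<integral>z. (\<integral>y. f (y + z) \<partial>\<mu>) \<partial>\<nu>)"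
    and "integrable \<nu> (\<lambda>z. \<integral>y. f (y + z) \<partial>\<mu>)"
proof -
  interpret \<mu>: real_distribution \<mu> by fact
  interpret \<nu>: real_distribution \<nu> by fact
  interpret pair_prob_space \<mu> \<nu> ..
  note [measurable] = f(1)
  have "integrable (\<mu> \<Otimes>\<^sub>M \<nu>) fst" "integrable (\<mu> \<Otimes>\<^sub>M \<nu>) snd"
    using int \<nu>.prob_space by (auto intro!: Fubini_integrable)
  then have dom: "integrable (\<mu> \<Otimes>\<^sub>M \<nu>) (\<lambda>p. \<bar>fst p\<bar> + \<bar>snd p\<bar>)"
    by (intro Bochner_Integration.integrable_add integrable_abs)
  have *: "integrable (\<mu> \<Otimes>\<^sub>M \<nu>) (\<lambda>(y, z). f (y + z))"
    by (rule Bochner_Integration.integrable_bound[OF dom])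
      (auto intro!: AE_I2 order_trans[OF f(2)] order_trans[OF abs_triangle_ineq])
  show "integrable (\<mu> \<star> \<nu>) f"
    unfolding convolution_def using * by (subst integrable_distr_eq) (auto simp: case_prod_beta')
  show "(\<integral>x. f x \<partial>(\<mu> \<star> \<nu>)) = (\<integral>z. (\<integral>y. f (y + z) \<partial>\<mu>) \<partial>\<nu>)"
    unfolding convolution_def using integral_snd[OF *]
    by (subst integral_distr) (auto simp: case_prod_beta')
  show "integrable \<nu> (\<lambda>z. \<integral>y. f (y + z) \<partial>\<mu>)"
    using integrable_snd[OF *] .
qed

lemma integrable_walk_max:
  assumes H: "real_distribution H" and int: "integrable H (\<lambda>x. x)"
  shows "integrable (walk_max H N) (\<lambda>x. x)"
proof (induction N)
  case (Suc N)
  have "integrable (H \<star> walk_max H N) (max 0)"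
    by (intro integral_convolution real_distribution_walk_max assms Suc.IH) auto
  then show ?case
    by (simp add: integrable_distr_eq)
qed (simp add: integrable_iff_bounded nn_integral_return)

text \<open>
  The mean of the maximum of the first \<open>N\<close> steps would tend to \<open>-\<infinity>\<close> if the maximum
  exceeded \<open>w\<close> with probability close to 1.
\<close>

lemma walk_max_uniform_mass:
  assumes H: "real_distribution H" and int: "integrable H (\<lambda>x. x)" and neg: "(\<integral>x. x \<partial>H) < 0"
  shows "\<exists>w\<ge>0. \<exists>p>0. \<forall>N. tail (walk_max H N) w \<le> 1 - p"
proof -
  interpret H: real_distribution H by fact
  define a where "a = - (\<integral>x. x \<partial>H)"
  have a: "0 < a" using neg by (simp add: a_def)
  \<comment> \<open>A maximum that stands at \<open>z\<close> changes by \<open>m z\<close> in the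
    mean when the recursion is applied. \<open>m\<close> decreases from \<open>m 0\<close> to the
    drift \<open>- a\<close>, so above some level \<open>w\<close> it is at most
    \<open>- a / 2\<close>.\<close>
  define m where "m w = (\<integral>y. max (- w) y \<partial>H)" for w
  have int_max: "integrable H (max w)" for w
    using int by (rule Bochner_Integration.integrable_max[OF H.integrable_const])
  have m_anti: "m w' \<le> m w" if "w \<le> w'" for w w'
    unfolding m_def using that by (intro integral_mono int_max) auto
  have m0: "0 \<le> m 0" unfolding m_def by (intro integral_nonneg_AE) auto
  have "(\<lambda>n. m (real n)) \<longlonglongrightarrow> (\<integral>y. y \<partial>H)"
    unfolding m_def
  proof (rule integral_dominated_convergence[where w="\<lambda>y. \<bar>y\<bar>"])
    show "AE y in H. (\<lambda>n. max (- real n) y) \<longlonglongrightarrow> y"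
    proof (rule AE_I2)
      fix y :: real
      have "\<forall>\<^sub>F n in sequentially. max (- real n) y = y"
        using eventually_ge_at_top[of "nat \<lceil>- y\<rceil>"] by eventually_elim linarith
      then show "(\<lambda>n. max (- real n) y) \<longlonglongrightarrow> y" by (rule tendsto_eventually)
    qed
    show "AE y in H. norm (max (- real n) y) \<le> \<bar>y\<bar>" for n
    proof (rule AE_I2)
      show "norm (max (- real n) y) \<le> \<bar>y\<bar>" for y :: real
        by (cases "- real n \<le> y") (auto simp: max_def)
    qed
  qed (auto intro!: integrable_abs int)
  then have "\<forall>\<^sub>F n in sequentially. m (real n) < - (a / 2)"
    by (rule order_tendstoD) (use a in \<open>simp add: a_def\<close>)
  then obtain n where n: "m (real n) < - (a / 2)"
    by (auto dest: eventually_happens)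
  define w where "w = real n"
  have w: "0 \<le> w" "m w \<le> - (a / 2)" using n by (auto simp: w_def)
  define e where "e N = (\<integral>x. x \<partial>walk_max H N)" for N
  have e0: "0 \<le> e N" for N
    unfolding e_def using AE_walk_max_nonneg[OF H] by (rule integral_nonneg_AE)
  have step: "e (Suc N) \<le> e N + m 0 - (m 0 + a / 2) * tail (walk_max H N) w" for N
  proof -
    define \<rho> where "\<rho> = walk_max H N"
    have \<rho>: "real_distribution \<rho>" unfolding \<rho>_def by (rule real_distribution_walk_max[OF H])
    interpret \<rho>: real_distribution \<rho> by fact
    have int\<rho>: "integrable \<rho> (\<lambda>x. x)" unfolding \<rho>_def by (rule integrable_walk_max[OF H int])
    have int_ind: "integrable \<rho> (indicator {w<..} :: real \<Rightarrow> real)"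
      by (rule integrable_real_distribution[OF \<rho>, where B=1]) auto
    have int_b: "integrable \<rho> (\<lambda>z. m 0 - (m 0 + a / 2) * indicator {w<..} z)"
      by (intro Bochner_Integration.integrable_diff \<rho>.integrable_const integrable_mult_right int_ind)
    note conv = integral_convolution[OF H \<rho> int int\<rho>, of "max 0"]
    have "e (Suc N) = (\<integral>x. max 0 x \<partial>(H \<star> \<rho>))"
      unfolding e_def walk_max.simps \<rho>_def[symmetric] by (subst integral_distr) auto
    also have "\<dots> = (\<integral>z. (\<integral>y. max 0 (y + z) \<partial>H) \<partial>\<rho>)"
      by (rule conv) auto
    also have "\<dots> \<le> (\<integral>z. z + (m 0 - (m 0 + a / 2) * indicator {w<..} z) \<partial>\<rho>)"
    proof (rule integral_mono_AE)
      show "integrable \<rho> (\<lambda>z. \<integral>y. max 0 (y + z) \<partial>H)" by (rule conv) auto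
      show "integrable \<rho> (\<lambda>z. z + (m 0 - (m 0 + a / 2) * indicator {w<..} z))"
        by (rule Bochner_Integration.integrable_add[OF int\<rho> int_b])
      show "AE z in \<rho>. (\<integral>y. max 0 (y + z) \<partial>H) \<le> z + (m 0 - (m 0 + a / 2) * indicator {w<..} z)"
        using AE_walk_max_nonneg[OF H, of N] unfolding \<rho>_def[symmetric]
      proof eventually_elim
        case (elim z)
        have "(\<integral>y. max 0 (y + z) \<partial>H) = (\<integral>y. max (- z) y + z \<partial>H)"
          by (intro Bochner_Integration.integral_cong) (auto simp: max_def)
        also have "\<dots> = m z + z"
          using int_max H.prob_space by (simp add: m_def)
        finally show ?case
          using m_anti[OF elim] m_anti[of w z] w by (auto simp: indicator_def)
      qed
    qed
    also have "\<dots> = e N + (m 0 - (m 0 + a / 2) * tail \<rho> w)"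
    proof -
      have "(\<integral>z. m 0 - (m 0 + a / 2) * indicator {w<..} z \<partial>\<rho>) = m 0 - (m 0 + a / 2) * tail \<rho> w"
        using \<rho>.prob_space
        by (subst Bochner_Integration.integral_diff[OF \<rho>.integrable_const integrable_mult_right[OF int_ind]])
          (simp add: tail_def)
      then show ?thesis
        by (subst Bochner_Integration.integral_add[OF int\<rho> int_b]) (simp only: e_def \<rho>_def)
    qed
    finally show ?thesis by (simp add: \<rho>_def)
  qed
  \<comment> \<open>Break-even point: with mass at least \<open>1 - p\<close> above
    \<open>w\<close>, the mean changes by at most
    \<open>m 0 - (m 0 + a / 2) * (1 - p) = - a / 4\<close>.\<close>
  define p where "p = (a / 4) / (m 0 + a / 2)"
  have p: "0 < p" using a m0 by (simp add: p_def)
  have "m 0 + a / 2 \<noteq> 0" using a m0 by linarith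
  then have p_eq: "(m 0 + a / 2) * p = a / 4" unfolding p_def by (rule times_divide_eq_right[THEN trans, OF nonzero_mult_div_cancel_left])
  have "tail (walk_max H N) w \<le> 1 - p" for N
  proof (rule ccontr)
    assume N: "\<not> tail (walk_max H N) w \<le> 1 - p"
    \<comment> \<open>The tails increase with the horizon, so too much mass above \<open>w\<close>
      at \<open>N\<close> persists at every later step, and the nonnegative mean would become
      negative.\<close>
    have "e (N + k) \<le> e N - k * (a / 4)" for k
    proof (induction k)
      case (Suc k)
      have "1 - p \<le> tail (walk_max H (N + k)) w"
        using N tail_walk_max_mono[OF H, of N "N + k" w] by simp
      then have "(m 0 + a / 2) * (1 - p) \<le> (m 0 + a / 2) * tail (walk_max H (N + k)) w"
        using a m0 by (intro mult_left_mono) auto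
      moreover have "(m 0 + a / 2) * (1 - p) = m 0 + a / 4"
        using p_eq by (simp add: algebra_simps)
      ultimately have "e (Suc (N + k)) \<le> e (N + k) - a / 4"
        using step[of "N + k"] by linarith
      moreover have "real (Suc k) * (a / 4) = real k * (a / 4) + a / 4"
        by (simp add: algebra_simps)
      ultimately show ?case using Suc.IH unfolding add_Suc_right by linarith
    qed simp
    moreover obtain k :: nat where "e N / (a / 4) < k" using reals_Archimedean2 by blast
    then have "e N < real k * (a / 4)"
      using a by (subst (asm) pos_divide_less_eq) auto
    ultimately show False
      using e0[of "N + k"] by (meson diff_less_0_iff_less le_less_trans not_le)
  qed
  with w p show ?thesis by blast
qed

lemma sum_of_bool_less_le: "(\<Sum>n<m. of_bool (real n < t)) \<le> max 0 (t + 1)"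
proof (induction m)
  case (Suc m)
  have "(\<Sum>n<m. of_bool (real n < t)) \<le> (\<Sum>n<m. 1 :: real)"
    by (intro sum_mono) auto
  then show ?case using Suc by (auto simp: of_bool_def)
qed simp

text \<open>A jump of size \<open>y\<close> exceeds at most \<open>(y - u) / c + 1\<close> of the
  levels \<open>u + real n * c\<close>; the mean of this count bounds the sum for all
  \<open>m\<close> at once.\<close>

lemma sum_tail_le:
  assumes H: "real_distribution H" and int: "integrable H (\<lambda>x. x)" and c: "0 < c"
  shows "(\<Sum>n<m. tail H (u + real n * c)) \<le> (\<integral>y. max 0 ((y - u) / c + 1) \<partial>H)"
proof -
  interpret H: real_distribution H by fact
  have i: "integrable H (indicator {x<..} :: real \<Rightarrow> real)" for x
    by (intro integrable_real_distribution[OF H, where B=1]) auto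
  have "(\<Sum>n<m. tail H (u + real n * c)) = (\<integral>y. (\<Sum>n<m. indicator {u + real n * c<..} y) \<partial>H)"
    unfolding tail_eq_integral[OF H] by (rule Bochner_Integration.integral_sum[symmetric, OF i])
  also have "\<dots> \<le> (\<integral>y. max 0 ((y - u) / c + 1) \<partial>H)"
  proof (rule integral_mono)
    show "integrable H (\<lambda>y. max 0 ((y - u) / c + 1))"
      using int by (intro Bochner_Integration.integrable_max) auto
    fix y
    have "(\<Sum>n<m. indicator {u + real n * c<..} y) = (\<Sum>n<m. of_bool (real n < (y - u) / c) :: real)"
      using c by (intro sum.cong) (auto simp: indicator_def field_simps)
    then show "(\<Sum>n<m. indicator {u + real n * c<..} y) \<le> max 0 ((y - u) / c + 1)"
      using sum_of_bool_less_le[of "(y - u) / c" m] by simp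
  qed (intro Bochner_Integration.integrable_sum i)
  finally show ?thesis .
qed

lemma integrable_distr_shift:
  assumes H: "real_distribution H" and int: "integrable H (\<lambda>x. x)"
  shows "integrable (distr H borel (\<lambda>y. s * y + c)) (\<lambda>x. x)"
    and "(\<integral>x. x \<partial>distr H borel (\<lambda>y. s * y + c)) = s * (\<integral>x. x \<partial>H) + c"
proof -
  interpret H: real_distribution H by fact
  have i: "integrable H (\<lambda>y. s * y)" by (rule integrable_mult_right[OF int])
  show "integrable (distr H borel (\<lambda>y. s * y + c)) (\<lambda>x. x)"
    using Bochner_Integration.integrable_add[OF i H.integrable_const[of c]]
    by (subst integrable_distr_eq) simp_all
  show "(\<integral>x. x \<partial>distr H borel (\<lambda>y. s * y + c)) = s * (\<integral>x. x \<partial>H) + c"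
    using Bochner_Integration.integral_add[OF i H.integrable_const[of c]] H.prob_space
    by (subst integral_distr) simp_all
qed

text \<open>Shifting the increments by half the absolute drift keeps the drift negative, so
  \<open>walk_max_uniform_mass\<close> gives a probability of at least \<open>p\<close>, at every
  horizon, that the walk never crosses the corresponding line. Raising the level by
  \<open>w + A\<close> therefore costs a factor \<open>1 - p\<close>, up to a small error.\<close>

lemma walk_max_vanish:
  assumes H: "real_distribution H" and int: "integrable H (\<lambda>x. x)" and neg: "(\<integral>x. x \<partial>H) < 0"
    and \<epsilon>: "0 < \<epsilon>"
  shows "\<exists>x\<ge>0. \<forall>N. tail (walk_max H N) x \<le> \<epsilon>"
proof -
  interpret H: real_distribution H by fact
  define c where "c = - (\<integral>x. x \<partial>H) / 2"
  have c: "0 < c" using neg by (simp add: c_def)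
  define Hc where "Hc = distr H borel (\<lambda>y. y + c)"
  have Hc: "real_distribution Hc"
    unfolding Hc_def by (intro real_distribution_distr_borel H) simp
  have "integrable Hc (\<lambda>x. x)" "(\<integral>x. x \<partial>Hc) < 0"
    using integrable_distr_shift[OF H int, of 1 c] neg by (auto simp: Hc_def c_def)
  from walk_max_uniform_mass[OF Hc this] obtain w p
    where w: "0 \<le> w" and p: "0 < p" and wp: "\<And>N. tail (walk_max Hc N) w \<le> 1 - p" by blast
  have p1: "p \<le> 1" using wp[of 0] tail_nonneg[of "walk_max Hc 0" w] by linarith
  \<comment> \<open>Bounds the probability of a crossing jump that has to exceed \<open>u\<close> at
    the first step and \<open>c\<close> more at each later one.\<close>
  define g where "g u = (\<integral>y. max 0 ((y - u) / c + 1) \<partial>H)" for u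
  have g_int: "integrable H (\<lambda>y. max 0 ((y - u) / c + 1))" for u
    using int by (intro Bochner_Integration.integrable_max) auto
  have g_anti: "g u' \<le> g u" if "u \<le> u'" for u u'
    unfolding g_def using that c
    by (intro integral_mono g_int max.mono add_right_mono divide_right_mono) auto
  have g0: "0 \<le> g u" for u unfolding g_def by (intro integral_nonneg_AE) auto
  have "(\<lambda>n. g (real n)) \<longlonglongrightarrow> (\<integral>y. 0 \<partial>H)"
    unfolding g_def
  proof (rule integral_dominated_convergence[where w="\<lambda>y. max 0 ((y - 0) / c + 1)"])
    show "AE y in H. (\<lambda>n. max 0 ((y - real n) / c + 1)) \<longlonglongrightarrow> 0"
    proof (rule AE_I2)
      fix y :: real
      have "\<forall>\<^sub>F n in sequentially. max 0 ((y - real n) / c + 1) = 0"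
        using eventually_ge_at_top[of "nat \<lceil>y + c\<rceil>"]
      proof eventually_elim
        case (elim n)
        then have "y + c \<le> real n" by linarith
        then show ?case using c by (simp add: field_simps max_def)
      qed
      then show "(\<lambda>n. max 0 ((y - real n) / c + 1)) \<longlonglongrightarrow> 0" by (rule tendsto_eventually)
    qed
    show "AE y in H. norm (max 0 ((y - real n) / c + 1)) \<le> max 0 ((y - 0) / c + 1)" for n
      proof (rule AE_I2)
      fix y
      have "max 0 ((y - real n) / c + 1) \<le> max 0 ((y - 0) / c + 1)"
        using c by (intro max.mono add_right_mono divide_right_mono) auto
      then show "norm (max 0 ((y - real n) / c + 1)) \<le> max 0 ((y - 0) / c + 1)" by simp
    qed
  qed (use g_int[of 0] in auto)
  \<comment> \<open>The map \<open>v \<mapsto> g A + (1 - p) * v\<close> has fixed point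
    \<open>g A / p\<close>; this makes it smaller than \<open>\<epsilon> / 2\<close>, and the other
    half is left for the power of \<open>1 - p\<close>.\<close>
  then have "\<forall>\<^sub>F n in sequentially. g (real n) < \<epsilon> * p / 2"
    using \<epsilon> p by (intro order_tendstoD) auto
  then obtain n where n: "g (real n) < \<epsilon> * p / 2"
    by (auto dest: eventually_happens)
  define A where "A = real n"
  \<comment> \<open>If the restarted maximum \<open>z\<close> is at most \<open>x - w - A\<close>,
    the crossing jump must exceed \<open>A\<close>; otherwise only the probability of crossing at
    all is used.\<close>
  have step: "tail (walk_max H (Suc N)) x \<le> g A + (1 - p) * tail (walk_max H N) (x - w - A)"
    if x: "w \<le> x" for x N
  proof -
    define \<rho> where "\<rho> = walk_max H N"
    have \<rho>: "real_distribution \<rho>" unfolding \<rho>_def by (rule real_distribution_walk_max[OF H])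
    interpret \<rho>: real_distribution \<rho> by fact
    note [measurable] = borel_measurable_tail[OF H]
    have "tail (walk_max H (Suc N)) x \<le>
      (\<integral>z. min (tail (walk_max Hc (Suc N)) w) (\<Sum>n<Suc N. tail H (x - z - w + real n * c)) \<partial>\<rho>)"
      unfolding Hc_def \<rho>_def
      by (rule tail_walk_max_le) (use H real_distribution_walk_max[OF H] c w x in auto)
    also have "\<dots> \<le> (\<integral>z. g A + (1 - p) * indicator {x - w - A<..} z \<partial>\<rho>)"
    proof (rule integral_mono_real_distribution[OF \<rho>, where B=1 and B'="g A + 1"])
      fix z
      show "min (tail (walk_max Hc (Suc N)) w) (\<Sum>n<Suc N. tail H (x - z - w + real n * c))
          \<le> g A + (1 - p) * indicator {x - w - A<..} z"
      proof (cases "x - w - A < z")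
        case True
        have "min (tail (walk_max Hc (Suc N)) w) (\<Sum>n<Suc N. tail H (x - z - w + real n * c)) \<le> 1 - p"
          using wp[of "Suc N"] by (rule min.coboundedI1)
        then show ?thesis using True g0[of A] by simp
      next
        case False
        have "(\<Sum>n<Suc N. tail H (x - z - w + real n * c)) \<le> g (x - z - w)"
          unfolding g_def by (rule sum_tail_le[OF H int c])
        also have "\<dots> \<le> g A" by (rule g_anti) (use False in simp)
        finally show ?thesis using False by (intro min.coboundedI2) simp
      qed
      show "\<bar>min (tail (walk_max Hc (Suc N)) w) (\<Sum>n<Suc N. tail H (x - z - w + real n * c))\<bar> \<le> 1"
      proof -
        have "0 \<le> (\<Sum>n<Suc N. tail H (x - z - w + real n * c))" by (intro sum_nonneg tail_nonneg)
        moreover have "0 \<le> tail (walk_max Hc (Suc N)) w" "tail (walk_max Hc (Suc N)) w \<le> 1"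
          by (intro tail_nonneg tail_le_1 real_distribution_walk_max Hc)+
        ultimately show ?thesis by linarith
      qed
      show "\<bar>g A + (1 - p) * indicator {x - w - A<..} z\<bar> \<le> g A + 1"
        using g0[of A] p p1 by (auto simp: indicator_def)
    qed auto
    also have "\<dots> = g A + (1 - p) * tail \<rho> (x - w - A)"
    proof -
      have "integrable \<rho> (\<lambda>z. (1 - p) * indicator {x - w - A<..} z)"
        by (rule integrable_mult_right, rule integrable_real_distribution[OF \<rho>, where B=1]) auto
      from Bochner_Integration.integral_add[OF \<rho>.integrable_const this, of "g A"] show ?thesis
        using \<rho>.prob_space by (simp add: tail_def)
    qed
    finally show ?thesis by (simp add: \<rho>_def del: walk_max.simps)
  qed
  have A: "0 \<le> A" by (simp add: A_def)
  have iter: "tail (walk_max H N) x \<le> g A / p + (1 - p) ^ j" if "real j * (w + A) \<le> x" "0 \<le> x" for j x N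
    using that
  proof (induction j arbitrary: x N)
    case 0
    have "0 \<le> g A / p" using g0[of A] p by simp
    then show ?case using tail_le_1[OF real_distribution_walk_max[OF H], of N x] by simp
  next
    case (Suc j)
    show ?case
    proof (cases N)
      case 0
      have "0 \<le> g A / p" "0 \<le> (1 - p) ^ Suc j" using g0[of A] p p1 by simp_all
      then show ?thesis using Suc.prems 0 by (simp add: tail_walk_max_0 del: walk_max.simps)
    next
      case (Suc M)
      have 1: "real j * (w + A) + (w + A) \<le> x" using Suc.prems by (simp add: algebra_simps)
      have 2: "0 \<le> real j * (w + A)" using A w by simp
      have "tail (walk_max H (Suc M)) x \<le> g A + (1 - p) * tail (walk_max H M) (x - w - A)"
        by (rule step) (use 1 2 A in linarith)
      also have "\<dots> \<le> g A + (1 - p) * (g A / p + (1 - p) ^ j)"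
        using p1 by (intro add_left_mono mult_left_mono Suc.IH) (use 1 2 in auto)
      also have "\<dots> = g A / p + (1 - p) ^ Suc j"
        using p by (simp add: field_simps)
      finally show ?thesis by (simp add: Suc del: walk_max.simps)
    qed
  qed
  have "(\<lambda>j. (1 - p) ^ j) \<longlonglongrightarrow> 0"
    using p p1 by (intro LIMSEQ_power_zero) auto
  then have "\<forall>\<^sub>F j in sequentially. (1 - p) ^ j < \<epsilon> / 2"
    using \<epsilon> by (intro order_tendstoD) auto
  then obtain j where j: "(1 - p) ^ j < \<epsilon> / 2"
    by (auto dest: eventually_happens)
  have "g A / p < \<epsilon> / 2"
    using n p by (simp add: A_def field_simps)
  then have "tail (walk_max H N) (real j * (w + A)) \<le> \<epsilon>" for N
  proof -
    have "0 \<le> real j * (w + A)" using A w by simp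
    from iter[OF order_refl this, of N] j \<open>g A / p < \<epsilon> / 2\<close> show ?thesis by linarith
  qed
  then show ?thesis
    using A w by (intro exI[of _ "real j * (w + A)"]) auto
qed

section \<open>Veraverbeke's theorem\<close>

text \<open>Here \<open>\<beta>\<close> stands for the integrated tail law and \<open>Fb\<close> for
  the tail of \<open>F\<close>. Of the integral relation only the bounds on increments are kept,
  which is what Riemann sums need; \<open>x1\<close> is a point past which the cap at 1 in the
  integrated tail is inactive.\<close>

locale integrated_subexp = subexp_distribution \<beta> for \<beta> :: "real measure" +
  fixes Fb :: "real \<Rightarrow> real" and x1 :: real
  assumes Fb_nonneg: "\<And>x. 0 \<le> Fb x"
    and increment_ge: "\<And>x h. x1 \<le> x \<Longrightarrow> 0 \<le> h \<Longrightarrow> h * Fb (x + h) \<le> tail \<beta> x - tail \<beta> (x + h)"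
    and increment_le: "\<And>x h. x1 \<le> x \<Longrightarrow> 0 \<le> h \<Longrightarrow> tail \<beta> x - tail \<beta> (x + h) \<le> h * Fb x"
begin

text \<open>Each term is paid for by the increment of \<open>tail \<beta>\<close> over the preceding
  interval of length \<open>c\<close>, which explains \<open>u - c\<close>; the sum telescopes. In
  \<open>sum_Fb_ge\<close> the following interval is used.\<close>

lemma sum_Fb_le:
  assumes "x1 \<le> u - c" "0 < c"
  shows "(\<Sum>n<m. Fb (u + real n * c)) \<le> tail \<beta> (u - c) / c"
proof -
  have "(\<Sum>n<m. c * Fb (u + real n * c)) \<le>
      (\<Sum>n<m. tail \<beta> (u - c + real n * c) - tail \<beta> (u - c + real (Suc n) * c))"
  proof (rule sum_mono)
    fix n
    have "0 \<le> real n * c" using assms by simp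
    then have "x1 \<le> u - c + real n * c" using assms by linarith
    from increment_ge[OF this, of c] assms
    show "c * Fb (u + real n * c) \<le> tail \<beta> (u - c + real n * c) - tail \<beta> (u - c + real (Suc n) * c)"
      by (simp add: algebra_simps)
  qed
  also have "\<dots> = tail \<beta> (u - c) - tail \<beta> (u - c + real m * c)"
    by (subst sum_lessThan_telescope') simp
  also have "\<dots> \<le> tail \<beta> (u - c)" by simp
  finally show ?thesis
    using assms by (simp add: sum_distrib_left[symmetric] pos_le_divide_eq mult.commute)
qed

lemma sum_Fb_ge:
  assumes "x1 \<le> u" "0 < c"
  shows "(tail \<beta> u - tail \<beta> (u + real m * c)) / c \<le> (\<Sum>n<m. Fb (u + real n * c))"
proof -
  have "tail \<beta> u - tail \<beta> (u + real m * c) =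
      (\<Sum>n<m. tail \<beta> (u + real n * c) - tail \<beta> (u + real (Suc n) * c))"
    by (subst sum_lessThan_telescope') simp
  also have "\<dots> \<le> (\<Sum>n<m. c * Fb (u + real n * c))"
  proof (rule sum_mono)
    fix n
    have "0 \<le> real n * c" using assms by simp
    then have "x1 \<le> u + real n * c" using assms by linarith
    from increment_le[OF this, of c] assms
    show "tail \<beta> (u + real n * c) - tail \<beta> (u + real (Suc n) * c) \<le> c * Fb (u + real n * c)"
      by (simp add: algebra_simps)
  qed
  finally show ?thesis
    using assms by (simp add: sum_distrib_left[symmetric] pos_divide_le_eq mult.commute)
qed

text \<open>One step of the recursion in terms of \<open>\<beta>\<close>:
  \<open>tail_walk_max_le\<close> is applied with the previous maximum as \<open>\<rho>\<close>, and
  its minimum is estimated by whichever entry is better for the value \<open>z\<close> of that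
  maximum.\<close>

lemma tail_walk_max_Suc_le:
  assumes H: "real_distribution H" and c: "0 < c" and b: "0 \<le> b" and D: "0 \<le> D"
    and \<gamma>: "\<And>N. tail (walk_max (distr H borel (\<lambda>y. y + c)) N) b \<le> \<gamma>"
    and u0: "x1 + c \<le> u0" "\<And>u. u0 \<le> u \<Longrightarrow> tail H u \<le> D * Fb u"
    and A: "u0 \<le> A" and x: "A + u0 + b \<le> x" "b \<le> x"
  shows "tail (walk_max H (Suc N)) x \<le> D / c * tail \<beta> (x - (b + c) - A) +
    \<gamma> * tail (walk_max H N) (x - (b + c) - A) + D / c * both_large \<beta> (walk_max H N) A (x - (b + c))"
proof -
  define \<rho> where "\<rho> = walk_max H N"
  have \<rho>: "real_distribution \<rho>" unfolding \<rho>_def by (rule real_distribution_walk_max[OF H])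
  interpret \<rho>: real_distribution \<rho> by fact
  define Hc where "Hc = distr H borel (\<lambda>y. y + c)"
  have Hc: "real_distribution Hc"
    unfolding Hc_def by (intro real_distribution_distr_borel H) simp
  note [measurable] = borel_measurable_tail[OF H] borel_measurable_tail[OF real_dist]
  \<comment> \<open>Total loss of level: \<open>b\<close> from the starting height of the line and
    \<open>c\<close> from \<open>sum_Fb_le\<close>.\<close>
  define R where "R = b + c"
  define C where "C = D / c"
  have C: "0 \<le> C" using D c by (simp add: C_def)
  have \<gamma>0: "0 \<le> \<gamma>" using \<gamma>[of 0] tail_nonneg order_trans by blast
  define q where "q v = min (tail (walk_max Hc (Suc N)) b) (\<Sum>n<Suc N. tail H (v - b + real n * c))" for v
  have q_meas[measurable]: "q \<in> borel_measurable borel" unfolding q_def by measurable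
  have q_le: "q v \<le> \<gamma>" for v
    unfolding q_def Hc_def using \<gamma>[of "Suc N"] by (rule min.coboundedI1)
  have q_bd: "\<bar>q v\<bar> \<le> 1" for v
  proof -
    have "0 \<le> (\<Sum>n<Suc N. tail H (v - b + real n * c))" by (intro sum_nonneg tail_nonneg)
    moreover have "0 \<le> tail (walk_max Hc (Suc N)) b" "tail (walk_max Hc (Suc N)) b \<le> 1"
      by (intro tail_nonneg tail_le_1 real_distribution_walk_max Hc)+
    ultimately show ?thesis unfolding q_def by linarith
  qed
  have q_tail: "q v \<le> C * tail \<beta> (v - R)" if v: "u0 + b \<le> v" for v
  proof -
    have "q v \<le> (\<Sum>n<Suc N. tail H (v - b + real n * c))"
      unfolding q_def by (rule min.cobounded2)
    also have "\<dots> \<le> (\<Sum>n<Suc N. D * Fb (v - b + real n * c))"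
    proof (intro sum_mono u0)
      show "u0 \<le> v - b + real n * c" for n
        using v c by (simp add: add_increasing2)
    qed
    also have "\<dots> \<le> D * (tail \<beta> (v - b - c) / c)"
      unfolding sum_distrib_left[symmetric]
      by (intro mult_left_mono sum_Fb_le) (use u0 v c D in auto)
    finally show ?thesis by (simp add: C_def R_def algebra_simps)
  qed
  have int_ind: "integrable \<rho> (\<lambda>z. \<gamma> * indicator {x - R - A<..} z)"
    by (rule integrable_mult_right, rule integrable_real_distribution[OF \<rho>, where B=1]) auto
  have int_both: "integrable \<rho> (\<lambda>z. C * (indicator {A<..} z * tail \<beta> (max A (x - R - z))))"
    by (rule integrable_mult_right, rule integrable_real_distribution[OF \<rho>, where B=1])
      (auto simp: indicator_def)
  have "tail (walk_max H (Suc N)) x \<le> (\<integral>z. q (x - z) \<partial>\<rho>)"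
    unfolding q_def Hc_def \<rho>_def
    by (rule tail_walk_max_le) (use H real_distribution_walk_max[OF H] c b x in auto)
  also have "\<dots> \<le> (\<integral>z. C * tail \<beta> (x - R - A) + \<gamma> * indicator {x - R - A<..} z +
      C * (indicator {A<..} z * tail \<beta> (max A (x - R - z))) \<partial>\<rho>)"
  proof (rule integral_mono)
    show "integrable \<rho> (\<lambda>z. q (x - z))"
      using q_bd by (intro integrable_real_distribution[OF \<rho>]) auto
    show "integrable \<rho> (\<lambda>z. C * tail \<beta> (x - R - A) + \<gamma> * indicator {x - R - A<..} z +
      C * (indicator {A<..} z * tail \<beta> (max A (x - R - z))))"
      by (intro Bochner_Integration.integrable_add int_ind int_both \<rho>.integrable_const)
    fix z
    have nn: "0 \<le> C * tail \<beta> (x - R - A)" "0 \<le> \<gamma> * indicator {x - R - A<..} z"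
      "0 \<le> C * (indicator {A<..} z * tail \<beta> (max A (x - R - z)))"
      using C \<gamma>0 by (auto simp: indicator_def)
    \<comment> \<open>Small \<open>z\<close>: a jump to nearly \<open>x\<close> is needed. Large
      \<open>z\<close>: only the crossing probability \<open>\<gamma>\<close> counts. In between,
      jump and restarted maximum both exceed \<open>A\<close>.\<close>
    consider "z \<le> A" | "x - R - A < z" | "A < z" "z \<le> x - R - A" by linarith
    then show "q (x - z) \<le> C * tail \<beta> (x - R - A) + \<gamma> * indicator {x - R - A<..} z +
      C * (indicator {A<..} z * tail \<beta> (max A (x - R - z)))"
    proof cases
      case 1
      have "q (x - z) \<le> C * tail \<beta> (x - z - R)" by (rule q_tail) (use 1 x in linarith)
      also have "\<dots> \<le> C * tail \<beta> (x - R - A)"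
        by (intro mult_left_mono tail_antimono C real_dist) (use 1 in linarith)
      finally show ?thesis using nn by linarith
    next
      case 2
      then have "q (x - z) \<le> \<gamma> * indicator {x - R - A<..} z" using q_le by simp
      then show ?thesis using nn by linarith
    next
      case 3
      then have "max A (x - R - z) = x - z - R" by linarith
      moreover have "q (x - z) \<le> C * tail \<beta> (x - z - R)"
        by (rule q_tail) (use 3 A c in \<open>simp add: R_def\<close>)
      ultimately have "q (x - z) \<le> C * (indicator {A<..} z * tail \<beta> (max A (x - R - z)))"
        using 3 by (simp add: algebra_simps)
      then show ?thesis using nn by linarith
    qed
  qed
  also have "\<dots> = C * tail \<beta> (x - R - A) + \<gamma> * tail \<rho> (x - R - A) + C * both_large \<beta> \<rho> A (x - R)"
  proof -
    have "(\<integral>z. C * tail \<beta> (x - R - A) + \<gamma> * indicator {x - R - A<..} z \<partial>\<rho>) =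
        C * tail \<beta> (x - R - A) + \<gamma> * tail \<rho> (x - R - A)"
      using Bochner_Integration.integral_add[OF \<rho>.integrable_const int_ind] \<rho>.prob_space
      by (simp add: tail_def)
    then show ?thesis
      by (subst Bochner_Integration.integral_add
          [OF Bochner_Integration.integrable_add[OF \<rho>.integrable_const int_ind] int_both])
        (simp add: both_large_def)
  qed
  finally show ?thesis by (simp only: C_def R_def \<rho>_def)
qed

lemma both_large_walk_max_le:
  assumes "real_distribution H" "\<And>x. tail (walk_max H N) x \<le> K * tail \<beta> x" "0 \<le> K"
  shows "both_large \<beta> (walk_max H N) A x \<le> K * both_large \<beta> \<beta> A x"
  using both_large_le[of \<beta> "walk_max H N" \<beta> A 1 K x] assms real_distribution_walk_max by simp

lemma jump_levels:
  assumes D: "\<forall>\<^sub>F u in at_top. tail H u \<le> D * Fb u" and \<epsilon>: "0 < \<epsilon>"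
  obtains u0 A where "b \<le> u0" "\<And>u. u0 \<le> u \<Longrightarrow> tail H u \<le> D * Fb u"
    "u0 \<le> A" "\<forall>\<^sub>F x in at_top. both_large \<beta> \<beta> A x \<le> \<epsilon> * tail \<beta> x"
proof -
  have "\<forall>\<^sub>F u0 in at_top. b \<le> u0 \<and> (\<forall>u\<ge>u0. tail H u \<le> D * Fb u) \<and>
      (\<forall>\<^sub>F x in at_top. both_large \<beta> \<beta> u0 x \<le> \<epsilon> * tail \<beta> x)"
    using eventually_ge_at_top[of b] eventually_all_ge_at_top[OF D] both_large_self[OF \<epsilon>]
    by eventually_elim auto
  from eventually_happens'[OF trivial_limit_at_top_linorder this] show ?thesis
    using that by blast
qed

lemma exists_shift_level:
  assumes H: "real_distribution H" and int: "integrable H (\<lambda>x. x)" and c: "(\<integral>x. x \<partial>H) + c < 0"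
    and \<gamma>: "0 < \<gamma>"
  shows "\<exists>b\<ge>0. \<forall>N. tail (walk_max (distr H borel (\<lambda>y. y + c)) N) b \<le> \<gamma>"
proof (rule walk_max_vanish)
  show "real_distribution (distr H borel (\<lambda>y. y + c))"
    by (intro real_distribution_distr_borel H) simp
  show "integrable (distr H borel (\<lambda>y. y + c)) (\<lambda>x. x)" "(\<integral>x. x \<partial>distr H borel (\<lambda>y. y + c)) < 0"
    using integrable_distr_shift[OF H int, of 1 c] c by simp_all
qed fact

text \<open>The error terms in \<open>tail_walk_max_Suc_le\<close> contain the previous maximum;
  before they can be made small, it must be known to be of the order of \<open>tail \<beta>\<close>.
  For a crude constant any line less steep than the drift will do, and the induction over
  \<open>N\<close> closes because these terms return only half of the bound.\<close>

lemma walk_max_bounded: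
  assumes H: "real_distribution H" and int: "integrable H (\<lambda>x. x)" and neg: "(\<integral>x. x \<partial>H) < 0"
    and D: "0 \<le> D" "\<forall>\<^sub>F u in at_top. tail H u \<le> D * Fb u"
  shows "\<exists>K\<ge>0. \<forall>N x. tail (walk_max H N) x \<le> K * tail \<beta> x"
proof -
  define c where "c = - (\<integral>x. x \<partial>H) / 2"
  have c: "0 < c" "(\<integral>x. x \<partial>H) + c < 0" using neg by (auto simp: c_def)
  obtain b where b: "0 \<le> b" "\<And>N. tail (walk_max (distr H borel (\<lambda>y. y + c)) N) b \<le> 1 / 8"
    using exists_shift_level[OF H int c(2), of "1 / 8"] by auto
  define C where "C = D / c"
  have C: "0 \<le> C" using D c by (simp add: C_def)
  define \<epsilon> where "\<epsilon> = 1 / (8 * (C + 1))"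
  have \<epsilon>: "0 < \<epsilon>" "C * \<epsilon> \<le> 1 / 8" using C by (auto simp: \<epsilon>_def field_simps)
  obtain u0 A where u0: "x1 + c \<le> u0" "\<And>u. u0 \<le> u \<Longrightarrow> tail H u \<le> D * Fb u"
    and A: "u0 \<le> A" "\<forall>\<^sub>F x in at_top. both_large \<beta> \<beta> A x \<le> \<epsilon> * tail \<beta> x"
    using jump_levels[OF D(2) \<epsilon>(1)] by blast
  define R where "R = b + c"
  have two: "(1::real) < 2" by simp
  have "\<forall>\<^sub>F x in at_top. A + u0 + b \<le> x \<and> b \<le> x \<and> both_large \<beta> \<beta> A (x - R) \<le> \<epsilon> * tail \<beta> (x - R) \<and>
      tail \<beta> (x - R) \<le> 2 * tail \<beta> x \<and> tail \<beta> (x - (R + A)) \<le> 2 * tail \<beta> x"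
    using eventually_ge_at_top[of "A + u0 + b"] eventually_ge_at_top[of b]
      eventually_compose_filterlim[OF A(2) filterlim_minus_const_at_top[of R]]
      eventually_shift_le[OF two, of R] eventually_shift_le[OF two, of "R + A"]
    by eventually_elim auto
  then obtain x0 where x0: "\<And>x. x0 \<le> x \<Longrightarrow> A + u0 + b \<le> x \<and> b \<le> x \<and>
      both_large \<beta> \<beta> A (x - R) \<le> \<epsilon> * tail \<beta> (x - R) \<and>
      tail \<beta> (x - R) \<le> 2 * tail \<beta> x \<and> tail \<beta> (x - (R + A)) \<le> 2 * tail \<beta> x"
    by (auto simp: eventually_at_top_linorder)
  \<comment> \<open>\<open>4 * C\<close> keeps the direct jump within half of \<open>K\<close>, the
    factor 2 for the shift included; the two terms with the previous maximum get a quarter each, by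
    the choices \<open>1 / 8\<close>. The summand \<open>1 / tail \<beta> x0\<close> makes the claim
    trivial below \<open>x0\<close>.\<close>
  define K where "K = 4 * C + 1 / tail \<beta> x0"
  have K0: "1 / tail \<beta> x0 \<le> K" "4 * C \<le> K" using C tail_pos[of x0] by (auto simp: K_def)
  have "1 \<le> 1 / tail \<beta> x0" using tail_pos[of x0] tail_le_1[OF real_dist, of x0]
    by (simp add: le_divide_eq_1_pos)
  then have K1: "1 \<le> K" using K0(1) by linarith
  have "tail (walk_max H N) x \<le> K * tail \<beta> x" for N x
  proof (induction N arbitrary: x)
    case 0
    show ?case
      using K1 tail_neg[of x] tail_pos[of x] by (auto simp: tail_walk_max_0 simp del: walk_max.simps)
  next
    case (Suc N)
    show ?case
    proof (cases "x0 \<le> x")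
      case False
      have "tail (walk_max H (Suc N)) x \<le> 1"
        by (rule tail_le_1[OF real_distribution_walk_max[OF H]])
      also have "\<dots> = 1 / tail \<beta> x0 * tail \<beta> x0" using tail_pos[of x0] by simp
      also have "\<dots> \<le> K * tail \<beta> x"
        using False K0 K1 by (intro mult_mono tail_antimono real_dist) auto
      finally show ?thesis .
    next
      case True
      note x = x0[OF True]
      have "both_large \<beta> (walk_max H N) A (x - R) \<le> K * both_large \<beta> \<beta> A (x - R)"
        by (rule both_large_walk_max_le[OF H Suc.IH]) (use K1 in simp)
      also have "\<dots> \<le> K * (\<epsilon> * (2 * tail \<beta> x))"
      proof (rule mult_left_mono)
        have "both_large \<beta> \<beta> A (x - R) \<le> \<epsilon> * tail \<beta> (x - R)" using x by blast
        also have "\<dots> \<le> \<epsilon> * (2 * tail \<beta> x)" using x \<epsilon> by (intro mult_left_mono) auto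
        finally show "both_large \<beta> \<beta> A (x - R) \<le> \<epsilon> * (2 * tail \<beta> x)" .
      qed (use K1 in simp)
      finally have 1: "C * both_large \<beta> (walk_max H N) A (x - R) \<le> C * (K * (\<epsilon> * (2 * tail \<beta> x)))"
        using C by (rule mult_left_mono)
      have "C * \<epsilon> * (2 * K * tail \<beta> x) \<le> 1 / 8 * (2 * K * tail \<beta> x)"
        using \<epsilon> K1 by (intro mult_right_mono) auto
      with 1 have 1: "C * both_large \<beta> (walk_max H N) A (x - R) \<le> 1 / 4 * (K * tail \<beta> x)"
        by (simp add: algebra_simps)
      have "tail (walk_max H N) (x - R - A) \<le> K * tail \<beta> (x - (R + A))"
        using Suc.IH[of "x - R - A"] by (simp add: algebra_simps)
      also have "\<dots> \<le> K * (2 * tail \<beta> x)" using x K1 by (intro mult_left_mono) auto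
      finally have 2: "1 / 8 * tail (walk_max H N) (x - R - A) \<le> 1 / 4 * (K * tail \<beta> x)" by simp
      have "C * tail \<beta> (x - R - A) \<le> C * (2 * tail \<beta> x)"
        using x C by (intro mult_left_mono) (auto simp: algebra_simps)
      also have "\<dots> = 4 * C * (tail \<beta> x / 2)" by simp
      also have "\<dots> \<le> K * (tail \<beta> x / 2)" using K0 by (intro mult_right_mono) auto
      finally have 3: "C * tail \<beta> (x - R - A) \<le> 1 / 2 * (K * tail \<beta> x)" by simp
      have "tail (walk_max H (Suc N)) x \<le> C * tail \<beta> (x - R - A) +
         1 / 8 * tail (walk_max H N) (x - R - A) + C * both_large \<beta> (walk_max H N) A (x - R)"
        unfolding C_def R_def
        by (rule tail_walk_max_Suc_le[OF H c(1) b(1) D(1) b(2) u0 A(1)]) (use x in auto)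
      then show ?thesis using 1 2 3 by linarith
    qed
  qed
  with K1 show ?thesis by (intro exI[of _ K]) auto
qed

text \<open>The one-step inequality again, now with a slope close to \<open>\<mu>\<close>. As
  \<open>walk_max_bounded\<close> already controls the previous maximum, its contributions are small
  outright and no further induction is needed.\<close>

theorem tail_bound_walk_max:
  assumes H: "real_distribution H" and int: "integrable H (\<lambda>x. x)" and neg: "(\<integral>x. x \<partial>H) = - \<mu>" "0 < \<mu>"
    and D: "0 \<le> D" "\<And>\<delta>. 0 < \<delta> \<Longrightarrow> \<forall>\<^sub>F u in at_top. tail H u \<le> (D + \<delta>) * Fb u"
  shows "tail_bound \<beta> (walk_max H) (D / \<mu>)"
  unfolding tail_bound_def
proof (intro allI impI)
  fix \<delta> :: real assume \<delta>: "0 < \<delta>"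
  have "\<exists>K\<ge>0. \<forall>N x. tail (walk_max H N) x \<le> K * tail \<beta> x"
    by (rule walk_max_bounded[OF H int _ _ D(2)[of 1]]) (use D neg in auto)
  then obtain K where K: "0 \<le> K" "\<And>N x. tail (walk_max H N) x \<le> K * tail \<beta> x" by blast
  \<comment> \<open>One parameter \<open>t\<close> serves as the slack in the jump tail and as the
    gap between slope and drift.\<close>
  have "((\<lambda>t. (D + t) / (\<mu> - t)) \<longlongrightarrow> (D + 0) / (\<mu> - 0)) (at_right 0)"
    using neg by (intro tendsto_intros) auto
  then have "\<forall>\<^sub>F t in at_right 0. (D + t) / (\<mu> - t) < D / \<mu> + \<delta> / 4"
    by (rule order_tendstoD) (use \<delta> in simp)
  moreover have "\<forall>\<^sub>F t in at_right 0. t < \<mu>" "\<forall>\<^sub>F t in at_right (0::real). 0 < t"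
    using neg by (auto simp: eventually_at_right_less eventually_at_right_field intro!: exI[of _ \<mu>])
  ultimately have "\<forall>\<^sub>F t in at_right 0. (D + t) / (\<mu> - t) < D / \<mu> + \<delta> / 4 \<and> t < \<mu> \<and> 0 < t"
    by eventually_elim auto
  then obtain t where t: "(D + t) / (\<mu> - t) < D / \<mu> + \<delta> / 4" "t < \<mu>" "0 < t"
    by (metis (no_types, lifting) eventually_happens'[OF trivial_limit_at_right_real])
  define c where "c = \<mu> - t"
  have c: "0 < c" "(\<integral>x. x \<partial>H) + c < 0" using t neg by (auto simp: c_def)
  define C where "C = (D + t) / c"
  have C: "0 \<le> C" "C < D / \<mu> + \<delta> / 4" using D c t by (auto simp: C_def c_def)
  define \<gamma> where "\<gamma> = \<delta> / (8 * (K + 1))"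
  have \<gamma>: "0 < \<gamma>" "\<gamma> * K \<le> \<delta> / 8" using \<delta> K by (auto simp: \<gamma>_def field_simps)
  define \<epsilon> where "\<epsilon> = \<delta> / (8 * (C * K + 1))"
  have \<epsilon>: "0 < \<epsilon>" "C * K * \<epsilon> \<le> \<delta> / 8"
  proof -
    have "0 \<le> C * K" using C K by simp
    moreover have "k * (\<delta> / (8 * (k + 1))) \<le> \<delta> / 8" if "0 \<le> k" for k
      using that \<delta> by (simp add: field_simps)
    ultimately show "0 < \<epsilon>" "C * K * \<epsilon> \<le> \<delta> / 8"
      using \<delta> unfolding \<epsilon>_def by auto
  qed
  obtain b where b: "0 \<le> b" "\<And>N. tail (walk_max (distr H borel (\<lambda>y. y + c)) N) b \<le> \<gamma>"
    using exists_shift_level[OF H int c(2) \<gamma>(1)] by auto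
  obtain u0 A where u0: "x1 + c \<le> u0" "\<And>u. u0 \<le> u \<Longrightarrow> tail H u \<le> (D + t) * Fb u"
    and A: "u0 \<le> A" "\<forall>\<^sub>F x in at_top. both_large \<beta> \<beta> A x \<le> \<epsilon> * tail \<beta> x"
    using jump_levels[OF D(2)[OF t(3)] \<epsilon>(1)] by blast
  define R where "R = b + c"
  \<comment> \<open>\<open>s\<close> pays for the shifts by \<open>R\<close> and
    \<open>R + A\<close>. The three terms add up to \<open>C + \<delta> / 8 + \<delta> / 8\<close>,
    so the total is \<open>C + \<delta> / 2\<close>, which is below
    \<open>D / \<mu> + \<delta>\<close>.\<close>
  define s where "s = (C + \<delta> / 2) / (C + \<delta> / 4)"
  have s: "1 < s" "(C + \<delta> / 4) * s = C + \<delta> / 2"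
    using C \<delta> by (auto simp: s_def field_simps add_nonneg_pos)
  have Ct: "0 \<le> D + t" using D t by simp
  show "\<forall>\<^sub>F x in at_top. \<forall>N. tail (walk_max H N) x \<le> (D / \<mu> + \<delta>) * tail \<beta> x"
    using eventually_ge_at_top[of "A + u0 + b"] eventually_ge_at_top[of b]
      eventually_compose_filterlim[OF A(2) filterlim_minus_const_at_top[of R]]
      eventually_shift_le[OF s(1), of R] eventually_shift_le[OF s(1), of "R + A"]
  proof eventually_elim
    case x: (elim x)
    show ?case
    proof
      fix N
      show "tail (walk_max H N) x \<le> (D / \<mu> + \<delta>) * tail \<beta> x"
      proof (cases N)
        case 0
        then show ?thesis using x b \<delta> D neg by (simp add: tail_walk_max_0 del: walk_max.simps)
      next
        case (Suc M)
        have "both_large \<beta> (walk_max H M) A (x - R) \<le> K * both_large \<beta> \<beta> A (x - R)"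
          by (rule both_large_walk_max_le[OF H K(2,1)])
        also have "\<dots> \<le> K * (\<epsilon> * (s * tail \<beta> x))"
        proof (rule mult_left_mono[OF _ K(1)])
          have "both_large \<beta> \<beta> A (x - R) \<le> \<epsilon> * tail \<beta> (x - R)" using x by blast
          also have "\<dots> \<le> \<epsilon> * (s * tail \<beta> x)" using x \<epsilon> by (intro mult_left_mono) auto
          finally show "both_large \<beta> \<beta> A (x - R) \<le> \<epsilon> * (s * tail \<beta> x)" .
        qed
        finally have "C * both_large \<beta> (walk_max H M) A (x - R) \<le> C * (K * (\<epsilon> * (s * tail \<beta> x)))"
          using C(1) by (rule mult_left_mono)
        also have "\<dots> = C * K * \<epsilon> * (s * tail \<beta> x)" by (simp only: mult.assoc)
        also have "\<dots> \<le> \<delta> / 8 * (s * tail \<beta> x)"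
          using \<epsilon> s by (intro mult_right_mono) auto
        finally have 1: "C * both_large \<beta> (walk_max H M) A (x - R) \<le> \<delta> / 8 * (s * tail \<beta> x)" .
        have "\<gamma> * tail (walk_max H M) (x - R - A) \<le> \<gamma> * (K * (s * tail \<beta> x))"
        proof (rule mult_left_mono)
          have "tail (walk_max H M) (x - R - A) \<le> K * tail \<beta> (x - (R + A))"
            using K(2)[of M "x - R - A"] by (simp add: algebra_simps)
          also have "\<dots> \<le> K * (s * tail \<beta> x)" using x K(1) by (intro mult_left_mono) auto
          finally show "tail (walk_max H M) (x - R - A) \<le> K * (s * tail \<beta> x)" .
        qed (use \<gamma> in simp)
        also have "\<dots> = \<gamma> * K * (s * tail \<beta> x)" by (simp only: mult.assoc)
        also have "\<dots> \<le> \<delta> / 8 * (s * tail \<beta> x)"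
          using \<gamma> s by (intro mult_right_mono) auto
        finally have 2: "\<gamma> * tail (walk_max H M) (x - R - A) \<le> \<delta> / 8 * (s * tail \<beta> x)" .
        have 3: "C * tail \<beta> (x - R - A) \<le> C * (s * tail \<beta> x)"
          using x C by (intro mult_left_mono) (auto simp: algebra_simps)
        have "tail (walk_max H (Suc M)) x \<le> C * tail \<beta> (x - R - A) +
           \<gamma> * tail (walk_max H M) (x - R - A) + C * both_large \<beta> (walk_max H M) A (x - R)"
          unfolding C_def R_def
          by (rule tail_walk_max_Suc_le[OF H c(1) b(1) Ct b(2) u0 A(1)]) (use x in auto)
        also have "\<dots> \<le> C * (s * tail \<beta> x) + \<delta> / 8 * (s * tail \<beta> x) + \<delta> / 8 * (s * tail \<beta> x)"
          using 1 2 3 by linarith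
        also have "\<dots> = (C + \<delta> / 4) * s * tail \<beta> x" by (simp add: algebra_simps)
        also have "\<dots> = (C + \<delta> / 2) * tail \<beta> x" unfolding s(2) ..
        also have "\<dots> \<le> (D / \<mu> + \<delta>) * tail \<beta> x"
          using C \<delta> by (intro mult_right_mono) auto
        finally show ?thesis by (simp add: Suc del: walk_max.simps)
      qed
    qed
  qed
qed

text \<open>With slope \<open>\<mu> + t\<close>, slightly steeper than the drift, the reflected
  increments have mean \<open>- t\<close>. So \<open>walk_max_vanish\<close> keeps the walk above
  \<open>- K - n * c\<close> and below \<open>x\<close>, up to probability \<open>t\<close> each,
  uniformly in the horizon. The jumps from there sum to a lower Riemann sum for
  \<open>\<beta>\<close>; the long tail of \<open>\<beta>\<close> absorbs \<open>K\<close> and the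
  shift \<open>A\<close> of the hypothesis.\<close>

theorem tail_walk_max_lower:
  assumes H: "real_distribution H" and int: "integrable H (\<lambda>x. x)" and neg: "(\<integral>x. x \<partial>H) = - \<mu>" "0 < \<mu>"
    and D: "\<And>\<delta>. 0 < \<delta> \<Longrightarrow> \<exists>A. \<forall>\<^sub>F u in at_top. (D - \<delta>) * Fb (u + A) \<le> tail H u"
    and \<delta>: "0 < \<delta>"
  shows "\<forall>\<^sub>F x in at_top. \<exists>N. (D / \<mu> - \<delta>) * tail \<beta> x \<le> tail (walk_max H N) x"
proof (cases "D / \<mu> \<le> \<delta>")
  case True
  then have "(D / \<mu> - \<delta>) * tail \<beta> x \<le> 0" for x
    by (intro mult_nonpos_nonneg) auto
  then have "(D / \<mu> - \<delta>) * tail \<beta> x \<le> tail (walk_max H 0) x" for x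
    using tail_nonneg order_trans by blast
  then show ?thesis by (intro always_eventually) blast
next
  case False
  with \<delta> neg have D0: "0 < D" by (smt (verit) divide_nonpos_pos)
  \<comment> \<open>Losses: \<open>1 - 2 * t\<close> for the weights in
    \<open>tail_walk_max_ge\<close>, one factor \<open>1 - t\<close> for moving the level by
    \<open>K + A\<close>, another for stopping the sum at \<open>N\<close>, and the quotient for the
    tail constant and the slope.\<close>
  have "((\<lambda>t. (1 - 2 * t) * (1 - t) * (1 - t) * ((D - t) / (\<mu> + t))) \<longlongrightarrow>
      (1 - 2 * 0) * (1 - 0) * (1 - 0) * ((D - 0) / (\<mu> + 0))) (at_right 0)"
    using neg by (intro tendsto_intros) auto
  then have "\<forall>\<^sub>F t in at_right 0. D / \<mu> - \<delta> < (1 - 2 * t) * (1 - t) * (1 - t) * ((D - t) / (\<mu> + t))"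
    by (rule order_tendstoD) (use \<delta> in simp)
  moreover have "\<forall>\<^sub>F t in at_right 0. t < D" "\<forall>\<^sub>F t in at_right (0::real). 0 < t" "\<forall>\<^sub>F t in at_right (0::real). t < 1 / 2"
    using order_tendstoD(2)[OF tendsto_ident_at, of 0 D "{0<..}"] D0
      order_tendstoD(2)[OF tendsto_ident_at, of 0 "1 / 2 :: real" "{0<..}"]
    by (simp_all add: eventually_at_right_less)
  ultimately have "\<forall>\<^sub>F t in at_right 0. D / \<mu> - \<delta> < (1 - 2 * t) * (1 - t) * (1 - t) * ((D - t) / (\<mu> + t)) \<and>
      t < D \<and> 0 < t \<and> t < 1 / 2"
    by eventually_elim auto
  then obtain t where t: "D / \<mu> - \<delta> < (1 - 2 * t) * (1 - t) * (1 - t) * ((D - t) / (\<mu> + t))" "t < D" "0 < t" "t < 1 / 2"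
    by (metis (no_types, lifting) eventually_happens'[OF trivial_limit_at_right_real])
  define c where "c = \<mu> + t"
  have c: "0 < c" using neg t by (simp add: c_def)
  obtain K where K: "0 \<le> K" "\<And>N. tail (walk_max (distr H borel (\<lambda>y. - y - c)) N) K \<le> t"
  proof -
    have eq: "(\<lambda>y. - 1 * y + - c) = (\<lambda>y. - y - c)" by auto
    have "\<exists>K\<ge>0. \<forall>N. tail (walk_max (distr H borel (\<lambda>y. - y - c)) N) K \<le> t"
    proof (rule walk_max_vanish)
      show "real_distribution (distr H borel (\<lambda>y. - y - c))"
        by (intro real_distribution_distr_borel H) simp
      show "integrable (distr H borel (\<lambda>y. - y - c)) (\<lambda>x. x)" "(\<integral>x. x \<partial>distr H borel (\<lambda>y. - y - c)) < 0"
        using integrable_distr_shift[OF H int, of "-1" "- c", unfolded eq] t neg(1) by (simp_all add: c_def)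
    qed (rule t)
    then show ?thesis using that by blast
  qed
  obtain x2 where x2: "0 \<le> x2" "\<And>N. tail (walk_max H N) x2 \<le> t"
    using walk_max_vanish[OF H int _ t(3)] neg by auto
  obtain A where A: "\<forall>\<^sub>F u in at_top. (D - t) * Fb (u + A) \<le> tail H u"
    using D[OF t(3)] by blast
  have A': "\<forall>\<^sub>F x in at_top. \<forall>u\<ge>x. (D - t) * Fb (u + A) \<le> tail H u"
    by (rule eventually_all_ge_at_top[OF A])
  have t1: "1 - t < 1" using t by simp
  show ?thesis
    using eventually_ge_at_top[of x2] eventually_compose_filterlim[OF A' filterlim_minus_const_at_top[of "- K"]]
      eventually_ge_at_top[of "x1 - K - A"] eventually_shift_ge[OF t1, of "- (K + A)"]
  proof eventually_elim
    case x: (elim x)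
    define u where "u = x + K + A"
    \<comment> \<open>The horizon may depend on \<open>x\<close>: it must be long enough for the
      remainder of the sum to be a small part of \<open>tail \<beta> u\<close>.\<close>
    have "filterlim (\<lambda>n. u + real n * c) at_top sequentially"
      by (intro filterlim_tendsto_add_at_top[OF tendsto_const] filterlim_at_top_mult_tendsto_pos[OF tendsto_const c]
          filterlim_real_sequentially)
    from filterlim_compose[OF tail_tendsto_0[OF real_dist] this]
    have "\<forall>\<^sub>F n in sequentially. tail \<beta> (u + real n * c) < t * tail \<beta> u"
      by (rule order_tendstoD) (use t tail_pos in simp)
    then obtain N where N: "tail \<beta> (u + real N * c) < t * tail \<beta> u"
      by (auto dest: eventually_happens)
    have "(D / \<mu> - \<delta>) * tail \<beta> x \<le> (1 - 2 * t) * (1 - t) * (1 - t) * ((D - t) / c) * tail \<beta> x"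
      using t by (intro mult_right_mono) (auto simp: c_def)
    also have "\<dots> = (1 - 2 * t) * ((D - t) * ((1 - t) * ((1 - t) * tail \<beta> x) / c))"
      by simp
    also have "\<dots> \<le> (1 - 2 * t) * ((D - t) * ((1 - t) * tail \<beta> u / c))"
      using x t c by (intro mult_left_mono divide_right_mono) (auto simp: u_def algebra_simps)
    also have "\<dots> \<le> (1 - 2 * t) * ((D - t) * ((tail \<beta> u - tail \<beta> (u + real N * c)) / c))"
      using t c N by (intro mult_left_mono divide_right_mono) (auto simp: algebra_simps)
    also have "\<dots> \<le> (1 - 2 * t) * ((D - t) * (\<Sum>n<N. Fb (u + real n * c)))"
      using t c x by (intro mult_left_mono sum_Fb_ge) (auto simp: u_def)
    also have "\<dots> = (\<Sum>n<N. (1 - 2 * t) * ((D - t) * Fb (x + K + real n * c + A)))"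
      by (simp add: sum_distrib_left u_def algebra_simps)
    also have "\<dots> \<le> (\<Sum>n<N. (1 - tail (walk_max H n) x - tail (walk_max (distr H borel (\<lambda>y. - y - c)) n) K) *
      tail H (x + K + real n * c))"
    proof (intro sum_mono mult_mono)
      fix n
      have "tail (walk_max H n) x \<le> tail (walk_max H n) x2"
        using x by (intro tail_antimono real_distribution_walk_max H) auto
      then show "1 - 2 * t \<le> 1 - tail (walk_max H n) x - tail (walk_max (distr H borel (\<lambda>y. - y - c)) n) K"
        using x2(2)[of n] K(2)[of n] by linarith
      then show "0 \<le> 1 - tail (walk_max H n) x - tail (walk_max (distr H borel (\<lambda>y. - y - c)) n) K"
        using t by linarith
      show "(D - t) * Fb (x + K + real n * c + A) \<le> tail H (x + K + real n * c)"
        using x c by simp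
      show "0 \<le> (D - t) * Fb (x + K + real n * c + A)"
        using t Fb_nonneg by simp
    qed
    also have "\<dots> \<le> tail (walk_max H N) x"
      by (rule tail_walk_max_ge[OF H])
    finally show ?case by blast
  qed
qed

end

section \<open>Monotone-separable networks\<close>

lemma last_activity_cong:
  assumes "\<And>k. m \<le> k \<Longrightarrow> k \<le> n \<Longrightarrow> t k = t' k" "\<And>k. m \<le> k \<Longrightarrow> k \<le> n \<Longrightarrow> z k = z' k"
  shows "last_activity f m n t z = last_activity f m n t' z'"
proof -
  have "(\<lambda>i\<in>{..<nat (n - m + 1)}. t (m + int i)) = (\<lambda>i\<in>{..<nat (n - m + 1)}. t' (m + int i))"
    "(\<lambda>i\<in>{..<nat (n - m + 1)}. z (m + int i)) = (\<lambda>i\<in>{..<nat (n - m + 1)}. z' (m + int i))"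
    by (auto intro!: restrict_ext assms)
  then show ?thesis unfolding last_activity_def Let_def by simp
qed

lemma dater_Q_eq: "dater_Q f m n z = last_activity f m n (\<lambda>_. 0) z"
  by (simp add: dater_Q_def maximal_dater_def)

lemma dater_Q_cong:
  assumes "\<And>k. m \<le> k \<Longrightarrow> k \<le> n \<Longrightarrow> z k = z' k"
  shows "dater_Q f m n z = dater_Q f m n z'"
  unfolding dater_Q_eq by (rule last_activity_cong) (use assms in auto)

lemma dater_Q_shift: "dater_Q f m n (\<lambda>k. z (k + s)) = dater_Q f (m + s) (n + s) z"
  unfolding dater_Q_eq last_activity_def by (simp add: algebra_simps)

context monotone_separable
begin

lemma last_activity_const:
  assumes "range z \<subseteq> space K" "m \<le> n"
  shows "last_activity f m n (\<lambda>_. c) z = dater_Q f m n z + c"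
  using homogeneity[of "\<lambda>_. 0" z m n c] assms by (simp add: dater_Q_eq mono_def)

lemma dater_Q_nonneg:
  assumes "range z \<subseteq> space K" "m \<le> n" shows "0 \<le> dater_Q f m n z"
  using causality[of "\<lambda>_. 0" z m n] assms by (simp add: dater_Q_eq mono_def)

text \<open>A window of length one sees a single epoch, so the input may be replaced by a constant
  one and homogeneity applies.\<close>

lemma maximal_dater_single:
  assumes "range z \<subseteq> space K" shows "maximal_dater f i i t z = dater_Q f i i z"
proof -
  have "last_activity f i i t z = last_activity f i i (\<lambda>_. t i) z"
    by (rule last_activity_cong) auto
  then show ?thesis using assms by (simp add: maximal_dater_def last_activity_const)
qed

text \<open>
  Delaying the arrivals after \<open>l\<close> until the first part of the input has been processed and the
  last customer has arrived separates the two parts.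
\<close>

lemma last_activity_split_le:
  assumes t: "mono t" and z: "range z \<subseteq> space K" and mln: "m \<le> l" "l < n"
  shows "last_activity f m n t z \<le> max (last_activity f m l t z) (t n) + dater_Q f (l + 1) n z"
proof -
  define c where "c = max (last_activity f m l t z) (t n)"
  define t' where "t' k = (if k \<le> l then t k else max c (t k))" for k
  have t': "mono t'"
  proof (rule monoI)
    fix j k :: int assume "j \<le> k"
    then show "t' j \<le> t' k"
      using monoD[OF t, of j k] by (auto simp: t'_def)
  qed
  have eq: "last_activity f m l t' z = last_activity f m l t z"
    by (rule last_activity_cong) (auto simp: t'_def)
  have "last_activity f m n t z \<le> last_activity f m n t' z"
    by (rule external_monotonicity) (use t t' z mln in \<open>auto simp: t'_def\<close>)
  also have "\<dots> = last_activity f (l + 1) n t' z"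
    by (rule separability) (use t' z mln in \<open>auto simp: eq t'_def c_def\<close>)
  also have "\<dots> = last_activity f (l + 1) n (\<lambda>_. c) z"
  proof (rule last_activity_cong)
    fix k assume "l + 1 \<le> k" "k \<le> n"
    then show "t' k = c"
      using monoD[OF t, of k n] by (simp add: t'_def c_def)
  qed simp
  also have "\<dots> = c + dater_Q f (l + 1) n z"
    using mln z by (simp add: last_activity_const)
  finally show ?thesis by (simp add: c_def)
qed

lemma dater_Q_subadditive:
  assumes "range z \<subseteq> space K" "m \<le> l" "l < n"
  shows "dater_Q f m n z \<le> dater_Q f m l z + dater_Q f (l + 1) n z"
proof -
  have "mono (\<lambda>_::int. 0::real)" by (simp add: mono_def)
  from last_activity_split_le[OF this assms] dater_Q_nonneg[OF assms(1,2)]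
  show ?thesis by (simp add: dater_Q_eq)
qed

lemma dater_Q_le_sum:
  assumes z: "range z \<subseteq> space K" and "m \<le> n"
  shows "dater_Q f m n z \<le> (\<Sum>i\<in>{m..n}. dater_Q f i i z)"
  using \<open>m \<le> n\<close>
proof (induction n rule: int_ge_induct)
  case (step n)
  have "{m..n + 1} = insert (n + 1) {m..n}" using step by auto
  then show ?case
    using dater_Q_subadditive[OF z, of m n "n + 1"] step by simp
qed simp

text \<open>Advance the arrivals up to \<open>m\<close> by the time \<open>c\<close> that customer
  \<open>m\<close> alone needs. This customer has then left by \<open>t m\<close>, so separability
  discards it, and monotonicity restores the original arrivals.\<close>

lemma last_activity_extend:
  assumes t: "mono t" and z: "range z \<subseteq> space K" and mn: "m < n"
  shows "last_activity f (m + 1) n t z \<le> last_activity f m n t z"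
proof -
  define c where "c = dater_Q f m m z"
  have c: "0 \<le> c" unfolding c_def using z by (intro dater_Q_nonneg) auto
  define t' where "t' k = (if k \<le> m then t k - c else t k)" for k
  have t': "mono t'"
  proof (rule monoI)
    fix j k :: int assume "j \<le> k"
    then show "t' j \<le> t' k"
      using monoD[OF t, of j k] c by (auto simp: t'_def)
  qed
  have "last_activity f m m t' z = last_activity f m m (\<lambda>_. t m - c) z"
    by (rule last_activity_cong) (auto simp: t'_def)
  also have "\<dots> = t m" using z by (simp add: last_activity_const c_def)
  finally have "last_activity f m m t' z \<le> t' (m + 1)"
    using monoD[OF t, of m "m + 1"] by (simp add: t'_def)
  then have "last_activity f m n t' z = last_activity f (m + 1) n t' z"
    by (intro separability) (use t' z mn in auto)
  also have "\<dots> = last_activity f (m + 1) n t z"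
    by (rule last_activity_cong) (auto simp: t'_def)
  finally show ?thesis
    using external_monotonicity[OF t' t z, of m n] mn c by (simp add: t'_def)
qed

lemma maximal_dater_antimono:
  assumes t: "mono t" and z: "range z \<subseteq> space K" and "m' \<le> m" "m \<le> n"
  shows "maximal_dater f m n t z \<le> maximal_dater f m' n t z"
  using \<open>m' \<le> m\<close>
proof (induction m' rule: int_le_induct)
  case (step m')
  then show ?case
    using last_activity_extend[OF t z, of "m' - 1" n] \<open>m \<le> n\<close> by (simp add: maximal_dater_def)
qed simp

text \<open>Unfolds Lindley's recursion for the upper-bound queue.\<close>

lemma maximal_dater_le_queue:
  fixes L :: nat and t :: "int \<Rightarrow> real" and z :: "int \<Rightarrow> 'k"
  defines "s \<equiv> \<lambda>n. dater_Q f (int L * (n - 1) + 1) (int L * n) z"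
    and "\<tau> \<equiv> \<lambda>n. t (int L * n) - t (int L * (n - 1))"
  assumes t: "mono t" and z: "range z \<subseteq> space K" and L: "1 \<le> L"
  shows "\<exists>j\<le>k. maximal_dater f (int L * (n - 1 - int k) + 1) (int L * n) t z \<le>
    s n + (\<Sum>i\<in>{n - int j..n - 1}. s i - \<tau> (i + 1))"
proof (induction k arbitrary: n)
  case 0
  \<comment> \<open>Monotonicity compares inputs at all indices. Cutting off the arrivals after the
    window, which it does not see, allows the comparison with the constant input
    \<open>t (int L * n)\<close>.\<close>
  have "last_activity f (int L * (n - 1) + 1) (int L * n) t z =
      last_activity f (int L * (n - 1) + 1) (int L * n) (\<lambda>k. min (t k) (t (int L * n))) z"
    by (rule last_activity_cong) (use t in \<open>auto simp: monoD min_def intro: antisym\<close>)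
  also have "\<dots> \<le> last_activity f (int L * (n - 1) + 1) (int L * n) (\<lambda>_. t (int L * n)) z"
    by (rule external_monotonicity)
      (use t z L in \<open>auto simp: mono_def algebra_simps intro: min.coboundedI1\<close>)
  also have "\<dots> = s n + t (int L * n)"
    unfolding s_def using z L by (intro last_activity_const) (auto simp: algebra_simps)
  finally show ?case by (simp add: maximal_dater_def)
next
  case (Suc k)
  define m where "m = int L * (n - 1 - int (Suc k)) + 1"
  define l where "l = int L * (n - 1)"
  have ln: "l < int L * n" using L by (simp add: l_def algebra_simps)
  have "0 \<le> int L * int k" "1 \<le> int L" using L by simp_all
  moreover have "m = l - int L * int k - int L + 1" by (simp add: l_def m_def algebra_simps)
  ultimately have ml: "m \<le> l" by linarith
  from Suc.IH[of "n - 1"] obtain j where j: "j \<le> k"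
      "maximal_dater f (int L * (n - 1 - 1 - int k) + 1) l t z \<le>
        s (n - 1) + (\<Sum>i\<in>{n - 1 - int j..n - 1 - 1}. s i - \<tau> (i + 1))"
    unfolding l_def by blast
  have m: "int L * (n - 1 - 1 - int k) + 1 = m" by (simp add: m_def algebra_simps)
  have "last_activity f m (int L * n) t z \<le> max (last_activity f m l t z) (t (int L * n)) + s n"
    using last_activity_split_le[OF t z ml ln] by (simp add: s_def l_def)
  \<comment> \<open>Either block \<open>n\<close> is held up only by its own last arrival, and the
    sum is empty, or it waits for the previous blocks, and the sum grows by one term.\<close>
  then consider "maximal_dater f m (int L * n) t z \<le> s n"
    | "maximal_dater f m (int L * n) t z \<le> maximal_dater f m l t z - \<tau> n + s n"
    by (auto simp: maximal_dater_def \<tau>_def l_def max_def split: if_splits)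
  then show ?case
  proof cases
    case 1
    then show ?thesis by (intro exI[of _ 0]) (simp add: m_def)
  next
    case 2
    have "{n - int (Suc j)..n - 1} = insert (n - 1) {n - 1 - int j..n - 1 - 1}" by auto
    then have "(\<Sum>i\<in>{n - int (Suc j)..n - 1}. s i - \<tau> (i + 1)) =
        s (n - 1) - \<tau> n + (\<Sum>i\<in>{n - 1 - int j..n - 1 - 1}. s i - \<tau> (i + 1))"
      by simp
    then show ?thesis
      using 2 j unfolding m m_def[symmetric] by (intro exI[of _ "Suc j"]) auto
  qed
qed

end

lemma (in stochastic_network) range_\<zeta>: "\<omega> \<in> space M \<Longrightarrow> range (\<lambda>k. \<zeta> k \<omega>) \<subseteq> space K"
  using \<zeta>_measurable by (auto simp: measurable_def)

lemma (in stochastic_network) stationary_dater_le_response_hat: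
  assumes \<omega>: "\<omega> \<in> space M" and L: "1 \<le> L"
  shows "stationary_dater f T \<zeta> \<omega> \<le> response_hat f T \<zeta> L \<omega>"
proof -
  note t = T_mono[OF \<omega>] and z = range_\<zeta>[OF \<omega>]
  define Z where "Z n = ereal (maximal_dater f (- int n) 0 (\<lambda>k. T k \<omega>) (\<lambda>k. \<zeta> k \<omega>))" for n
  have "incseq Z"
    unfolding Z_def incseq_def by (auto intro: maximal_dater_antimono[OF t z])
  then have lim: "lim Z = (SUP n. Z n)"
    by (intro limI LIMSEQ_SUP)
  have "Z n \<le> response_hat f T \<zeta> L \<omega>" for n
  proof -
    let ?d = "\<lambda>i. service_hat f \<zeta> L i \<omega> - interarrival_hat T L (i + 1) \<omega>"
    obtain j where j: "maximal_dater f (int L * (0 - 1 - int n) + 1) (int L * 0) (\<lambda>k. T k \<omega>) (\<lambda>k. \<zeta> k \<omega>)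
        \<le> service_hat f \<zeta> L 0 \<omega> + (\<Sum>i\<in>{0 - int j..0 - 1}. ?d i)"
      using maximal_dater_le_queue[OF t z L, of n 0] by (auto simp: service_hat_def interarrival_hat_def)
    \<comment> \<open>The window is enlarged to \<open>n + 1\<close> whole blocks ending at 0, so
      that the bound for the block queue applies.\<close>
    have "1 * int n \<le> int L * int n" using L by (intro mult_right_mono) auto
    then have "int L * (0 - 1 - int n) + 1 \<le> - int n" using L by (simp add: algebra_simps)
    from maximal_dater_antimono[OF t z this, of 0]
    have "Z n \<le> ereal (maximal_dater f (int L * (0 - 1 - int n) + 1) (int L * 0) (\<lambda>k. T k \<omega>) (\<lambda>k. \<zeta> k \<omega>))"
      by (simp add: Z_def)
    also have "\<dots> \<le> ereal (service_hat f \<zeta> L 0 \<omega>) + ereal (\<Sum>i\<in>{- int j..- 1}. ?d i)"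
      using j by simp
    also have "\<dots> \<le> response_hat f T \<zeta> L \<omega>"
      unfolding response_hat_def by (intro add_left_mono SUP_upper) simp
    finally show ?thesis .
  qed
  then show ?thesis
    unfolding stationary_dater_def Z_def[symmetric] lim by (intro SUP_least)
qed

text \<open>Convergence is all that \<open>gamma0\<close>, a \<open>lim\<close>, requires.
  Nonnegativity gives the averages a finite infimum, which is their limit.\<close>

lemma fekete:
  fixes u :: "nat \<Rightarrow> real"
  assumes sub: "\<And>m n. u (m + n) \<le> u m + u n" and nonneg: "\<And>n. 0 \<le> u n"
  shows "convergent (\<lambda>n. u n / real n)"
proof -
  define l where "l = (INF n\<in>{1..}. u n / real n)"
  have bdd: "bdd_below ((\<lambda>n. u n / real n) ` {1..})"
    by (intro bdd_belowI[of _ 0]) (auto intro: divide_nonneg_nonneg nonneg)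
  have lower: "l \<le> u n / real n" if "1 \<le> n" for n
    unfolding l_def using bdd that by (intro cINF_lower) auto
  have mult: "u (q * m + s) \<le> real q * u m + u s" for q m s
  proof (induction q)
    case (Suc q)
    have "u (Suc q * m + s) \<le> u m + u (q * m + s)"
      using sub[of m "q * m + s"] by (simp add: algebra_simps)
    then show ?case using Suc by (simp add: algebra_simps)
  qed simp
  have "(\<lambda>n. u n / real n) \<longlonglongrightarrow> l"
  proof (rule order_tendstoI)
    fix y assume "y < l"
    show "\<forall>\<^sub>F n in sequentially. y < u n / real n"
      using eventually_ge_at_top[of 1] by eventually_elim (use lower \<open>y < l\<close> in force)
  next
    fix y assume "l < y"
    then obtain m where m: "1 \<le> m" "u m / real m < y"
      unfolding l_def by (subst (asm) cINF_less_iff[OF _ bdd]) auto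
    \<comment> \<open>A common bound for the values at all remainders modulo \<open>m\<close>; it
      disappears after division by \<open>n\<close>.\<close>
    define B where "B = (\<Sum>s<m. u s)"
    have B: "u s \<le> B" if "s < m" for s
      unfolding B_def using that nonneg by (intro member_le_sum) auto
    have "((\<lambda>n. u m / real m + B / real n) \<longlongrightarrow> u m / real m + 0) sequentially"
      by (intro tendsto_intros lim_const_over_n)
    then have "\<forall>\<^sub>F n in sequentially. u m / real m + B / real n < y"
      by (rule order_tendstoD) (use m in simp)
    then show "\<forall>\<^sub>F n in sequentially. u n / real n < y"
      using eventually_ge_at_top[of 1]
    proof eventually_elim
      case (elim n)
      have "u n = u (n div m * m + n mod m)" by simp
      also have "\<dots> \<le> real (n div m) * u m + u (n mod m)" by (rule mult)
      also have "\<dots> \<le> real (n div m) * u m + B" using m by (intro add_left_mono B) simp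
      also have "real (n div m) * u m \<le> real n / real m * u m"
      proof (rule mult_right_mono[OF _ nonneg])
        have "real (n div m) * real m \<le> real n"
          unfolding of_nat_mult[symmetric] of_nat_le_iff by (rule div_times_less_eq_dividend)
        then show "real (n div m) \<le> real n / real m" using m by (simp add: pos_le_divide_eq)
      qed
      finally have "u n / real n \<le> (real n / real m * u m + B) / real n"
        by (intro divide_right_mono) auto
      also have "\<dots> = u m / real m + B / real n" using elim by (simp add: field_simps)
      finally show ?case using elim by simp
    qed
  qed
  then show ?thesis by (rule convergentI)
qed

section \<open>Pathwise maxima and their laws\<close>

primrec partial_max :: "(nat \<Rightarrow> real) \<Rightarrow> nat \<Rightarrow> nat \<Rightarrow> real" where
  "partial_max x s 0 = 0"
| "partial_max x s (Suc N) = max 0 (x s + partial_max x (Suc s) N)"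

text \<open>The recursion copies \<open>walk_max\<close>, which makes laws computable by induction;
  this equivalence identifies the result with the maximum of the partial sums, the empty one
  included.\<close>

lemma less_partial_max_iff: "y < partial_max x s N \<longleftrightarrow> (\<exists>k\<le>N. y < (\<Sum>i<k. x (s + i)))"
proof (induction N arbitrary: s y)
  case (Suc N)
  have "y < partial_max x s (Suc N) \<longleftrightarrow> y < 0 \<or> (\<exists>k\<le>N. y - x s < (\<Sum>i<k. x (Suc s + i)))"
    using Suc[of "y - x s" "Suc s"] by (auto simp: less_max_iff_disj algebra_simps)
  also have "\<dots> \<longleftrightarrow> y < 0 \<or> (\<exists>k\<le>N. y < (\<Sum>i<Suc k. x (s + i)))"
    by (simp add: sum.lessThan_Suc_shift algebra_simps del: sum.lessThan_Suc)
  also have "\<dots> \<longleftrightarrow> (\<exists>k\<le>Suc N. y < (\<Sum>i<k. x (s + i)))"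
  proof
    assume "\<exists>k\<le>Suc N. y < (\<Sum>i<k. x (s + i))"
    then obtain k where "k \<le> Suc N" "y < (\<Sum>i<k. x (s + i))" by blast
    then show "y < 0 \<or> (\<exists>k\<le>N. y < (\<Sum>i<Suc k. x (s + i)))"
      by (cases k) auto
  qed (force intro: exI[of _ 0])
  finally show ?case .
qed simp

lemma measurable_partial_max:
  "{s..} \<subseteq> I \<Longrightarrow> (\<lambda>x. partial_max x s N) \<in> borel_measurable (\<Pi>\<^sub>M i\<in>I. borel)"
proof (induction N arbitrary: s)
  case (Suc N)
  then have "{Suc s..} \<subseteq> I" "s \<in> I" by auto
  with Suc.IH[of "Suc s"] show ?case by simp
qed simp

lemma partial_max_cong: "(\<And>i. s \<le> i \<Longrightarrow> x i = x' i) \<Longrightarrow> partial_max x s N = partial_max x' s N"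
proof (induction N arbitrary: s)
  case (Suc N)
  then show ?case using Suc.IH[of "Suc s"] by simp
qed simp

lemma (in prob_space) indep_var_partial_max:
  assumes X: "indep_vars (\<lambda>_. borel) X (UNIV :: nat set)"
  shows "indep_var borel (X s) borel (\<lambda>\<omega>. partial_max (\<lambda>i. X i \<omega>) (Suc s) N)"
proof -
  have "indep_var (\<Pi>\<^sub>M i\<in>{s}. borel) (\<lambda>\<omega>. restrict (\<lambda>i. X i \<omega>) {s})
      (\<Pi>\<^sub>M i\<in>{Suc s..}. borel) (\<lambda>\<omega>. restrict (\<lambda>i. X i \<omega>) {Suc s..})"
    by (rule indep_var_restrict[OF X]) auto
  then have "indep_var borel ((\<lambda>x. x s) \<circ> (\<lambda>\<omega>. restrict (\<lambda>i. X i \<omega>) {s}))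
      borel ((\<lambda>x. partial_max x (Suc s) N) \<circ> (\<lambda>\<omega>. restrict (\<lambda>i. X i \<omega>) {Suc s..}))"
    by (rule indep_var_compose) (auto intro: measurable_partial_max)
  moreover have "partial_max (restrict (\<lambda>i. X i \<omega>) {Suc s..}) (Suc s) N = partial_max (\<lambda>i. X i \<omega>) (Suc s) N" for \<omega>
    by (rule partial_max_cong) auto
  ultimately show ?thesis by (simp add: comp_def)
qed

lemma (in prob_space) random_variable_partial_max:
  assumes X: "\<And>i. random_variable borel (X i)"
  shows "random_variable borel (\<lambda>\<omega>. partial_max (\<lambda>i. X i \<omega>) s N)"
  by (induction N arbitrary: s) (use X in auto)

text \<open>The first term is independent of the maximum over the later indices, hence the induction
  over all starting points. Index 0 is left out because it will carry a service time, whose law is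
  different.\<close>

lemma (in prob_space) distr_partial_max:
  assumes X: "indep_vars (\<lambda>_. borel) X (UNIV :: nat set)"
    and H: "\<And>i. 1 \<le> i \<Longrightarrow> distr M borel (X i) = H" and s: "1 \<le> s"
  shows "distr M borel (\<lambda>\<omega>. partial_max (\<lambda>i. X i \<omega>) s N) = walk_max H N"
  using s
proof (induction N arbitrary: s)
  case 0
  have "distr M borel (\<lambda>\<omega>. 0::real) = return borel 0"
    by (rule measure_eqI) (auto simp: emeasure_distr emeasure_space_1 indicator_def)
  then show ?case by simp
next
  case (Suc N)
  have rv: "random_variable borel (X i)" for i
    using X by (auto simp: indep_vars_def)
  note rvp = random_variable_partial_max[OF rv]
  have "distr M borel (\<lambda>\<omega>. X s \<omega> + partial_max (\<lambda>i. X i \<omega>) (Suc s) N) = (H \<star> walk_max H N)"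
    using sum_indep_random_variable[OF indep_var_partial_max[OF X] rv rvp, of s N] H Suc by simp
  then have "walk_max H (Suc N) = distr (distr M borel (\<lambda>\<omega>. X s \<omega> + partial_max (\<lambda>i. X i \<omega>) (Suc s) N)) borel (max 0)"
    by simp
  also have "\<dots> = distr M borel (max 0 \<circ> (\<lambda>\<omega>. X s \<omega> + partial_max (\<lambda>i. X i \<omega>) (Suc s) N))"
    using rv rvp by (intro distr_distr) auto
  finally show ?case by (simp add: comp_def)
qed

section \<open>Stationarity and independence\<close>

lemma (in prob_space) indep_vars_prob_all:
  assumes X: "indep_vars N X I" and J: "finite J" "J \<subseteq> I" "\<And>i. i \<in> J \<Longrightarrow> B i \<in> sets (N i)"
  shows "\<P>(\<omega> in M. \<forall>i\<in>J. X i \<omega> \<in> B i) = (\<Prod>i\<in>J. \<P>(\<omega> in M. X i \<omega> \<in> B i))"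
proof (cases "J = {}")
  case False
  have "{\<omega> \<in> space M. \<forall>i\<in>J. X i \<omega> \<in> B i} = (\<Inter>i\<in>J. X i -` B i \<inter> space M)"
    using False by auto
  also have "prob \<dots> = (\<Prod>i\<in>J. prob (X i -` B i \<inter> space M))"
    using False J by (intro indep_varsD[OF X]) auto
  also have "\<dots> = (\<Prod>i\<in>J. \<P>(\<omega> in M. X i \<omega> \<in> B i))"
    by (intro prod.cong arg_cong[where f=prob]) auto
  finally show ?thesis .
qed (simp add: prob_space)

text \<open>A finite event splits into a part determined by \<open>U\<close> and a part determined
  by \<open>V\<close>. Independence of \<open>U\<close> and \<open>V\<close> separates the parts,
  and independence within each family factors them further; \<open>g\<close> and \<open>h\<close>
  express the families through \<open>U\<close> and \<open>V\<close>.\<close>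

lemma (in prob_space) indep_vars_case_sum:
  assumes X: "indep_vars (\<lambda>_. N) X UNIV" and Y: "indep_vars (\<lambda>_. N) Y UNIV"
    and UV: "independent_variables M S U S' V"
    and g: "\<And>i. g i \<in> measurable S N" "\<And>i \<omega>. \<omega> \<in> space M \<Longrightarrow> X i \<omega> = g i (U \<omega>)"
    and h: "\<And>j. h j \<in> measurable S' N" "\<And>j \<omega>. \<omega> \<in> space M \<Longrightarrow> Y j \<omega> = h j (V \<omega>)"
  shows "indep_vars (\<lambda>_. N) (case_sum X Y) UNIV"
  unfolding indep_vars_def2
proof (intro conjI ballI)
  have rv: "random_variable N (case_sum X Y i)" for i
    using X Y by (auto simp: indep_vars_def split: sum.split)
  then show "random_variable N (case_sum X Y i)" for i .
  show "indep_sets (\<lambda>i. {case_sum X Y i -` A \<inter> space M |A. A \<in> sets N}) UNIV"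
  proof (rule indep_setsI)
    show "{case_sum X Y i -` A \<inter> space M |A. A \<in> sets N} \<subseteq> events" for i
      using rv by (auto intro: measurable_sets)
  next
    fix A J assume J: "J \<noteq> {}" "finite J" "J \<subseteq> (UNIV :: ('b + 'd) set)"
      and A: "\<forall>j\<in>J. A j \<in> {case_sum X Y j -` A \<inter> space M |A. A \<in> sets N}"
    from A have "\<forall>j\<in>J. \<exists>B. B \<in> sets N \<and> A j = {\<omega> \<in> space M. case_sum X Y j \<omega> \<in> B}"
    proof (intro ballI)
      fix j assume "j \<in> J"
      with A obtain C where "C \<in> sets N" "A j = case_sum X Y j -` C \<inter> space M" by blast
      then show "\<exists>B. B \<in> sets N \<and> A j = {\<omega> \<in> space M. case_sum X Y j \<omega> \<in> B}"
        by (intro exI[of _ C]) auto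
    qed
    then obtain B where B: "\<And>j. j \<in> J \<Longrightarrow> B j \<in> sets N"
        "\<And>j. j \<in> J \<Longrightarrow> A j = {\<omega> \<in> space M. case_sum X Y j \<omega> \<in> B j}"
      by metis
    define JL where "JL = Inl -` J"
    define JR where "JR = Inr -` J"
    have fin: "finite JL" "finite JR"
      using J by (auto simp: JL_def JR_def intro: finite_vimageI)
    have J_eq: "J = Inl ` JL \<union> Inr ` JR" unfolding JL_def JR_def
    proof (intro equalityI subsetI)
      fix j assume "j \<in> J" then show "j \<in> Inl ` (Inl -` J) \<union> Inr ` (Inr -` J)" by (cases j) auto
    qed auto
    define EL where "EL = {\<omega> \<in> space M. \<forall>i\<in>JL. X i \<omega> \<in> B (Inl i)}"
    define ER where "ER = {\<omega> \<in> space M. \<forall>i\<in>JR. Y i \<omega> \<in> B (Inr i)}"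
    have int: "(\<Inter>j\<in>J. A j) = EL \<inter> ER"
    proof -
      have "(\<Inter>j\<in>J. A j) = {\<omega> \<in> space M. \<forall>j\<in>J. case_sum X Y j \<omega> \<in> B j}"
        using J(1) B(2) by auto
      also have "\<dots> = EL \<inter> ER"
        unfolding J_eq EL_def ER_def by (auto simp: ball_Un)
      finally show ?thesis .
    qed
    have "\<exists>P\<in>sets S. EL = U -` P \<inter> space M"
    proof
      show "{s \<in> space S. \<forall>i\<in>JL. g i s \<in> B (Inl i)} \<in> sets S"
      proof (rule sets.sets_Collect_finite_All[OF _ fin(1)])
        fix i assume "i \<in> JL"
        then show "{s \<in> space S. g i s \<in> B (Inl i)} \<in> sets S"
          using measurable_sets[OF g(1) B(1)[of "Inl i"]] by (auto simp: JL_def vimage_def Int_def conj_commute)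
      qed
      show "EL = U -` {s \<in> space S. \<forall>i\<in>JL. g i s \<in> B (Inl i)} \<inter> space M"
        using UV g(2) unfolding EL_def independent_variables_def measurable_def by auto
    qed
    moreover have "\<exists>P\<in>sets S'. ER = V -` P \<inter> space M"
    proof
      show "{s \<in> space S'. \<forall>i\<in>JR. h i s \<in> B (Inr i)} \<in> sets S'"
      proof (rule sets.sets_Collect_finite_All[OF _ fin(2)])
        fix i assume "i \<in> JR"
        then show "{s \<in> space S'. h i s \<in> B (Inr i)} \<in> sets S'"
          using measurable_sets[OF h(1) B(1)[of "Inr i"]] by (auto simp: JR_def vimage_def Int_def conj_commute)
      qed
      show "ER = V -` {s \<in> space S'. \<forall>i\<in>JR. h i s \<in> B (Inr i)} \<inter> space M"
        using UV h(2) unfolding ER_def independent_variables_def measurable_def by auto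
    qed
    ultimately have "prob (EL \<inter> ER) = prob EL * prob ER"
      using UV unfolding independent_variables_def by (auto intro!: indep_setD)
    also have "prob EL = (\<Prod>i\<in>JL. \<P>(\<omega> in M. X i \<omega> \<in> B (Inl i)))"
      unfolding EL_def by (rule indep_vars_prob_all[OF X]) (use fin B in \<open>auto simp: JL_def\<close>)
    also have "prob ER = (\<Prod>i\<in>JR. \<P>(\<omega> in M. Y i \<omega> \<in> B (Inr i)))"
      unfolding ER_def by (rule indep_vars_prob_all[OF Y]) (use fin B in \<open>auto simp: JR_def\<close>)
    also have "(\<Prod>i\<in>JL. \<P>(\<omega> in M. X i \<omega> \<in> B (Inl i))) * (\<Prod>i\<in>JR. \<P>(\<omega> in M. Y i \<omega> \<in> B (Inr i)))
        = (\<Prod>j\<in>J. \<P>(\<omega> in M. case_sum X Y j \<omega> \<in> B j))"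
      unfolding J_eq using fin
      by (subst prod.union_disjoint) (auto simp: prod.reindex)
    also have "\<dots> = (\<Prod>j\<in>J. prob (A j))"
      by (intro prod.cong) (auto simp: B(2))
    finally show "prob (\<Inter>j\<in>J. A j) = (\<Prod>j\<in>J. prob (A j))"
      by (simp add: int)
  qed
qed

text \<open>\<open>I\<close> is free because two cases are needed: all integers for stationarity, a
  single window for the independence of blocks.\<close>

lemma (in monotone_separable) measurable_dater_Q:
  assumes "m \<le> n" "{m..n} \<subseteq> I"
  shows "dater_Q f m n \<in> borel_measurable (\<Pi>\<^sub>M i\<in>I. K)"
proof -
  define l where "l = nat (n - m + 1)"
  have mem: "m + int i \<in> I" if "i < l" for i
    using assms that by (auto simp: l_def)
  have "(\<lambda>z. (\<lambda>i\<in>{..<l}. 0 :: real, \<lambda>i\<in>{..<l}. z (m + int i))) \<in>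
      measurable (\<Pi>\<^sub>M i\<in>I. K) ((\<Pi>\<^sub>M i\<in>{..<l}. borel) \<Otimes>\<^sub>M (\<Pi>\<^sub>M i\<in>{..<l}. K))"
    by (intro measurable_Pair measurable_restrict measurable_component_singleton mem) auto
  moreover have "1 \<le> l" using assms by (simp add: l_def)
  ultimately have "(\<lambda>z. f l (\<lambda>i\<in>{..<l}. 0 :: real, \<lambda>i\<in>{..<l}. z (m + int i))) \<in> borel_measurable (\<Pi>\<^sub>M i\<in>I. K)"
    by (rule measurable_compose[OF _ f_measurable])
  also have "(\<lambda>z. f l (\<lambda>i\<in>{..<l}. 0 :: real, \<lambda>i\<in>{..<l}. z (m + int i))) = dater_Q f m n"
    by (simp add: fun_eq_iff dater_Q_eq last_activity_def l_def Let_def)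
  finally show ?thesis .
qed

lemma sum_interarrival: "m \<le> n \<Longrightarrow> (\<Sum>k\<in>{m..<n}. interarrival T k \<omega>) = T n \<omega> - T m \<omega>"
proof (induction n rule: int_ge_induct)
  case (step n)
  have "{m..<n + 1} = insert n {m..<n}" using step by auto
  then show ?case using step by (simp add: interarrival_def)
qed simp

lemma interarrival_hat_eq:
  "interarrival_hat T L n \<omega> = (\<Sum>k\<in>{int L * (n - 1)..<int L * n}. interarrival T k \<omega>)"
  by (subst sum_interarrival) (simp_all add: interarrival_hat_def mult_left_mono)

section \<open>Laws, means and independence of the blocks\<close>

context stochastic_network
begin

abbreviation path_space :: "(int \<Rightarrow> real \<times> 'k) measure" where
  "path_space \<equiv> \<Pi>\<^sub>M n\<in>UNIV. borel \<Otimes>\<^sub>M K"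

abbreviation mark_dater :: "int \<Rightarrow> int \<Rightarrow> 'w \<Rightarrow> real" where
  "mark_dater m n \<omega> \<equiv> dater_Q f m n (\<lambda>k. \<zeta> k \<omega>)"

definition queue_increment :: "nat \<Rightarrow> int \<Rightarrow> 'w \<Rightarrow> real" where
  "queue_increment L i \<omega> = service_hat f \<zeta> L i \<omega> - interarrival_hat T L (i + 1) \<omega>"

lemma interarrival_measurable [measurable]: "interarrival T n \<in> borel_measurable M"
  using T_measurable unfolding interarrival_def[abs_def] by measurable

text \<open>Stationarity is assumed for the shift by one. Pushing this equality forward along the
  inverse shift gives the shift by minus one, and an induction in both directions reaches every
  integer.\<close>

lemma distr_shift:
  assumes G: "G \<in> borel_measurable path_space"
  shows "distr M borel (\<lambda>\<omega>. G (\<lambda>n. (interarrival T (n + s) \<omega>, \<zeta> (n + s) \<omega>))) =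
    distr M borel (\<lambda>\<omega>. G (\<lambda>n. (interarrival T n \<omega>, \<zeta> n \<omega>)) :: real)"
proof -
  define S where "S = path_space"
  define \<xi> where "\<xi> s \<omega> = (\<lambda>n. (interarrival T (n + s) \<omega>, \<zeta> (n + s) \<omega>))" for s \<omega>
  define \<theta> where "\<theta> = (\<lambda>(j::int) (x :: int \<Rightarrow> real \<times> 'k) n. x (n + j))"
  have \<theta>: "\<theta> j \<in> measurable S S" for j
    unfolding \<theta>_def S_def
    by (rule measurable_PiM_single') (auto simp: space_PiM PiE_UNIV_domain Pi_iff space_pair_measure)
  have \<xi>: "\<xi> s \<in> measurable M S" for s
    unfolding \<xi>_def S_def
    using \<zeta>_measurable
    by (intro measurable_PiM_single')
      (auto simp: space_PiM PiE_UNIV_domain Pi_iff space_pair_measure intro: measurable_space)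
  have \<theta>\<xi>: "\<theta> j \<circ> \<xi> s = \<xi> (s + j)" for s j
    by (auto simp: \<theta>_def \<xi>_def fun_eq_iff algebra_simps)
  have d: "distr M S (\<xi> (s + j)) = distr (distr M S (\<xi> s)) S (\<theta> j)" for s j
    using \<theta>\<xi>[of j s] by (simp add: distr_distr[OF \<theta> \<xi>])
  have one: "distr M S (\<xi> 1) = distr M S (\<xi> 0)"
    using stationary by (simp add: stationary_process_def S_def \<xi>_def[abs_def])
  have minus_one: "distr M S (\<xi> (- 1)) = distr M S (\<xi> 0)"
    using d[of 0 "- 1"] d[of 1 "- 1"] one by simp
  have "distr M S (\<xi> s) = distr M S (\<xi> 0)" for s
  proof (induction s rule: int_induct[where k=0])
    case (step1 i)
    show ?case using d[of i 1] d[of 0 1] one step1 by simp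
  next
    case (step2 i)
    show ?case using d[of i "- 1"] d[of 0 "- 1"] minus_one step2 by simp
  qed simp
  from this[of s] have "distr (distr M S (\<xi> s)) borel G = distr (distr M S (\<xi> 0)) borel G" by simp
  moreover have "distr (distr M S (\<xi> j)) borel G = distr M borel (G \<circ> \<xi> j)" for j
    using G by (intro distr_distr \<xi>) (simp add: S_def)
  ultimately have "distr M borel (G \<circ> \<xi> s) = distr M borel (G \<circ> \<xi> 0)" by simp
  then show ?thesis
    by (simp add: comp_def \<xi>_def[abs_def])
qed

lemma measurable_marks: "(\<lambda>\<omega> k. \<zeta> k \<omega>) \<in> measurable M (\<Pi>\<^sub>M k\<in>(UNIV::int set). K)"
  using \<zeta>_measurable by (intro measurable_PiM_single') (auto intro: measurable_space)

lemma random_variable_dater_Q: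
  "m \<le> n \<Longrightarrow> random_variable borel (mark_dater m n)"
  by (rule measurable_compose[OF measurable_marks measurable_dater_Q]) auto

lemma measurable_snd_path:
  "(\<lambda>x k. snd (x k)) \<in> measurable path_space (\<Pi>\<^sub>M k\<in>(UNIV::int set). K)"
  by (rule measurable_PiM_single') (auto simp: space_PiM PiE_UNIV_domain Pi_iff space_pair_measure mem_Times_iff)

lemma distr_dater_Q_shift:
  assumes "m \<le> n"
  shows "distr M borel (mark_dater (m + s) (n + s)) =
    distr M borel (mark_dater m n)"
proof -
  have "(\<lambda>x. dater_Q f m n (\<lambda>k. snd (x k))) \<in>
      borel_measurable path_space"
    by (rule measurable_compose[OF measurable_snd_path measurable_dater_Q]) (use assms in auto)
  from distr_shift[OF this, of s] show ?thesis
    by (simp add: dater_Q_shift[of f m n "\<lambda>k. \<zeta> k \<omega>" s for \<omega>])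
qed

lemma expectation_dater_Q_shift:
  assumes "m \<le> n"
  shows "expectation (mark_dater (m + s) (n + s)) =
    expectation (mark_dater m n)"
proof -
  have "(\<integral>x. x \<partial>distr M borel (mark_dater (m + s) (n + s))) =
      (\<integral>x. x \<partial>distr M borel (mark_dater m n))"
    using distr_dater_Q_shift[OF assms] by simp
  then show ?thesis
    using assms by (simp add: integral_distr random_variable_dater_Q)
qed

lemma integrable_dater_Q:
  assumes "m \<le> n" shows "integrable M (mark_dater m n)"
proof (rule Bochner_Integration.integrable_bound)
  have "integrable M (mark_dater i i)" for i
    using dater_integrable[of i]
    by (rule Bochner_Integration.integrable_cong[THEN iffD1, OF refl, rotated])
      (simp add: maximal_dater_single range_\<zeta>)
  then show "integrable M (\<lambda>\<omega>. \<Sum>i\<in>{m..n}. mark_dater i i \<omega>)"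
    by (rule Bochner_Integration.integrable_sum)
  show "AE \<omega> in M. norm (mark_dater m n \<omega>) \<le> norm (\<Sum>i\<in>{m..n}. mark_dater i i \<omega>)"
  proof (rule AE_I2)
    fix \<omega> assume "\<omega> \<in> space M"
    note z = range_\<zeta>[OF this]
    from dater_Q_le_sum[OF z assms] dater_Q_nonneg[OF z assms]
    show "norm (mark_dater m n \<omega>) \<le> norm (\<Sum>i\<in>{m..n}. mark_dater i i \<omega>)"
      by simp
  qed
qed (rule random_variable_dater_Q[OF assms])

lemma service_hat_interval: "1 \<le> L \<Longrightarrow> int L * (i - 1) + 1 \<le> int L * i"
  by (simp add: algebra_simps)

lemma random_variable_service_hat: "1 \<le> L \<Longrightarrow> random_variable borel (service_hat f \<zeta> L i)"
  unfolding service_hat_def by (intro random_variable_dater_Q service_hat_interval)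

lemma random_variable_interarrival_hat: "random_variable borel (interarrival_hat T L i)"
  using T_measurable unfolding interarrival_hat_def by measurable

lemma random_variable_queue_increment: "1 \<le> L \<Longrightarrow> random_variable borel (queue_increment L i)"
  unfolding queue_increment_def
  using random_variable_interarrival_hat random_variable_service_hat by (intro borel_measurable_diff)

lemma distr_queue_increment:
  assumes "1 \<le> L"
  shows "distr M borel (queue_increment L i) = distr M borel (queue_increment L 0)"
proof -
  \<comment> \<open>Service block 0 reads the marks \<open>1 - L\<close> to 0, whereas the gap that
    follows it sums the interarrival times 0 to \<open>L - 1\<close>. Increment \<open>i\<close> is
    this functional of the path shifted by \<open>L * i\<close>.\<close>
  define G where "G x = dater_Q f (1 - int L) 0 (\<lambda>k. snd (x k)) - (\<Sum>k\<in>{0..<int L}. fst (x k))" for x :: "int \<Rightarrow> real \<times> 'k"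
  have "(\<lambda>x. dater_Q f (1 - int L) 0 (\<lambda>k. snd (x k))) \<in>
      borel_measurable path_space"
    by (rule measurable_compose[OF measurable_snd_path measurable_dater_Q]) (use assms in auto)
  then have "G \<in> borel_measurable path_space"
    unfolding G_def by measurable
  note G = distr_shift[OF this]
  have eq: "queue_increment L i \<omega> = G (\<lambda>n. (interarrival T (n + int L * i) \<omega>, \<zeta> (n + int L * i) \<omega>))" for i \<omega>
  proof -
    have "(\<Sum>k\<in>{0..<int L}. interarrival T (k + int L * i) \<omega>) = interarrival_hat T L (i + 1) \<omega>"
      unfolding interarrival_hat_eq
      by (rule sum.reindex_bij_witness[of _ "\<lambda>k. k - int L * i" "\<lambda>k. k + int L * i"])
        (auto simp: algebra_simps)
    moreover have "dater_Q f (1 - int L) 0 (\<lambda>k. \<zeta> (k + int L * i) \<omega>) = service_hat f \<zeta> L i \<omega>"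
      using dater_Q_shift[of f "1 - int L" 0 "\<lambda>k. \<zeta> k \<omega>" "int L * i"]
      by (simp add: service_hat_def algebra_simps)
    ultimately show ?thesis by (simp add: G_def queue_increment_def)
  qed
  show ?thesis
    using G[of "int L * i"] G[of "int L * 0"] unfolding eq[symmetric] by simp
qed

lemma expectation_queue_increment:
  assumes "1 \<le> L"
  shows "integrable M (queue_increment L i)"
    and "expectation (queue_increment L i) =
      expectation (mark_dater (- int L) (- 1)) - real L * a"
proof -
  have s: "integrable M (service_hat f \<zeta> L i)"
    unfolding service_hat_def using assms by (intro integrable_dater_Q service_hat_interval)
  have t: "integrable M (interarrival_hat T L (i + 1))"
    unfolding interarrival_hat_eq[abs_def] using interarrival_integrable by auto
  show "integrable M (queue_increment L i)"
    unfolding queue_increment_def[abs_def] using s t by auto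
  have "expectation (interarrival_hat T L (i + 1)) = real L * a"
    unfolding interarrival_hat_eq[abs_def] using interarrival_integrable interarrival_mean
    by (simp add: algebra_simps)
  moreover have "expectation (service_hat f \<zeta> L i) = expectation (mark_dater (- int L) (- 1))"
    using expectation_dater_Q_shift[of "- int L" "- 1" "int L * i + 1"] assms
    by (simp add: service_hat_def[abs_def] algebra_simps)
  ultimately show "expectation (queue_increment L i) =
      expectation (mark_dater (- int L) (- 1)) - real L * a"
    unfolding queue_increment_def[abs_def] using s t by simp
qed

lemma convergent_mean_dater_Q:
  "convergent (\<lambda>n. expectation (mark_dater (- int n) (- 1)) / real n)"
proof -
  \<comment> \<open>For \<open>n = 0\<close> the window is empty and nothing is known about
    \<open>f 0\<close>. The value 0 keeps subadditivity, and the quotient is unchanged because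
    division by 0 gives 0.\<close>
  define u where "u n = (if n = 0 then 0 else expectation (mark_dater (- int n) (- 1)))" for n
  have nonneg: "0 \<le> u n" for n
    unfolding u_def by (auto intro!: integral_nonneg_AE AE_I2 dater_Q_nonneg range_\<zeta>)
  have "u (m + n) \<le> u m + u n" for m n
  proof (cases "m = 0 \<or> n = 0")
    case True
    then show ?thesis by (auto simp: u_def)
  next
    case False
    have "expectation (mark_dater (- int (m + n)) (- 1)) \<le>
      expectation (\<lambda>\<omega>. mark_dater (- int (m + n)) (- int n - 1) \<omega> + mark_dater (- int n) (- 1) \<omega>)"
    proof (rule integral_mono)
      fix \<omega> assume "\<omega> \<in> space M"
      from dater_Q_subadditive[OF range_\<zeta>[OF this], of "- int (m + n)" "- int n - 1" "- 1"] False
      show "mark_dater (- int (m + n)) (- 1) \<omega> \<le>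
        mark_dater (- int (m + n)) (- int n - 1) \<omega> + mark_dater (- int n) (- 1) \<omega>"
        by simp
    qed (use False in \<open>auto intro!: Bochner_Integration.integrable_add integrable_dater_Q\<close>)
    also have "\<dots> = expectation (mark_dater (- int (m + n)) (- int n - 1)) +
        expectation (mark_dater (- int n) (- 1))"
      using False by (intro Bochner_Integration.integral_add integrable_dater_Q) auto
    also have "expectation (mark_dater (- int (m + n)) (- int n - 1)) =
        expectation (mark_dater (- int m) (- 1))"
    proof -
      have e: "- int (m + n) = - int m + (- int n)" "- int n - 1 = - 1 + (- int n)" by auto
      show ?thesis unfolding e by (rule expectation_dater_Q_shift) (use False in auto)
    qed
    finally show ?thesis using False by (simp add: u_def)
  qed
  from fekete[OF this nonneg] have "convergent (\<lambda>n. u n / real n)" .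
  also have "(\<lambda>n. u n / real n) = (\<lambda>n. expectation (mark_dater (- int n) (- 1)) / real n)"
    by (auto simp: u_def)
  finally show ?thesis .
qed

lemma mean_dater_Q_tendsto_gamma0:
  "(\<lambda>n. expectation (mark_dater (- int n) (- 1)) / real n) \<longlonglongrightarrow> gamma0 M f \<zeta>"
  unfolding gamma0_def using convergent_mean_dater_Q by (rule convergent_LIMSEQ_iff[THEN iffD1])

lemma indep_vars_dater_Q_blocks:
  assumes \<zeta>: "indep_vars (\<lambda>_. K) \<zeta> UNIV" and le: "\<And>i. i \<in> I \<Longrightarrow> m i \<le> n i"
    and disj: "disjoint_family_on (\<lambda>i. {m i..n i}) I"
  shows "indep_vars (\<lambda>_. borel) (\<lambda>i \<omega>. mark_dater (m i) (n i) \<omega>) I"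
proof -
  have "indep_vars (\<lambda>i. \<Pi>\<^sub>M k\<in>{m i..n i}. K) (\<lambda>i \<omega>. restrict (\<lambda>k. \<zeta> k \<omega>) {m i..n i}) I"
    by (rule indep_vars_restrict[OF \<zeta> _ disj]) auto
  then have "indep_vars (\<lambda>_. borel) (\<lambda>i \<omega>. dater_Q f (m i) (n i) (restrict (\<lambda>k. \<zeta> k \<omega>) {m i..n i})) I"
    by (rule indep_vars_compose2) (use le in \<open>auto intro: measurable_dater_Q\<close>)
  moreover have "dater_Q f (m i) (n i) (restrict (\<lambda>k. \<zeta> k \<omega>) {m i..n i}) = mark_dater (m i) (n i) \<omega>" for i \<omega>
    by (rule dater_Q_cong) auto
  ultimately show ?thesis by simp
qed

lemma disjoint_service_blocks: "disjoint_family (\<lambda>i. {int L * (i - 1) + 1..int L * i})"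
proof -
  have *: "{int L * (i - 1) + 1..int L * i} \<inter> {int L * (j - 1) + 1..int L * j} = {}" if "i < j" for i j
  proof -
    have "int L * i \<le> int L * (j - 1)" using that by (intro mult_left_mono) auto
    then show ?thesis by auto
  qed
  show ?thesis
    unfolding disjoint_family_on_def
  proof (intro ballI impI)
    fix i j :: int assume "i \<noteq> j"
    then show "{int L * (i - 1) + 1..int L * i} \<inter> {int L * (j - 1) + 1..int L * j} = {}"
      using *[of i j] *[of j i] by (cases i j rule: linorder_cases) auto
  qed
qed

text \<open>The walk in \<open>response_hat\<close> runs backwards in time. Putting the service time
  of customer 0 in front of it makes one independence statement cover the walk and its independence
  of that service time.\<close>

definition reversed_queue :: "nat \<Rightarrow> nat \<Rightarrow> 'w \<Rightarrow> real" where
  "reversed_queue L n = (case n of 0 \<Rightarrow> service_hat f \<zeta> L 0 | Suc k \<Rightarrow> queue_increment L (- int k - 1))"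

lemma indep_vars_service_interarrival:
  assumes IA: "assumption_IA M K T \<zeta>" and L: "1 \<le> L"
  shows "indep_vars (\<lambda>_. borel) (case_sum (service_hat f \<zeta> L) (interarrival T)) UNIV"
proof (rule indep_vars_case_sum)
  show "indep_vars (\<lambda>_. borel) (service_hat f \<zeta> L) UNIV"
    unfolding service_hat_def[abs_def]
    by (rule indep_vars_dater_Q_blocks)
      (use IA L disjoint_service_blocks in \<open>auto simp: assumption_IA_def iid_sequence_def intro: service_hat_interval\<close>)
  show "indep_vars (\<lambda>_. borel) (interarrival T) UNIV"
    using IA by (auto simp: assumption_IA_def iid_sequence_def)
  show "independent_variables M (\<Pi>\<^sub>M n\<in>(UNIV :: int set). K) (\<lambda>\<omega> n. \<zeta> n \<omega>)
       (\<Pi>\<^sub>M n\<in>(UNIV :: int set). borel) (\<lambda>\<omega> n. interarrival T n \<omega>)"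
    using IA by (auto simp: assumption_IA_def)
  show "dater_Q f (int L * (i - 1) + 1) (int L * i) \<in> borel_measurable (\<Pi>\<^sub>M n\<in>(UNIV :: int set). K)" for i
    using L by (intro measurable_dater_Q service_hat_interval) auto
  show "(\<lambda>x. x j) \<in> borel_measurable (\<Pi>\<^sub>M n\<in>(UNIV :: int set). (borel :: real measure))" for j
    by measurable
qed (auto simp: service_hat_def)

lemma indep_vars_reversed_queue:
  assumes IA: "assumption_IA M K T \<zeta>" and L: "1 \<le> L"
  shows "indep_vars (\<lambda>_. borel) (reversed_queue L) UNIV"
proof -
  let ?V = "case_sum (service_hat f \<zeta> L) (interarrival T)"
  \<comment> \<open>The coordinates that entry \<open>n\<close> reads: one service block and, for
    \<open>n = Suc k\<close>, the \<open>L\<close> interarrival times that form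
    \<open>interarrival_hat T L (- int k)\<close>. Successive ranges adjoin without overlap.\<close>
  define B where "B n = (case n of 0 \<Rightarrow> {Inl 0}
    | Suc k \<Rightarrow> {Inl (- int k - 1)} \<union> Inr ` {int L * (- int k - 1)..<int L * (- int k)})" for n :: nat
  define G where "G n v = (case n of 0 \<Rightarrow> v (Inl 0)
    | Suc k \<Rightarrow> v (Inl (- int k - 1)) - (\<Sum>j\<in>{int L * (- int k - 1)..<int L * (- int k)}. v (Inr j)))"
    for n :: nat and v :: "int + int \<Rightarrow> real"
  have disj: "B m \<inter> B n = {}" if mn: "m < n" for m n
  proof -
    obtain k where n: "n = Suc k" using mn by (cases n) auto
    have "int L * (- int k) \<le> int L * (- int l - 1)" if "l < k" for l
      using that by (intro mult_left_mono) auto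
    then show ?thesis using mn by (cases m) (auto simp: B_def n, fastforce)
  qed
  have "disjoint_family B"
    unfolding disjoint_family_on_def
  proof (intro ballI impI)
    fix m n :: nat assume "m \<noteq> n"
    then show "B m \<inter> B n = {}"
      using disj[of m n] disj[of n m] by (cases m n rule: linorder_cases) auto
  qed
  then have "indep_vars (\<lambda>n. \<Pi>\<^sub>M i\<in>B n. borel) (\<lambda>n \<omega>. restrict (\<lambda>i. ?V i \<omega>) (B n)) UNIV"
    by (intro indep_vars_restrict[OF indep_vars_service_interarrival[OF IA L]]) auto
  then have "indep_vars (\<lambda>_. borel) (\<lambda>n \<omega>. G n (restrict (\<lambda>i. ?V i \<omega>) (B n))) UNIV"
  proof (rule indep_vars_compose2)
    fix n
    show "G n \<in> borel_measurable (\<Pi>\<^sub>M i\<in>B n. borel)"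
    proof (cases n)
      case (Suc k)
      have "(\<lambda>v. v (Inl (- int k - 1)) - (\<Sum>j\<in>{int L * (- int k - 1)..<int L * (- int k)}. v (Inr j)))
          \<in> borel_measurable (\<Pi>\<^sub>M i\<in>B n. (borel :: real measure))"
        by (intro borel_measurable_diff borel_measurable_sum measurable_component_singleton)
          (auto simp: B_def Suc)
      then show ?thesis by (simp add: G_def[abs_def] Suc)
    qed (simp add: G_def[abs_def] B_def)
  qed
  moreover have "G n (restrict (\<lambda>i. ?V i \<omega>) (B n)) = reversed_queue L n \<omega>" for n \<omega>
    by (cases n) (auto simp: G_def B_def reversed_queue_def queue_increment_def interarrival_hat_eq)
  ultimately show ?thesis by simp
qed

lemma sum_queue_increment:
  "(\<Sum>i\<in>{- int k..- 1}. queue_increment L i \<omega>) = (\<Sum>i<k. reversed_queue L (Suc i) \<omega>)"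
  by (rule sum.reindex_bij_witness[of _ "\<lambda>i. - int i - 1" "\<lambda>i. nat (- i - 1)"])
    (auto simp: reversed_queue_def)

text \<open>A strict inequality holds for a supremum as soon as one member satisfies it. The event
  is thus a countable union over horizons, which gives its measurability and the passage to the
  infinite horizon.\<close>

lemma less_response_hat_iff:
  "ereal x < response_hat f T \<zeta> L \<omega> \<longleftrightarrow>
    (\<exists>N. x < service_hat f \<zeta> L 0 \<omega> + partial_max (\<lambda>i. reversed_queue L i \<omega>) 1 N)"
proof -
  have "ereal x < response_hat f T \<zeta> L \<omega> \<longleftrightarrow>
    ereal (x - service_hat f \<zeta> L 0 \<omega>) < (SUP k. ereal (\<Sum>i<k. reversed_queue L (Suc i) \<omega>))"
    unfolding response_hat_def queue_increment_def[symmetric] sum_queue_increment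
    by (cases "SUP k. ereal (\<Sum>i<k. reversed_queue L (Suc i) \<omega>)") auto
  also have "\<dots> \<longleftrightarrow> (\<exists>k. x - service_hat f \<zeta> L 0 \<omega> < (\<Sum>i<k. reversed_queue L (1 + i) \<omega>))"
    by (simp add: less_SUP_iff)
  also have "\<dots> \<longleftrightarrow> (\<exists>N. x - service_hat f \<zeta> L 0 \<omega> < partial_max (\<lambda>i. reversed_queue L i \<omega>) 1 N)"
    unfolding less_partial_max_iff by blast
  finally show ?thesis by (simp add: algebra_simps)
qed

end

section \<open>Tails in the upper-bound queue\<close>

lemma subexponential_imp_subexp_distribution:
  assumes "subexponential G"
  shows "subexp_distribution (interval_measure G)" and "tail (interval_measure G) x = 1 - G x"
proof -
  have df: "distribution_function_nonneg G" using assms by (simp add: subexponential_def)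
  then have mono: "mono G" and cont: "\<And>x. continuous (at_right x) G" and top: "(G \<longlongrightarrow> 1) at_top"
    and neg: "\<And>x. x < 0 \<Longrightarrow> G x = 0"
    by (auto simp: distribution_function_nonneg_def)
  have "\<forall>\<^sub>F x in at_bot. 0 = G x"
    using eventually_gt_at_bot[of "0::real"] unfolding eventually_at_bot_dense
    by (intro exI[of _ 0]) (auto simp: neg)
  then have bot: "(G \<longlongrightarrow> 0) at_bot"
    by (rule Lim_transform_eventually[OF tendsto_const])
  have rd: "real_distribution (interval_measure G)"
    by (rule real_distribution_interval_measure) (use mono cont bot top in \<open>auto dest: monoD\<close>)
  have cdf: "cdf (interval_measure G) = G"
    by (rule cdf_interval_measure) (use mono cont bot top in \<open>auto dest: monoD\<close>)
  interpret real_distribution "interval_measure G" by fact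
  have tail: "tail (interval_measure G) x = 1 - G x" for x
    using prob_compl[of "{..x}"] fun_cong[OF cdf, of x]
    by (auto simp: tail_def cdf_def Compl_eq_Diff_UNIV[symmetric])
  then show "tail (interval_measure G) x = 1 - G x" .
  \<comment> \<open>The mass of the open negative half-line is the left limit of the distribution
    function at 0.\<close>
  have "((\<lambda>x::real. 0::real) \<longlongrightarrow> measure (interval_measure G) {..<0}) (at_left 0)"
  proof (rule Lim_transform_eventually[OF cdf_at_left[of 0]])
    show "\<forall>\<^sub>F x in at_left 0. cdf (interval_measure G) x = 0"
      unfolding cdf by (auto simp: eventually_at_filter neg)
  qed
  then have "measure (interval_measure G) {..<0} = 0"
    by (simp add: tendsto_const_iff)
  moreover have "0 < tail (interval_measure G) x" for x
    using assms by (simp add: tail subexponential_def)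
  moreover have "((\<lambda>x. tail (interval_measure G \<star> interval_measure G) x / tail (interval_measure G) x) \<longlongrightarrow> 2) at_top"
    using assms by (simp add: tail subexponential_def) (simp add: tail_def)
  ultimately show "subexp_distribution (interval_measure G)"
    by unfold_locales auto
qed

text \<open>Beyond a point where the cap at 1 is inactive, increments of the tail are integrals of
  the decreasing function \<open>1 - F\<close> over intervals, and its end values bound
  them.\<close>

lemma integrated_tail_integrated_subexp:
  assumes F: "subexponential F" and I: "subexponential (\<lambda>x. 1 - integrated_tail F x)"
  shows "\<exists>x1. integrated_subexp (interval_measure (\<lambda>x. 1 - integrated_tail F x)) (\<lambda>x. 1 - F x) x1"
proof -
  define \<beta> where "\<beta> = interval_measure (\<lambda>x. 1 - integrated_tail F x)"
  interpret subexp_distribution \<beta>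
    unfolding \<beta>_def by (rule subexponential_imp_subexp_distribution[OF I])
  have tail: "tail \<beta> x = integrated_tail F x" for x
    unfolding \<beta>_def by (simp add: subexponential_imp_subexp_distribution[OF I])
  have F_mono: "mono F" and F_lt: "\<And>x. F x < 1"
    using F by (auto simp: subexponential_def distribution_function_nonneg_def)
  have "\<forall>\<^sub>F x in at_top. tail \<beta> x < 1"
    by (rule order_tendstoD(2)[OF tail_tendsto_0[OF real_dist]]) simp
  then have "\<forall>\<^sub>F x in at_top. 0 \<le> x \<and> tail \<beta> x < 1"
    using eventually_ge_at_top[of 0] by eventually_elim auto
  then obtain x1 where x1: "\<And>x. x1 \<le> x \<Longrightarrow> 0 \<le> x \<and> tail \<beta> x < 1"
    by (auto simp: eventually_at_top_linorder)
  have tail_eq: "tail \<beta> x = (LBINT u:{x..}. 1 - F u)" if "x1 \<le> x" for x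
    using x1[OF that] unfolding tail integrated_tail_def by (auto simp: min_def split: if_splits)
  \<comment> \<open>Integrability follows from positivity of the tail, as the integral of a function
    that is not integrable is 0 by convention.\<close>
  have int: "set_integrable lborel {x..} (\<lambda>u. 1 - F u)" if "x1 \<le> x" for x
  proof (rule ccontr)
    assume "\<not> set_integrable lborel {x..} (\<lambda>u. 1 - F u)"
    then have "(LBINT u:{x..}. 1 - F u) = 0"
      unfolding set_integrable_def set_lebesgue_integral_def by (rule not_integrable_integral_eq)
    with tail_eq[OF that] tail_pos[of x] show False by simp
  qed
  have diff: "tail \<beta> x - tail \<beta> (x + h) = (LBINT u:{x..<x + h}. 1 - F u)"
    and int': "set_integrable lborel {x..<x + h} (\<lambda>u. 1 - F u)" if "x1 \<le> x" "0 \<le> h" for x h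
  proof -
    show int': "set_integrable lborel {x..<x + h} (\<lambda>u. 1 - F u)"
      by (rule set_integrable_subset[OF int[OF that(1)]]) auto
    have eq: "{x..} = {x..<x + h} \<union> {x + h..}" using that by auto
    have "(LBINT u:{x..}. 1 - F u) = (LBINT u:{x..<x + h}. 1 - F u) + (LBINT u:{x + h..}. 1 - F u)"
      unfolding eq using that by (intro set_integral_Un int' int) auto
    then show "tail \<beta> x - tail \<beta> (x + h) = (LBINT u:{x..<x + h}. 1 - F u)"
      using tail_eq[of x] tail_eq[of "x + h"] that by simp
  qed
  have const: "(LBINT u:{x..<x + h}. c) = h * c" "set_integrable lborel {x..<x + h} (\<lambda>_. c)"
    if "0 \<le> h" for x h c :: real
    using that set_integral_const[of "{x..<x + h}" lborel c]
    by (auto simp: set_integrable_def intro!: integrable_scaleR_left integrable_real_indicator)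
  show ?thesis
    unfolding \<beta>_def[symmetric]
  proof (intro exI[of _ x1] integrated_subexp.intro integrated_subexp_axioms.intro subexp_distribution_axioms)
    fix x h assume x: "x1 \<le> x" and h: "0 \<le> (h::real)"
    have "(LBINT u:{x..<x + h}. 1 - F (x + h)) \<le> (LBINT u:{x..<x + h}. 1 - F u)"
      by (rule set_integral_mono[OF const(2)[OF h] int'[OF x h]]) (auto intro: monoD[OF F_mono])
    then show "h * (1 - F (x + h)) \<le> tail \<beta> x - tail \<beta> (x + h)"
      unfolding diff[OF x h] const(1)[OF h] .
    have "(LBINT u:{x..<x + h}. 1 - F u) \<le> (LBINT u:{x..<x + h}. 1 - F x)"
      by (rule set_integral_mono[OF int'[OF x h] const(2)[OF h]]) (auto intro: monoD[OF F_mono])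
    then show "tail \<beta> x - tail \<beta> (x + h) \<le> h * (1 - F x)"
      unfolding diff[OF x h] const(1)[OF h] .
  qed (use F_lt in \<open>auto intro: less_imp_le\<close>)
qed

lemma (in prob_space) tail_distr_random_variable:
  "random_variable borel X \<Longrightarrow> tail (distr M borel X) x = \<P>(\<omega> in M. x < X \<omega>)"
  by (auto simp: tail_def measure_distr vimage_def Int_def intro!: arg_cong[where f=prob])

lemma asymp_equiv_imp_ratio:
  fixes g h :: "real \<Rightarrow> real"
  assumes "g \<sim>[at_top] (\<lambda>x. c * h x)" "0 < c" "\<And>x. 0 < h x"
  shows "((\<lambda>x. g x / h x) \<longlongrightarrow> c) at_top"
proof -
  have "((\<lambda>x. g x / (c * h x)) \<longlongrightarrow> 1) at_top"
    using assms(2,3) by (intro asymp_equivD_strong[OF assms(1)] always_eventually) (auto simp: less_imp_neq[THEN not_sym])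
  from tendsto_mult[OF tendsto_const[of c] this] show ?thesis
    using assms(2) by simp
qed

section \<open>Tail of a block service time\<close>

locale heavy_tailed_network = stochastic_network M K f T \<zeta> a
  for M :: "'w measure" and K :: "'k measure"
    and f :: "nat \<Rightarrow> (nat \<Rightarrow> real) \<times> (nat \<Rightarrow> 'k) \<Rightarrow> real"
    and T :: "int \<Rightarrow> 'w \<Rightarrow> real" and \<zeta> :: "int \<Rightarrow> 'w \<Rightarrow> 'k" and a :: real +
  fixes r :: nat and Y :: "int \<Rightarrow> nat \<Rightarrow> 'w \<Rightarrow> real" and F :: "real \<Rightarrow> real" and d :: "nat \<Rightarrow> real"
  assumes IA: "assumption_IA M K T \<zeta>"
    and AA: "assumption_AA M f T \<zeta> r Y"
    and SE: "assumption_SE M r Y F d"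
    and H: "assumption_H M r Y F d"
begin

abbreviation service_law :: "nat \<Rightarrow> real measure" where
  "service_law L \<equiv> distr M borel (service_hat f \<zeta> L 0)"

definition dsum :: real where "dsum = (\<Sum>j=1..r. d j)"

lemma dsum_pos: "0 < dsum"
  using SE by (simp add: assumption_SE_def dsum_def)

lemma subexp_F: "subexponential F"
  using SE by (simp add: assumption_SE_def)

sublocale F: subexp_distribution "interval_measure F"
  by (rule subexponential_imp_subexp_distribution[OF subexp_F])

lemma tail_F: "tail (interval_measure F) x = 1 - F x"
  by (rule subexponential_imp_subexp_distribution[OF subexp_F])

lemma F_less_1: "0 < 1 - F x"
  using F.tail_pos[of x] by (simp add: tail_F)

definition Y_max :: "int \<Rightarrow> 'w \<Rightarrow> real" where
  "Y_max i \<omega> = (MAX j\<in>{1..r}. Y i j \<omega>)"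

lemma r_pos: "1 \<le> r"
  using AA by (simp add: assumption_AA_def)

lemma indep_vars_Y: "indep_vars (\<lambda>_. \<Pi>\<^sub>M j\<in>{1..r}. borel) (\<lambda>i \<omega>. \<lambda>j\<in>{1..r}. Y i j \<omega>) UNIV"
  using AA by (simp add: assumption_AA_def iid_sequence_def)

lemma random_variable_Y:
  assumes "j \<in> {1..r}" shows "random_variable borel (Y i j)"
proof -
  have "random_variable (\<Pi>\<^sub>M j\<in>{1..r}. borel) (\<lambda>\<omega>. \<lambda>j\<in>{1..r}. Y i j \<omega>)"
    using indep_vars_Y by (simp add: indep_vars_def)
  from measurable_compose[OF this measurable_component_singleton[OF assms]] assms
  show ?thesis by simp
qed

lemma measurable_Max_components:
  "(\<lambda>v. MAX j\<in>{1..r}. v j) \<in> borel_measurable (\<Pi>\<^sub>M j\<in>{1..r}. (borel :: real measure))"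
  by (rule borel_measurable_Max) auto

lemma Y_max_eq: "Y_max i \<omega> = (MAX j\<in>{1..r}. (\<lambda>j\<in>{1..r}. Y i j \<omega>) j)"
  unfolding Y_max_def by (rule arg_cong[where f=Max], rule image_cong) auto

lemma indep_vars_Y_max: "indep_vars (\<lambda>_. borel) Y_max UNIV"
proof -
  have "Y_max = (\<lambda>i \<omega>. MAX j\<in>{1..r}. (\<lambda>j\<in>{1..r}. Y i j \<omega>) j)"
    by (intro ext) (rule Y_max_eq)
  then show ?thesis
    using indep_vars_compose2[OF indep_vars_Y, of "\<lambda>_ v. MAX j\<in>{1..r}. v j" "\<lambda>_. borel"]
      measurable_Max_components by simp
qed

lemma random_variable_Y_max: "random_variable borel (Y_max i)"
  using indep_vars_Y_max by (simp add: indep_vars_def)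

lemma distr_Y_max: "distr M borel (Y_max i) = distr M borel (Y_max 1)"
proof -
  have rv: "random_variable (\<Pi>\<^sub>M j\<in>{1..r}. borel) (\<lambda>\<omega>. \<lambda>j\<in>{1..r}. Y i j \<omega>)" for i
    using indep_vars_Y by (simp add: indep_vars_def)
  have eq: "distr M borel (Y_max i) = distr (distr M (\<Pi>\<^sub>M j\<in>{1..r}. borel) (\<lambda>\<omega>. \<lambda>j\<in>{1..r}. Y i j \<omega>)) borel
      (\<lambda>v. MAX j\<in>{1..r}. v j)" for i
    by (subst distr_distr[OF measurable_Max_components rv], rule arg_cong[where f="distr M borel"])
      (simp add: comp_def Y_max_eq[abs_def])
  have "distr M (\<Pi>\<^sub>M j\<in>{1..r}. borel) (\<lambda>\<omega>. \<lambda>j\<in>{1..r}. Y i j \<omega>) =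
      distr M (\<Pi>\<^sub>M j\<in>{1..r}. borel) (\<lambda>\<omega>. \<lambda>j\<in>{1..r}. Y 1 j \<omega>)"
    using AA by (simp only: assumption_AA_def iid_sequence_def)
  then show ?thesis unfolding eq by simp
qed

lemma H_last: "(\<lambda>x. \<Sum>j=1..r. \<P>(\<omega> in M. Y 1 j \<omega> > x)) \<sim>[at_top] (\<lambda>x. dsum * (1 - F x))"
  using H by (simp add: assumption_H_def dsum_def sum_distrib_right)

lemma ratio_Y_max: "((\<lambda>x. \<P>(\<omega> in M. x < Y_max 1 \<omega>) / (1 - F x)) \<longlongrightarrow> dsum) at_top"
proof (rule asymp_equiv_imp_ratio[OF _ dsum_pos F_less_1])
  have "(\<lambda>x. \<P>(\<omega> in M. x < Y_max 1 \<omega>)) \<sim>[at_top] (\<lambda>x. \<Sum>j=1..r. \<P>(\<omega> in M. Y 1 j \<omega> > x))"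
    using H by (simp only: assumption_H_def Y_max_def)
  also note H_last
  finally show "(\<lambda>x. \<P>(\<omega> in M. x < Y_max 1 \<omega>)) \<sim>[at_top] (\<lambda>x. dsum * (1 - F x))" .
qed

lemma ratio_Y_sum: "((\<lambda>x. \<P>(\<omega> in M. x < (\<Sum>j=1..r. Y 1 j \<omega>)) / (1 - F x)) \<longlongrightarrow> dsum) at_top"
proof (rule asymp_equiv_imp_ratio[OF _ dsum_pos F_less_1])
  have "(\<lambda>x. \<P>(\<omega> in M. x < (\<Sum>j=1..r. Y 1 j \<omega>))) \<sim>[at_top]
      (\<lambda>x. prob {\<omega> \<in> space M. (MAX j\<in>{1..r}. Y 1 j \<omega>) > x})"
    using H by (simp only: assumption_H_def)
  also have "\<dots> \<sim>[at_top] (\<lambda>x. \<Sum>j=1..r. \<P>(\<omega> in M. Y 1 j \<omega> > x))"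
    using H by (simp only: assumption_H_def)
  also note H_last
  finally show "(\<lambda>x. \<P>(\<omega> in M. x < (\<Sum>j=1..r. Y 1 j \<omega>))) \<sim>[at_top] (\<lambda>x. dsum * (1 - F x))" .
qed

text \<open>Stationarity moves the index to 1, where the tail assumptions are stated. The dummy
  index turns one law into a constant family.\<close>

lemma tail_bound_dater_Q_single:
  "tail_bound (interval_measure F) (\<lambda>_::nat. distr M borel (mark_dater i i)) dsum"
  unfolding tail_bound_def
proof (intro allI impI)
  fix \<delta> :: real assume "0 < \<delta>"
  then have "\<forall>\<^sub>F x in at_top. \<P>(\<omega> in M. x < (\<Sum>j=1..r. Y 1 j \<omega>)) / (1 - F x) < dsum + \<delta>"
    by (intro order_tendstoD(2)[OF ratio_Y_sum]) simp
  then show "\<forall>\<^sub>F x in at_top. \<forall>_::nat. tail (distr M borel (mark_dater i i)) x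
      \<le> (dsum + \<delta>) * tail (interval_measure F) x"
  proof eventually_elim
    case (elim x)
    have [measurable]: "random_variable borel (\<lambda>\<omega>. \<Sum>j=1..r. Y 1 j \<omega>)"
      by (intro borel_measurable_sum random_variable_Y)
    have [measurable]: "random_variable borel (mark_dater 1 1)"
      by (intro random_variable_dater_Q) simp
    have ae: "AE \<omega> in M. maximal_dater f 1 1 (\<lambda>k. T k \<omega>) (\<lambda>k. \<zeta> k \<omega>) = (\<Sum>j=1..r. Y 1 j \<omega>)"
      using AA by (simp add: assumption_AA_def)
    have "tail (distr M borel (mark_dater i i)) x =
        tail (distr M borel (mark_dater 1 1)) x"
      using distr_dater_Q_shift[of 1 1 "i - 1"] by simp
    also have "\<dots> = \<P>(\<omega> in M. x < mark_dater 1 1 \<omega>)"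
      by (rule tail_distr_random_variable) simp
    also have "\<dots> = \<P>(\<omega> in M. x < (\<Sum>j=1..r. Y 1 j \<omega>))"
    proof (rule finite_measure_eq_AE)
      show "AE \<omega> in M. \<omega> \<in> {\<omega> \<in> space M. x < mark_dater 1 1 \<omega>} \<longleftrightarrow>
          \<omega> \<in> {\<omega> \<in> space M. x < (\<Sum>j=1..r. Y 1 j \<omega>)}"
        using ae AE_space
      proof eventually_elim
        case (elim \<omega>)
        then show ?case using maximal_dater_single[OF range_\<zeta>, of \<omega> 1 "\<lambda>k. T k \<omega>"] by simp
      qed
    qed measurable
    also have "\<dots> \<le> (dsum + \<delta>) * (1 - F x)"
      using elim F_less_1[of x] by (simp add: pos_divide_less_eq less_imp_le)
    finally show ?case by (simp add: tail_F)
  qed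
qed

lemma indep_vars_dater_Q_single: "indep_vars (\<lambda>_. borel) (\<lambda>i \<omega>. mark_dater i i \<omega>) UNIV"
  by (rule indep_vars_dater_Q_blocks)
    (use IA in \<open>auto simp: assumption_IA_def iid_sequence_def disjoint_family_on_def\<close>)

text \<open>Subexponentiality of \<open>F\<close> itself enters here: each independent single dater
  adds \<open>dsum\<close> to the constant.\<close>

lemma tail_bound_sum_dater_Q:
  assumes "finite I"
  shows "tail_bound (interval_measure F)
    (\<lambda>_::nat. distr M borel (\<lambda>\<omega>. \<Sum>i\<in>I. mark_dater i i \<omega>)) (real (card I) * dsum)"
  using assms
proof (induction I)
  case empty
  have "tail (distr M borel (\<lambda>\<omega>. 0)) x \<le> \<delta> * tail (interval_measure F) x" if "0 \<le> x" "0 < \<delta>" for x \<delta>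
    using that by (subst tail_distr_random_variable) auto
  then show ?case
    unfolding tail_bound_def
    by (auto intro!: eventually_mono[OF eventually_ge_at_top[of 0]])
next
  case (insert i I)
  let ?Z = "\<lambda>i \<omega>. mark_dater i i \<omega>"
  have rv: "random_variable borel (?Z i)" for i by (rule random_variable_dater_Q) simp
  have rv_sum: "random_variable borel (\<lambda>\<omega>. \<Sum>i\<in>I. ?Z i \<omega>)"
    by (intro borel_measurable_sum rv)
  have "indep_var borel (?Z i) borel (\<lambda>\<omega>. \<Sum>i\<in>I. ?Z i \<omega>)"
    by (rule indep_vars_sum[OF insert.hyps]) (rule indep_vars_subset[OF indep_vars_dater_Q_single], simp)
  from sum_indep_random_variable[OF this rv rv_sum]
  have eq: "distr M borel (\<lambda>\<omega>. \<Sum>i\<in>insert i I. ?Z i \<omega>) =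
      (distr M borel (?Z i) \<star> distr M borel (\<lambda>\<omega>. \<Sum>i\<in>I. ?Z i \<omega>))"
    using insert.hyps by simp
  have "tail_bound (interval_measure F) (\<lambda>_::nat. distr M borel (?Z i) \<star> distr M borel (\<lambda>\<omega>. \<Sum>i\<in>I. ?Z i \<omega>))
      (dsum + real (card I) * dsum)"
    using dsum_pos
    by (intro F.tail_bound_convolution real_distribution_distr rv rv_sum tail_bound_dater_Q_single insert.IH) auto
  then show ?case
    unfolding eq using insert.hyps by (simp add: algebra_simps)
qed

lemma tail_service_hat_upper:
  assumes L: "1 \<le> L" and \<delta>: "0 < \<delta>"
  shows "\<forall>\<^sub>F x in at_top. tail (service_law L) x \<le> (real L * dsum + \<delta>) * (1 - F x)"
proof -
  let ?S = "\<lambda>\<omega>. \<Sum>i\<in>{1 - int L..0}. mark_dater i i \<omega>"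
  have rv: "random_variable borel ?S"
    by (intro borel_measurable_sum random_variable_dater_Q) simp
  have "\<forall>\<^sub>F x in at_top. tail (distr M borel ?S) x \<le> (real L * dsum + \<delta>) * tail (interval_measure F) x"
    using tail_bound_sum_dater_Q[of "{1 - int L..0}"] \<delta> by (auto simp: tail_bound_def)
  then show ?thesis
  proof eventually_elim
    case (elim x)
    have "\<P>(\<omega> in M. x < service_hat f \<zeta> L 0 \<omega>) \<le> \<P>(\<omega> in M. x < ?S \<omega>)"
    proof (rule finite_measure_mono)
      show "{\<omega> \<in> space M. x < service_hat f \<zeta> L 0 \<omega>} \<subseteq> {\<omega> \<in> space M. x < ?S \<omega>}"
      proof safe
        fix \<omega> assume \<omega>: "\<omega> \<in> space M" and x: "x < service_hat f \<zeta> L 0 \<omega>"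
        from dater_Q_le_sum[OF range_\<zeta>[OF \<omega>], of "1 - int L" 0] L x
        show "x < ?S \<omega>" by (simp add: service_hat_def)
      qed
      show "{\<omega> \<in> space M. x < ?S \<omega>} \<in> events" using rv by measurable
    qed
    then show ?case
      using elim rv random_variable_service_hat[OF L] by (simp add: tail_distr_random_variable tail_F)
  qed
qed

text \<open>By nonnegativity one component above \<open>x\<close> lifts its sum over the block above
  \<open>x\<close>, and (AA) lifts the service time. The maxima over components are independent
  between customers, so the probability that none exceeds \<open>x\<close> is a power.\<close>

lemma tail_service_hat_ge:
  assumes L: "1 \<le> L"
  shows "1 - (1 - \<P>(\<omega> in M. x < Y_max 1 \<omega>)) ^ L \<le> tail (service_law L) x"
proof -
  define I where "I = {1 - int L..0}"
  have I: "finite I" "card I = L" by (auto simp: I_def)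
  note [measurable] = random_variable_Y_max random_variable_service_hat[OF L]
  have p: "prob {\<omega> \<in> space M. Y_max i \<omega> \<in> {..x}} = 1 - \<P>(\<omega> in M. x < Y_max 1 \<omega>)" for i
  proof -
    have "\<P>(\<omega> in M. x < Y_max i \<omega>) = \<P>(\<omega> in M. x < Y_max 1 \<omega>)"
      using arg_cong[OF distr_Y_max[of i], of "\<lambda>\<nu>. tail \<nu> x"]
      by (simp add: tail_distr_random_variable random_variable_Y_max)
    moreover have "{\<omega> \<in> space M. Y_max i \<omega> \<in> {..x}} = space M - {\<omega> \<in> space M. x < Y_max i \<omega>}" by auto
    ultimately show ?thesis by (simp add: prob_compl)
  qed
  have "(1 - \<P>(\<omega> in M. x < Y_max 1 \<omega>)) ^ L = prob {\<omega> \<in> space M. \<forall>i\<in>I. Y_max i \<omega> \<in> {..x}}"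
    using indep_vars_prob_all[OF indep_vars_Y_max I(1), of "\<lambda>_. {..x}"] I p by simp
  also have "\<dots> = 1 - \<P>(\<omega> in M. \<exists>i\<in>I. x < Y_max i \<omega>)"
  proof -
    have "{\<omega> \<in> space M. \<forall>i\<in>I. Y_max i \<omega> \<in> {..x}} = space M - {\<omega> \<in> space M. \<exists>i\<in>I. x < Y_max i \<omega>}"
      by (auto simp: not_less)
    moreover have "{\<omega> \<in> space M. \<exists>i\<in>I. x < Y_max i \<omega>} \<in> events"
      using I by measurable
    ultimately show ?thesis by (simp add: prob_compl)
  qed
  finally have "1 - (1 - \<P>(\<omega> in M. x < Y_max 1 \<omega>)) ^ L = \<P>(\<omega> in M. \<exists>i\<in>I. x < Y_max i \<omega>)"
    by simp
  also have "\<dots> \<le> \<P>(\<omega> in M. x < service_hat f \<zeta> L 0 \<omega>)"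
  proof (rule finite_measure_mono_AE)
    have "AE \<omega> in M. \<forall>i\<in>I. \<forall>j\<in>{1..r}. 0 \<le> Y i j \<omega>"
      using AA I by (intro AE_finite_allI) (auto simp: assumption_AA_def)
    moreover have "\<forall>n\<le>0. AE \<omega> in M. (MAX j\<in>{1..r}. \<Sum>i\<in>{n..0}. Y i j \<omega>) \<le> mark_dater n 0 \<omega>"
      using AA unfolding assumption_AA_def by (elim conjE)
    then have "AE \<omega> in M. (MAX j\<in>{1..r}. \<Sum>i\<in>{1 - int L..0}. Y i j \<omega>) \<le> mark_dater (1 - int L) 0 \<omega>"
      by (elim allE impE) (use L in auto)
    ultimately show "AE \<omega> in M. \<omega> \<in> {\<omega> \<in> space M. \<exists>i\<in>I. x < Y_max i \<omega>} \<longrightarrow>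
        \<omega> \<in> {\<omega> \<in> space M. x < service_hat f \<zeta> L 0 \<omega>}"
    proof eventually_elim
      case (elim \<omega>)
      have "x < service_hat f \<zeta> L 0 \<omega>" if i: "i \<in> I" "x < Y_max i \<omega>" for i
      proof -
        have ne: "{1..r} \<noteq> {}" using r_pos by auto
        obtain j where j: "j \<in> {1..r}" "x < Y i j \<omega>"
          using i(2) ne unfolding Y_max_def by (subst (asm) Max_gr_iff) auto
        have "Y i j \<omega> \<le> (\<Sum>i\<in>I. Y i j \<omega>)"
          using elim(1) i(1) j(1) I(1) by (intro member_le_sum) auto
        also have "\<dots> \<le> (MAX j\<in>{1..r}. \<Sum>i\<in>I. Y i j \<omega>)"
          using j(1) by (intro Max_ge) auto
        also have "\<dots> \<le> service_hat f \<zeta> L 0 \<omega>"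
          using elim(2) by (simp add: I_def service_hat_def)
        finally show ?thesis using j by simp
      qed
      then show ?case by auto
    qed
  qed measurable
  finally show ?thesis
    using random_variable_service_hat[OF L] by (simp add: tail_distr_random_variable)
qed

lemma tail_service_hat_lower:
  assumes L: "1 \<le> L" and \<delta>: "0 < \<delta>"
  shows "\<forall>\<^sub>F x in at_top. (real L * dsum - \<delta>) * (1 - F x) \<le> tail (service_law L) x"
proof -
  define p where "p x = \<P>(\<omega> in M. x < Y_max 1 \<omega>)" for x
  have "p = tail (distr M borel (Y_max 1))"
    by (simp add: fun_eq_iff p_def tail_distr_random_variable[OF random_variable_Y_max])
  then have "(p \<longlongrightarrow> 0) at_top"
    using tail_tendsto_0[OF real_distribution_distr[OF random_variable_Y_max[of 1]]] by simp
  \<comment> \<open>\<open>1 - (1 - p) ^ L\<close> is \<open>p\<close> times a geometric sum of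
    \<open>L\<close> terms, each tending to 1.\<close>
  then have "((\<lambda>x. p x / (1 - F x) * (\<Sum>k<L. (1 - p x) ^ k)) \<longlongrightarrow> dsum * (\<Sum>k<L. (1 - 0) ^ k)) at_top"
    using ratio_Y_max unfolding p_def[symmetric] by (intro tendsto_intros)
  then have "\<forall>\<^sub>F x in at_top. real L * dsum - \<delta> < p x / (1 - F x) * (\<Sum>k<L. (1 - p x) ^ k)"
    by (rule order_tendstoD) (use \<delta> in simp)
  then show ?thesis
  proof eventually_elim
    case (elim x)
    have "p x * (\<Sum>k<L. (1 - p x) ^ k) = 1 - (1 - p x) ^ L"
      using one_diff_power_eq[of "1 - p x" L] by simp
    then have "(real L * dsum - \<delta>) * (1 - F x) \<le> 1 - (1 - p x) ^ L"
      using elim F_less_1[of x] by (simp add: pos_less_divide_eq less_imp_le)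
    also have "\<dots> \<le> tail (service_law L) x"
      unfolding p_def by (rule tail_service_hat_ge[OF L])
    finally show ?case .
  qed
qed

end

section \<open>From block tails to the queue and the stationary dater\<close>

context heavy_tailed_network
begin

lemma interarrival_hat_nonneg: "\<omega> \<in> space M \<Longrightarrow> 0 \<le> interarrival_hat T L i \<omega>"
  using monoD[OF T_mono, of \<omega> "int L * (i - 1)" "int L * i"]
  by (simp add: interarrival_hat_def mult_left_mono)

lemma tail_queue_increment_le:
  assumes L: "1 \<le> L"
  shows "tail (distr M borel (queue_increment L 0)) x \<le> tail (service_law L) x"
proof -
  note [measurable] = random_variable_service_hat[OF L]
  have "\<P>(\<omega> in M. x < queue_increment L 0 \<omega>) \<le> \<P>(\<omega> in M. x < service_hat f \<zeta> L 0 \<omega>)"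
  proof (rule finite_measure_mono)
    show "{\<omega> \<in> space M. x < queue_increment L 0 \<omega>} \<subseteq> {\<omega> \<in> space M. x < service_hat f \<zeta> L 0 \<omega>}"
    proof safe
      fix \<omega> assume "\<omega> \<in> space M" "x < queue_increment L 0 \<omega>"
      then show "x < service_hat f \<zeta> L 0 \<omega>"
        using interarrival_hat_nonneg[of \<omega> L 1] by (simp add: queue_increment_def)
    qed
  qed measurable
  then show ?thesis
    using random_variable_service_hat[OF L] random_variable_queue_increment[OF L]
    by (simp add: tail_distr_random_variable)
qed

lemma indep_var_service_interarrival:
  assumes L: "1 \<le> L"
  shows "indep_var borel (service_hat f \<zeta> L 0) borel (interarrival_hat T L 1)"
proof -
  let ?V = "case_sum (service_hat f \<zeta> L) (interarrival T)"
  have "indep_var borel ((\<lambda>v. v (Inl 0)) \<circ> (\<lambda>\<omega>. restrict (\<lambda>i. ?V i \<omega>) {Inl 0}))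
     borel ((\<lambda>v. \<Sum>k\<in>{0..<int L}. v (Inr k)) \<circ> (\<lambda>\<omega>. restrict (\<lambda>i. ?V i \<omega>) (Inr ` {0..<int L})))"
    by (rule indep_var_compose[OF indep_var_restrict[OF indep_vars_service_interarrival[OF IA L]]])
      (auto intro!: borel_measurable_sum measurable_component_singleton)
  then show ?thesis
    by (simp add: comp_def interarrival_hat_eq[abs_def])
qed

text \<open>The gap stays below some \<open>A\<close> with probability close to 1, independently of
  the service time, and then a service time above \<open>x + A\<close> suffices. \<open>A\<close>
  remains in the claim and is absorbed in \<open>tail_walk_max_lower\<close>.\<close>

lemma tail_queue_increment_lower:
  assumes L: "1 \<le> L" and \<delta>: "0 < \<delta>"
  shows "\<exists>A. \<forall>\<^sub>F x in at_top. (real L * dsum - \<delta>) * (1 - F (x + A)) \<le> tail (distr M borel (queue_increment L 0)) x"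
proof -
  define D where "D = real L * dsum"
  have D: "0 \<le> D" using dsum_pos by (simp add: D_def)
  \<comment> \<open>Chosen such that \<open>(D - \<delta> / 2) * (1 - \<eta>)\<close> is at least
    \<open>D - \<delta>\<close>.\<close>
  define \<eta> where "\<eta> = min 1 (\<delta> / (2 * (D + 1)))"
  have \<eta>: "0 < \<eta>" "\<eta> \<le> 1" using \<delta> D by (auto simp: \<eta>_def)
  have "\<eta> * D \<le> \<delta> / (2 * (D + 1)) * D"
    using D by (intro mult_right_mono) (auto simp: \<eta>_def)
  also have "\<dots> \<le> \<delta> / 2" using D \<delta> by (simp add: field_simps)
  finally have "\<eta> * D \<le> \<delta> / 2" .
  moreover have "(D - \<delta> / 2) * (1 - \<eta>) = D - \<delta> / 2 - \<eta> * D + \<delta> / 2 * \<eta>" by (simp add: field_simps)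
  moreover have "0 \<le> \<delta> / 2 * \<eta>" using \<delta> \<eta> by simp
  ultimately have D_le: "D - \<delta> \<le> (D - \<delta> / 2) * (1 - \<eta>)" by linarith
  note [measurable] = random_variable_service_hat[OF L] random_variable_interarrival_hat random_variable_queue_increment[OF L]
  have "\<forall>\<^sub>F A in at_top. tail (distr M borel (interarrival_hat T L 1)) A < \<eta>"
    by (rule order_tendstoD(2)[OF tail_tendsto_0[OF
          real_distribution_distr[OF random_variable_interarrival_hat]] \<eta>(1)])
  then obtain A where A: "tail (distr M borel (interarrival_hat T L 1)) A < \<eta>"
    using eventually_happens'[OF trivial_limit_at_top_linorder] by blast
  have "\<P>(\<omega> in M. interarrival_hat T L 1 \<omega> \<le> A) = 1 - tail (distr M borel (interarrival_hat T L 1)) A"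
  proof -
    have "{\<omega> \<in> space M. interarrival_hat T L 1 \<omega> \<le> A} = space M - {\<omega> \<in> space M. A < interarrival_hat T L 1 \<omega>}"
      by auto
    then show ?thesis by (simp add: prob_compl tail_distr_random_variable)
  qed
  with A have A: "1 - \<eta> \<le> \<P>(\<omega> in M. interarrival_hat T L 1 \<omega> \<le> A)" by simp
  have filter: "filterlim (\<lambda>x. x - - A) at_top at_top" by (rule filterlim_minus_const_at_top)
  have \<delta>2: "0 < \<delta> / 2" using \<delta> by simp
  have "\<forall>\<^sub>F x in at_top. (D - \<delta> / 2) * (1 - F (x - - A)) \<le> tail (service_law L) (x - - A)"
    using eventually_compose_filterlim[OF tail_service_hat_lower[OF L \<delta>2] filter] unfolding D_def .
  then have "\<forall>\<^sub>F x in at_top. (D - \<delta>) * (1 - F (x + A)) \<le> tail (distr M borel (queue_increment L 0)) x"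
  proof eventually_elim
    case (elim x)
    have "(D - \<delta>) * (1 - F (x + A)) \<le> (D - \<delta> / 2) * (1 - \<eta>) * (1 - F (x + A))"
      using D_le F_less_1[of "x + A"] by (intro mult_right_mono) auto
    also have "\<dots> = (D - \<delta> / 2) * (1 - F (x + A)) * (1 - \<eta>)" by simp
    also have "\<dots> \<le> tail (service_law L) (x + A) * (1 - \<eta>)"
      using elim \<eta> by (intro mult_right_mono) auto
    also have "\<dots> \<le> tail (service_law L) (x + A) * \<P>(\<omega> in M. interarrival_hat T L 1 \<omega> \<le> A)"
      using A by (intro mult_left_mono) auto
    also have "\<dots> = prob (service_hat f \<zeta> L 0 -` {x + A<..} \<inter> space M) * prob (interarrival_hat T L 1 -` {..A} \<inter> space M)"
      by (simp add: tail_distr_random_variable vimage_def Int_def conj_commute)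
    also have "\<dots> = prob ((\<lambda>\<omega>. (service_hat f \<zeta> L 0 \<omega>, interarrival_hat T L 1 \<omega>)) -` ({x + A<..} \<times> {..A}) \<inter> space M)"
      by (rule indep_varD[OF indep_var_service_interarrival[OF L], symmetric]) auto
    also have "\<dots> \<le> \<P>(\<omega> in M. x < queue_increment L 0 \<omega>)"
      by (rule finite_measure_mono) (auto simp: queue_increment_def)
    finally show ?case by (simp add: tail_distr_random_variable)
  qed
  then show ?thesis unfolding D_def by blast
qed

text \<open>At horizon \<open>N\<close> the response has law
  \<open>\<sigma> \<star> walk_max H N\<close>. For the upper bound \<open>\<sigma>\<close>
  contributes the constant 0; for the lower bound the nonnegative service time is dropped. Both
  bounds leave the constant of the walk, whose drift is \<open>- \<mu>\<close>.\<close>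

lemma upper_bound_queue_limit:
  assumes L: "upper_bound_queue_stable M f \<zeta> a L"
  defines "\<mu> \<equiv> real L * a - expectation (mark_dater (- int L) (- 1))"
  shows "((\<lambda>x. \<P>(\<omega> in M. ereal x < response_hat f T \<zeta> L \<omega>) / integrated_tail F x)
    \<longlongrightarrow> real L * dsum / \<mu>) at_top"
proof -
  have L1: "1 \<le> L" and \<mu>: "0 < \<mu>"
    using L by (auto simp: upper_bound_queue_stable_def \<mu>_def)
  define \<beta> where "\<beta> = interval_measure (\<lambda>x. 1 - integrated_tail F x)"
  have subexp_I: "subexponential (\<lambda>x. 1 - integrated_tail F x)"
    using SE by (simp add: assumption_SE_def)
  obtain x1 where "integrated_subexp \<beta> (\<lambda>x. 1 - F x) x1"
    using integrated_tail_integrated_subexp[OF subexp_F subexp_I] unfolding \<beta>_def by blast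
  then interpret I: integrated_subexp \<beta> "\<lambda>x. 1 - F x" x1 .
  have tail_I: "tail \<beta> x = integrated_tail F x" for x
    unfolding \<beta>_def by (simp add: subexponential_imp_subexp_distribution[OF subexp_I])
  define H where "H = distr M borel (queue_increment L 0)"
  define \<sigma> where "\<sigma> = distr M borel (service_hat f \<zeta> L 0)"
  note [measurable] = random_variable_service_hat[OF L1] random_variable_queue_increment[OF L1]
  have rH: "real_distribution H" and r\<sigma>: "real_distribution \<sigma>"
    unfolding H_def \<sigma>_def by (auto intro!: real_distribution_distr)
  have intH: "integrable H (\<lambda>x. x)"
    unfolding H_def using expectation_queue_increment(1)[OF L1] by (subst integrable_distr_eq) auto
  have meanH: "(\<integral>x. x \<partial>H) = - \<mu>"
    unfolding H_def using expectation_queue_increment(2)[OF L1] by (subst integral_distr) (auto simp: \<mu>_def)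
  define D where "D = real L * dsum"
  have D: "0 \<le> D" using dsum_pos by (simp add: D_def)
  have H_upper: "\<forall>\<^sub>F u in at_top. tail H u \<le> (D + \<delta>) * (1 - F u)" if "0 < \<delta>" for \<delta>
    using tail_service_hat_upper[OF L1 that]
  proof eventually_elim
    case (elim u)
    then show ?case
      using tail_queue_increment_le[OF L1, of u] by (simp add: H_def D_def)
  qed
  have bound_walk: "tail_bound \<beta> (walk_max H) (D / \<mu>)"
    by (rule I.tail_bound_walk_max[OF rH intH meanH \<mu> D H_upper])
  \<comment> \<open>\<open>1 - F x\<close> is at most the increment of \<open>tail \<beta>\<close>
    between \<open>x - 1\<close> and \<open>x\<close>, and this is negligible because
    \<open>\<beta>\<close> is long-tailed.\<close>
  have bound_service: "tail_bound \<beta> (\<lambda>_::nat. \<sigma>) 0"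
    unfolding tail_bound_def
  proof (intro allI impI)
    fix \<delta> :: real assume \<delta>: "0 < \<delta>"
    define s where "s = 1 + \<delta> / (D + 1)"
    have s: "1 < s" using D \<delta> by (simp add: s_def)
    have "\<forall>\<^sub>F x in at_top. tail \<sigma> x \<le> (D + 1) * (1 - F x)"
      unfolding \<sigma>_def D_def by (rule tail_service_hat_upper[OF L1]) simp
    then show "\<forall>\<^sub>F x in at_top. \<forall>_::nat. tail \<sigma> x \<le> (0 + \<delta>) * tail \<beta> x"
      using eventually_ge_at_top[of "x1 + 1"] I.eventually_shift_le[OF s, of 1]
    proof eventually_elim
      case (elim x)
      have "1 - F x \<le> tail \<beta> (x - 1) - tail \<beta> x"
        using I.increment_ge[of "x - 1" 1] elim by simp
      also have "\<dots> \<le> \<delta> / (D + 1) * tail \<beta> x"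
        using elim by (simp add: s_def algebra_simps)
      finally have "(D + 1) * (1 - F x) \<le> (D + 1) * (\<delta> / (D + 1) * tail \<beta> x)"
        using D by (intro mult_left_mono) auto
      also have "\<dots> = \<delta> * tail \<beta> x" using D by simp
      finally show ?case using elim by simp
    qed
  qed
  have bound: "tail_bound \<beta> (\<lambda>N. \<sigma> \<star> walk_max H N) (0 + D / \<mu>)"
    using D \<mu> by (intro I.tail_bound_convolution r\<sigma> real_distribution_walk_max rH bound_service bound_walk) auto
  let ?pm = "\<lambda>N \<omega>. partial_max (\<lambda>i. reversed_queue L i \<omega>) 1 N"
  note ind = indep_vars_reversed_queue[OF IA L1]
  have rv: "random_variable borel (reversed_queue L i)" for i
    using ind by (simp add: indep_vars_def)
  note rv_pm = random_variable_partial_max[of "reversed_queue L", OF rv]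
  have distr_pm: "distr M borel (?pm N) = walk_max H N" for N
  proof (rule distr_partial_max[OF ind])
    fix i :: nat assume "1 \<le> i"
    then obtain k where "i = Suc k" by (cases i) auto
    then show "distr M borel (reversed_queue L i) = H"
      using distr_queue_increment[OF L1, of "- int k - 1"] by (simp add: reversed_queue_def H_def)
  qed simp
  have service_eq: "reversed_queue L 0 = service_hat f \<zeta> L 0"
    by (simp add: reversed_queue_def)
  have distr_sum: "distr M borel (\<lambda>\<omega>. service_hat f \<zeta> L 0 \<omega> + ?pm N \<omega>) = (\<sigma> \<star> walk_max H N)" for N
    using sum_indep_random_variable[OF indep_var_partial_max[OF ind, of 0 N] rv rv_pm] distr_pm[of N]
    by (simp add: service_eq \<sigma>_def)
  define R where "R x = {\<omega> \<in> space M. ereal x < response_hat f T \<zeta> L \<omega>}" for x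
  define E where "E x N = {\<omega> \<in> space M. x < service_hat f \<zeta> L 0 \<omega> + ?pm N \<omega>}" for x N
  have E_events: "E x N \<in> events" for x N
    unfolding E_def using rv_pm[of 1 N] by measurable
  have R_eq: "R x = (\<Union>N. E x N)" for x
    unfolding R_def E_def less_response_hat_iff by auto
  have R_events: "R x \<in> events" for x unfolding R_eq using E_events by auto
  have prob_E: "prob (E x N) = tail (\<sigma> \<star> walk_max H N) x" for x N
    unfolding E_def distr_sum[symmetric] using rv_pm[of 1 N]
    by (subst tail_distr_random_variable) auto
  have incseq_E: "incseq (E x)" for x
  proof (rule incseq_SucI)
    have "x - service_hat f \<zeta> L 0 \<omega> < ?pm (Suc N) \<omega>" if "x - service_hat f \<zeta> L 0 \<omega> < ?pm N \<omega>" for N \<omega>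
      using that unfolding less_partial_max_iff by (auto intro: le_SucI)
    then show "E x N \<subseteq> E x (Suc N)" for N
      unfolding E_def by (auto simp: diff_less_eq add.commute simp del: partial_max.simps)
  qed
  \<comment> \<open>The tails at finite horizons increase to that of the response, so a bound
    uniform in \<open>N\<close> survives the limit.\<close>
  have lim_E: "(\<lambda>N. prob (E x N)) \<longlonglongrightarrow> prob (R x)" for x
    unfolding R_eq by (rule finite_Lim_measure_incseq[OF _ incseq_E]) (use E_events in auto)
  have lower: "tail (walk_max H N) x \<le> prob (R x)" for N x
  proof -
    have "tail (walk_max H N) x = \<P>(\<omega> in M. x < ?pm N \<omega>)"
      unfolding distr_pm[symmetric] by (rule tail_distr_random_variable[OF rv_pm])
    also have "\<dots> \<le> prob (R x)"
    proof (rule finite_measure_mono[OF _ R_events])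
      show "{\<omega> \<in> space M. x < ?pm N \<omega>} \<subseteq> R x"
      proof safe
        fix \<omega> assume \<omega>: "\<omega> \<in> space M" and x: "x < ?pm N \<omega>"
        have "0 \<le> service_hat f \<zeta> L 0 \<omega>"
          unfolding service_hat_def
          by (rule dater_Q_nonneg[OF range_\<zeta>[OF \<omega>] service_hat_interval[OF L1]])
        then have "\<omega> \<in> E x N" using \<omega> x by (simp add: E_def)
        then show "\<omega> \<in> R x" by (auto simp: R_eq)
      qed
    qed
    finally show ?thesis .
  qed
  have "((\<lambda>x. prob (R x) / tail \<beta> x) \<longlongrightarrow> D / \<mu>) at_top"
  proof (rule order_tendstoI)
    fix y assume y: "y < D / \<mu>"
    define \<delta> where "\<delta> = (D / \<mu> - y) / 2"
    have \<delta>: "0 < \<delta>" "y < D / \<mu> - \<delta>" using y by (auto simp: \<delta>_def field_simps)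
    have H_lower: "\<exists>A. \<forall>\<^sub>F u in at_top. (D - \<delta>) * (1 - F (u + A)) \<le> tail H u" if "0 < \<delta>" for \<delta>
      unfolding H_def D_def by (rule tail_queue_increment_lower[OF L1 that])
    have "\<forall>\<^sub>F x in at_top. \<exists>N. (D / \<mu> - \<delta>) * tail \<beta> x \<le> tail (walk_max H N) x"
      by (rule I.tail_walk_max_lower[OF rH intH meanH \<mu> H_lower \<delta>(1)])
    then show "\<forall>\<^sub>F x in at_top. y < prob (R x) / tail \<beta> x"
    proof eventually_elim
      case (elim x)
      then obtain N where "(D / \<mu> - \<delta>) * tail \<beta> x \<le> tail (walk_max H N) x" by blast
      with lower[of N x] have "(D / \<mu> - \<delta>) * tail \<beta> x \<le> prob (R x)" by linarith
      then have "D / \<mu> - \<delta> \<le> prob (R x) / tail \<beta> x"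
        using I.tail_pos[of x] by (simp add: pos_le_divide_eq)
      with \<delta>(2) show ?case by linarith
    qed
  next
    fix y assume y: "D / \<mu> < y"
    define \<delta> where "\<delta> = (y - D / \<mu>) / 2"
    have \<delta>: "0 < \<delta>" "D / \<mu> + \<delta> < y" using y by (auto simp: \<delta>_def field_simps)
    have "\<forall>\<^sub>F x in at_top. \<forall>N. tail (\<sigma> \<star> walk_max H N) x \<le> (0 + D / \<mu> + \<delta>) * tail \<beta> x"
      using bound \<delta>(1) by (simp add: tail_bound_def)
    then show "\<forall>\<^sub>F x in at_top. prob (R x) / tail \<beta> x < y"
    proof eventually_elim
      case (elim x)
      have "prob (R x) \<le> (D / \<mu> + \<delta>) * tail \<beta> x"
        by (rule LIMSEQ_le_const2[OF lim_E]) (use elim in \<open>auto simp: prob_E\<close>)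
      then have "prob (R x) / tail \<beta> x \<le> D / \<mu> + \<delta>"
        using I.tail_pos[of x] by (simp add: pos_divide_le_eq)
      with \<delta>(2) show ?case by linarith
    qed
  qed
  then show ?thesis
    by (simp add: tail_I R_def D_def)
qed

lemma response_hat_event: "1 \<le> L \<Longrightarrow> {\<omega> \<in> space M. ereal x < response_hat f T \<zeta> L \<omega>} \<in> events"
proof -
  assume L: "1 \<le> L"
  note [measurable] = random_variable_service_hat[OF L]
  have rv: "random_variable borel (reversed_queue L i)" for i
    using indep_vars_reversed_queue[OF IA L] by (simp add: indep_vars_def)
  note [measurable] = random_variable_partial_max[of "reversed_queue L", OF rv]
  show ?thesis unfolding less_response_hat_iff by measurable
qed

lemma integrated_tail_nonneg: "0 \<le> integrated_tail F x"
  using subexponential_imp_subexp_distribution(2)[of "\<lambda>x. 1 - integrated_tail F x" x] SE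
    tail_nonneg[of "interval_measure (\<lambda>x. 1 - integrated_tail F x)" x]
  by (simp add: assumption_SE_def)

text \<open>Dividing by \<open>L\<close> turns the constant of the queue into
  \<open>dsum / (a - e L / real L)\<close>, whose limit is governed by \<open>gamma0\<close>. Since
  \<open>Z\<close> is dominated for every stable \<open>L\<close> and its limsup does not involve
  \<open>L\<close>, the bound passes to the limit.\<close>

lemma upper_bound_queue_tail_limit:
  assumes gamma: "gamma0 M f \<zeta> < a"
  shows "\<exists>c :: nat \<Rightarrow> real.
    (\<forall>\<^sub>F L in sequentially. upper_bound_queue_stable M f \<zeta> a L) \<and>
    (\<forall>L. upper_bound_queue_stable M f \<zeta> a L \<longrightarrow>
      ((\<lambda>x. measure M {\<omega> \<in> space M. response_hat f T \<zeta> L \<omega> > ereal x} / integrated_tail F x)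
        \<longlongrightarrow> c L) at_top) \<and>
    c \<longlonglongrightarrow> dsum / (a - gamma0 M f \<zeta>) \<and>
    Limsup at_top
      (\<lambda>x. ereal (measure M {\<omega> \<in> space M. stationary_dater f T \<zeta> \<omega> > ereal x} / integrated_tail F x))
      \<le> ereal (dsum / (a - gamma0 M f \<zeta>))"
proof -
  define e where "e n = expectation (mark_dater (- int n) (- 1))" for n
  have e: "(\<lambda>n. e n / real n) \<longlonglongrightarrow> gamma0 M f \<zeta>"
    unfolding e_def by (rule mean_dater_Q_tendsto_gamma0)
  define c where "c L = real L * dsum / (real L * a - e L)" for L
  have "\<forall>\<^sub>F L in sequentially. e L / real L < a"
    using order_tendstoD(2)[OF e gamma] .
  then have stable: "\<forall>\<^sub>F L in sequentially. upper_bound_queue_stable M f \<zeta> a L"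
    using eventually_ge_at_top[of 1]
    by eventually_elim (simp add: upper_bound_queue_stable_def e_def pos_divide_less_eq mult.commute)
  have limit: "((\<lambda>x. measure M {\<omega> \<in> space M. response_hat f T \<zeta> L \<omega> > ereal x} / integrated_tail F x)
        \<longlongrightarrow> c L) at_top" if "upper_bound_queue_stable M f \<zeta> a L" for L
    unfolding c_def e_def by (rule upper_bound_queue_limit[OF that])
  have "(\<lambda>L. dsum / (a - e L / real L)) \<longlonglongrightarrow> dsum / (a - gamma0 M f \<zeta>)"
    using gamma by (intro tendsto_intros e) auto
  then have c: "c \<longlonglongrightarrow> dsum / (a - gamma0 M f \<zeta>)"
  proof (rule Lim_transform_eventually)
    show "\<forall>\<^sub>F L in sequentially. dsum / (a - e L / real L) = c L"
      using eventually_ge_at_top[of 1]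
    proof eventually_elim
      case (elim L)
      then have "real L * a - e L = real L * (a - e L / real L)" by (simp add: algebra_simps)
      then show ?case using elim by (simp add: c_def)
    qed
  qed
  define z where "z x = measure M {\<omega> \<in> space M. stationary_dater f T \<zeta> \<omega> > ereal x} / integrated_tail F x" for x
  have limsup_le: "Limsup at_top (\<lambda>x. ereal (z x)) \<le> ereal (c L)" if L: "upper_bound_queue_stable M f \<zeta> a L" for L
  proof -
    have L1: "1 \<le> L" using L by (simp add: upper_bound_queue_stable_def)
    have "z x \<le> measure M {\<omega> \<in> space M. response_hat f T \<zeta> L \<omega> > ereal x} / integrated_tail F x" for x
      unfolding z_def
    proof (intro divide_right_mono finite_measure_mono)
      show "{\<omega> \<in> space M. stationary_dater f T \<zeta> \<omega> > ereal x} \<subseteq> {\<omega> \<in> space M. response_hat f T \<zeta> L \<omega> > ereal x}"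
        using stationary_dater_le_response_hat[OF _ L1] by (auto intro: less_le_trans)
    qed (use response_hat_event[OF L1] integrated_tail_nonneg in auto)
    then have "Limsup at_top (\<lambda>x. ereal (z x)) \<le>
        Limsup at_top (\<lambda>x. ereal (measure M {\<omega> \<in> space M. response_hat f T \<zeta> L \<omega> > ereal x} / integrated_tail F x))"
      by (intro Limsup_mono always_eventually) auto
    also have "\<dots> = ereal (c L)"
      by (intro lim_imp_Limsup trivial_limit_at_top_linorder tendsto_ereal limit[OF L])
    finally show ?thesis .
  qed
  have "Limsup at_top (\<lambda>x. ereal (z x)) \<le> ereal (dsum / (a - gamma0 M f \<zeta>))"
  proof (rule tendsto_lowerbound[OF tendsto_ereal[OF c]])
    show "\<forall>\<^sub>F L in sequentially. Limsup at_top (\<lambda>x. ereal (z x)) \<le> ereal (c L)"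
      using stable by eventually_elim (rule limsup_le)
  qed simp
  with stable limit c show ?thesis
    unfolding z_def by blast
qed

end

theorem theorem5:
  fixes M :: "'w measure"
    and K :: "'k measure"
    and f :: "nat \<Rightarrow> (nat \<Rightarrow> real) \<times> (nat \<Rightarrow> 'k) \<Rightarrow> real"
    and T :: "int \<Rightarrow> 'w \<Rightarrow> real"
    and \<zeta> :: "int \<Rightarrow> 'w \<Rightarrow> 'k"
    and a :: real
    and r :: nat
    and Y :: "int \<Rightarrow> nat \<Rightarrow> 'w \<Rightarrow> real"
    and F :: "real \<Rightarrow> real"
    and d :: "nat \<Rightarrow> real"
  assumes "stochastic_network M K f T \<zeta> a"
    and "gamma0 M f \<zeta> < a"
    and "assumption_IA M K T \<zeta>"
    and "assumption_AA M f T \<zeta> r Y"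
    and "assumption_SE M r Y F d"
    and "assumption_H M r Y F d"
  shows "\<exists>c :: nat \<Rightarrow> real.
    (\<forall>\<^sub>F L in sequentially. upper_bound_queue_stable M f \<zeta> a L) \<and>
    (\<forall>L. upper_bound_queue_stable M f \<zeta> a L \<longrightarrow>
      ((\<lambda>x. measure M {\<omega> \<in> space M. response_hat f T \<zeta> L \<omega> > ereal x} / integrated_tail F x)
        \<longlongrightarrow> c L) at_top) \<and>
    c \<longlonglongrightarrow> (\<Sum>j=1..r. d j) / (a - gamma0 M f \<zeta>) \<and>
    Limsup at_top
      (\<lambda>x. ereal (measure M {\<omega> \<in> space M. stationary_dater f T \<zeta> \<omega> > ereal x} / integrated_tail F x))
      \<le> ereal ((\<Sum>j=1..r. d j) / (a - gamma0 M f \<zeta>))"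
proof -
  interpret heavy_tailed_network M K f T \<zeta> a r Y F d
    using assms by (intro heavy_tailed_network.intro heavy_tailed_network_axioms.intro)
  show ?thesis
    using upper_bound_queue_tail_limit[OF assms(2)] unfolding dsum_def .
qed

end
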